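(* For every $\epsilon > 0$ there is a constant $C_\epsilon > 0$ such that the following holds. Let $p > 3$ be a prime, let $a$ be an integer with $\gcd(a, p) = 1$, let $c$ be any integer, and let $H$ be a positive integer with $H \ge C_\epsilon\, p^{1/6 + \epsilon}$. Let $C_{a,c} := \{(x, y) \in (\mathbb{Z}/p\mathbb{Z})^2 : y \equiv a x^3 + c x \pmod p\}$, and for integers $X, Y$ let $B(X, Y; H) := \{(x, y) \in (\mathbb{Z}/p\mathbb{Z})^2 : x \equiv X + i \pmod p,\ y \equiv Y + j \pmod p \text{ for some integers } 1 \le i, j \le H\}$. Then there exist integers $0 \le X, Y \le p - 1$ such that $|C_{a,c} \cap B(X, Y; H)| \ge 2$.
   Context: The box $B(X,Y;H)$ is a square of side length $H$ taken with residues modulo $p$ (wrapping around), and $|S|$ denotes the number of elements of a set $S$. *)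

theory Defs
  imports "HOL-Analysis.Analysis" "HOL-Number_Theory.Cong"
begin

text \<open>Points of (Z/pZ)^2 are represented by their canonical residues in {0..p-1}.\<close>

definition curve_pts :: "int \<Rightarrow> int \<Rightarrow> int \<Rightarrow> (int \<times> int) set" where
  "curve_pts p a c = {(x, y). x \<in> {0..p-1} \<and> y \<in> {0..p-1} \<and> [y = a * x^3 + c * x] (mod p)}"

definition box_pts :: "int \<Rightarrow> int \<Rightarrow> int \<Rightarrow> int \<Rightarrow> (int \<times> int) set" where
  "box_pts p X Y H = {(x, y). x \<in> {0..p-1} \<and> y \<in> {0..p-1} \<and>
     (\<exists>i j. 1 \<le> i \<and> i \<le> H \<and> 1 \<le> j \<and> j \<le> H \<and> [x = X + i] (mod p) \<and> [y = Y + j] (mod p))}"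

end

theory Submission
  imports Defs "HOL-Number_Theory.Number_Theory" "HOL-Real_Asymp.Real_Asymp"
begin

text \<open>
  Suppose that no box of side \<open>H\<close> contains two points, and put \<open>4 A = a\<close> and
  \<open>F(h) = A h\<^sup>3 + c h\<close> modulo \<open>p\<close>. The points with abscissae \<open>x\<close> and \<open>x + h\<close> have ordinates
  differing by \<open>k\<close> iff \<open>x\<close> solves a quadratic equation of discriminant \<open>12 a h (k - F(h))\<close>. So for
  \<open>1 \<le> h < H\<close> the Legendre symbol of \<open>k - F(h)\<close> is a nonzero constant on \<open>0 \<le> k < H\<close>. Consequently,
  if \<open>v x = k - F(h)\<close> with \<open>h, k \<le> H/2\<close> and \<open>v\<close> prime, the symbol is constant on
  \<open>x + 1, \<dots>, x + u\<close> as long as \<open>u v \<le> H/2\<close>.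

  By Weil's bound (proved by Stepanov's method) at most \<open>O(p\<^sup>1\<^sup>/\<^sup>2 log p)\<close> residues \<open>x\<close> start such a
  run of length \<open>log p\<close>. On the other hand the residues \<open>(k - F(h)) / v\<close> are numerous. The values
  \<open>k - F(h)\<close> seldom coincide, because a coincidence is a point on a fixed line modulo \<open>p\<close> with
  coordinates so small that it lies on a rational line, and then a divisor bound applies. Two
  quotients \<open>(k - F(h)) / v = (k' - F(h')) / v'\<close> with \<open>v \<noteq> v'\<close> are rare as well: if several pairs
  \<open>(v, v')\<close> occur for the same \<open>(h, h')\<close>, then \<open>F(h)\<close> and \<open>F(h')\<close> are fractions with small numerator and
  denominator modulo \<open>p\<close>, the coincidence is an identity of integers, and \<open>v\<close>, \<open>v'\<close> divide the
  denominators unless \<open>v\<close> divides one of a few small integers attached to \<open>(h, k)\<close>. This yields more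
  than \<open>p\<^sup>1\<^sup>/\<^sup>2\<^sup>+\<^sup>\<epsilon>\<close> residues \<open>x\<close>, a contradiction.
\<close>

hide_const (open) UnivPoly.coeff UnivPoly.monom Module.smult

subsection \<open>Integer polynomials modulo a prime\<close>

lemma const_dvd_imp_dvd_poly:
  fixes p :: int
  assumes "[:p:] dvd f"
  shows "p dvd poly f a"
  using assms by (auto elim!: dvdE)

text \<open>Gauss's lemma: \<open>[:p:]\<close> is a prime element among the integer polynomials.
  Divisibility by it expresses vanishing over the field with \<open>p\<close> elements, so all
  polynomials can keep integer coefficients.\<close>

lemma prime_const_dvd_mult_iff:
  fixes p :: int
  assumes "prime p"
  shows "[:p:] dvd f * g \<longleftrightarrow> [:p:] dvd f \<or> [:p:] dvd g"
  using assms by (intro prime_elem_dvd_mult_iff lift_prime_elem_poly) auto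

lemma prime_const_dvd_power:
  fixes p :: int
  assumes "prime p" "[:p:] dvd f ^ n"
  shows "[:p:] dvd f"
proof -
  have "prime_elem [:p:]" using assms by (intro lift_prime_elem_poly) auto
  thus ?thesis using assms(2) by (rule prime_elem_dvd_power)
qed

lemma prime_const_not_dvd_linear:
  fixes p :: int
  assumes "prime p"
  shows "\<not> [:p:] dvd [:- a, 1:]"
proof
  assume "[:p:] dvd [:- a, 1:]"
  hence "p dvd coeff [:- a, 1:] 1" by (simp only: const_poly_dvd_iff)
  thus False using assms by (simp add: not_prime_unit)
qed

lemma linear_factor_mod_prime:
  fixes p :: int
  assumes "p dvd poly f a"
  shows "[:p:] dvd f - [:- a, 1:] * synthetic_div f a"
proof -
  have "f - [:- a, 1:] * synthetic_div f a = [:poly f a:]"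
    using synthetic_div_correct'[of a f] by (simp add: algebra_simps)
  thus ?thesis using assms by simp
qed

text \<open>As \<open>g\<close> does not vanish at \<open>b\<close> modulo \<open>p\<close>,
  evaluation at \<open>b\<close> shows that \<open>q\<close> does; one factor
  \<open>[:- b, 1:]\<close> is cancelled and the argument repeats.\<close>

lemma linear_power_dvd_cofactor_mod_prime:
  fixes p :: int
  assumes p: "prime p" and g: "\<not> p dvd poly g b"
    and "[:p:] dvd g * q - [:- b, 1:] ^ l * q'"
  shows "\<exists>q''. [:p:] dvd q - [:- b, 1:] ^ l * q''"
  using assms(3)
proof (induction l arbitrary: q)
  case 0
  show ?case by (intro exI[of _ q]) simp
next
  case (Suc l)
  have "p dvd poly (g * q - [:- b, 1:] ^ Suc l * q') b"
    using Suc.prems by (rule const_dvd_imp_dvd_poly)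
  hence "p dvd poly q b"
    using g p by (auto simp: prime_dvd_mult_iff)
  define q1 where "q1 = synthetic_div q b"
  define X where "X = [:- b, 1:]"
  have q1: "[:p:] dvd q - X * q1"
    using \<open>p dvd poly q b\<close> unfolding q1_def X_def by (rule linear_factor_mod_prime)
  have hyp: "[:p:] dvd g * q - X ^ Suc l * q'" using Suc.prems by (simp only: X_def)
  have "X * (g * q1 - X ^ l * q') = (g * q - X ^ Suc l * q') - g * (q - X * q1)"
    by (simp add: algebra_simps)
  also have "[:p:] dvd \<dots>" by (rule dvd_diff[OF hyp dvd_mult[OF q1]])
  finally have "[:p:] dvd g * q1 - X ^ l * q'"
    using prime_const_dvd_mult_iff[OF p] prime_const_not_dvd_linear[OF p, of b]
    unfolding X_def by blast
  from Suc.IH[OF this[unfolded X_def]] obtain q'' where q'': "[:p:] dvd q1 - X ^ l * q''"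
    unfolding X_def by blast
  have "q - X ^ Suc l * q'' = (q - X * q1) + X * (q1 - X ^ l * q'')"
    by (simp add: algebra_simps)
  also have "[:p:] dvd \<dots>" by (rule dvd_add[OF q1 dvd_mult[OF q'']])
  finally show ?case unfolding X_def by blast
qed

text \<open>The linear factors are pairwise coprime modulo \<open>p\<close>: the product over the
  earlier roots has at \<open>b\<close> a value prime to \<open>p\<close>, so the next power divides
  the remaining cofactor.\<close>

lemma prod_linear_power_dvd_mod_prime:
  fixes p :: int
  assumes p: "prime p" and "finite A"
    and "\<And>a b. a \<in> A \<Longrightarrow> b \<in> A \<Longrightarrow> a \<noteq> b \<Longrightarrow> \<not> p dvd b - a"
    and "\<And>a. a \<in> A \<Longrightarrow> \<exists>q. [:p:] dvd f - [:- a, 1:] ^ l * q"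
  shows "\<exists>q. [:p:] dvd f - (\<Prod>a\<in>A. [:- a, 1:]) ^ l * q"
  using assms(2-)
proof (induction A rule: finite_induct)
  case empty
  show ?case by (intro exI[of _ f]) simp
next
  case (insert b A)
  have "\<exists>q. [:p:] dvd f - (\<Prod>a\<in>A. [:- a, 1:]) ^ l * q"
    using insert.prems by (intro insert.IH) auto
  then obtain q where q: "[:p:] dvd f - (\<Prod>a\<in>A. [:- a, 1:]) ^ l * q" ..
  obtain q' where q': "[:p:] dvd f - [:- b, 1:] ^ l * q'"
    using insert.prems(2)[of b] by auto
  define X where "X = [:- b, 1:]"
  define P where "P = (\<Prod>a\<in>A. [:- a, 1:])"
  let ?g = "P ^ l"
  have "\<not> p dvd poly ?g b"
  proof
    assume "p dvd poly ?g b"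
    hence "p dvd poly P b"
      using p unfolding poly_power by (blast dest: prime_dvd_power)
    hence "p dvd (\<Prod>a\<in>A. b - a)" by (simp add: poly_prod P_def)
    then obtain a where "a \<in> A" "p dvd b - a"
      using p insert.hyps(1) by (auto simp: prime_dvd_prod_iff)
    with insert.prems(1)[of a b] insert.hyps show False by auto
  qed
  moreover have "[:p:] dvd ?g * q - X ^ l * q'"
  proof -
    have "?g * q - X ^ l * q' = (f - X ^ l * q') - (f - ?g * q)" by simp
    also have "[:p:] dvd \<dots>"
      using q' q unfolding X_def P_def by (rule dvd_diff)
    finally show ?thesis .
  qed
  ultimately obtain q'' where q'': "[:p:] dvd q - X ^ l * q''"
    using linear_power_dvd_cofactor_mod_prime[OF p] unfolding X_def by blast
  have "f - (X * P) ^ l * q'' = (f - ?g * q) + ?g * (q - X ^ l * q'')"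
    by (simp add: algebra_simps power_mult_distrib)
  also have "[:p:] dvd \<dots>"
    using q unfolding P_def by (rule dvd_add[OF _ dvd_mult[OF q'']])
  finally show ?case unfolding X_def P_def prod.insert[OF insert.hyps] by blast
qed

lemma degree_le_monic_mult_mod_prime:
  fixes p :: int
  assumes "lead_coeff M = 1" and fq: "[:p:] dvd f - M * q" and f: "\<not> [:p:] dvd f"
  shows "degree M \<le> degree f"
proof -
  \<comment> \<open>Reducing the coefficients removes the top terms of \<open>q\<close> that vanish
    modulo \<open>p\<close>. The leading coefficient of \<open>q1\<close> is then prime to
    \<open>p\<close>, and so is that of \<open>M * q1\<close>.\<close>
  define q1 where "q1 = map_poly (\<lambda>x. x mod p) q"
  have coeff_q1: "coeff q1 n = coeff q n mod p" for n
    by (simp add: q1_def coeff_map_poly)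
  have "[:p:] dvd q - q1"
    by (simp add: const_poly_dvd_iff coeff_q1 minus_mod_eq_mult_div)
  hence "[:p:] dvd (f - M * q) + M * (q - q1)" using fq by (intro dvd_add dvd_mult)
  hence f1: "[:p:] dvd f - M * q1" by (simp add: algebra_simps)
  have "q1 \<noteq> 0" using f f1 by auto
  have "\<not> p dvd lead_coeff q1"
  proof
    assume "p dvd lead_coeff q1"
    hence "lead_coeff q1 = 0" by (simp add: coeff_q1 mod_eq_0_iff_dvd dvd_mod_iff)
    thus False using \<open>q1 \<noteq> 0\<close> by simp
  qed
  moreover have "coeff (M * q1) (degree M + degree q1) = lead_coeff q1"
    using assms(1) by (simp add: coeff_mult_degree_sum)
  ultimately have "\<not> p dvd coeff f (degree M + degree q1)"
    using f1 by (metis coeff_diff const_poly_dvd_iff dvd_diff_right_iff dvd_diff_commute)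
  hence "degree M + degree q1 \<le> degree f" by (metis dvd_0_right le_degree)
  thus ?thesis by simp
qed

text \<open>The product of the \<open>l\<close>-th powers of the linear factors is monic of degree
  \<open>l * card A\<close> and divides \<open>f\<close> modulo \<open>p\<close>.\<close>

lemma card_multiple_roots_mod_prime_le_degree:
  fixes p :: int
  assumes p: "prime p" and "finite A"
    and "\<And>a b. a \<in> A \<Longrightarrow> b \<in> A \<Longrightarrow> a \<noteq> b \<Longrightarrow> \<not> p dvd b - a"
    and "\<And>a. a \<in> A \<Longrightarrow> \<exists>q. [:p:] dvd f - [:- a, 1:] ^ l * q"
    and f: "\<not> [:p:] dvd f"
  shows "l * card A \<le> degree f"
proof -
  let ?M = "(\<Prod>a\<in>A. [:- a, 1:]) ^ l"
  obtain q where "[:p:] dvd f - ?M * q"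
    using prod_linear_power_dvd_mod_prime[OF assms(1-4)] by blast
  moreover have "lead_coeff ?M = 1"
    by (simp only: lead_coeff_power lead_coeff_prod) simp
  ultimately have "degree ?M \<le> degree f" using f by (intro degree_le_monic_mult_mod_prime)
  moreover have "degree ?M = l * card A"
  proof -
    have "degree (\<Prod>a\<in>A. [:- a, 1:]) = (\<Sum>a\<in>A. degree [:- a, 1:])"
      by (rule degree_prod_sum_eq) auto
    thus ?thesis by (subst degree_power_eq) (auto simp: \<open>finite A\<close>)
  qed
  ultimately show ?thesis by simp
qed

lemma higher_pderiv_pcompose_linear:
  "(pderiv ^^ i) (pcompose f [:a, 1:]) = pcompose ((pderiv ^^ i) f) [:a, 1:]"
  by (induction i) (simp_all add: pderiv_pcompose pderiv_pCons)

text \<open>Taylor expansion at \<open>a\<close>: the coefficient of order \<open>i\<close> is the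
  \<open>i\<close>-th derivative divided by \<open>i!\<close>, and \<open>i!\<close> is prime to
  \<open>p\<close> because \<open>i < l \<le> p\<close>.\<close>

lemma linear_power_dvd_mod_prime_if_higher_pderiv:
  fixes p :: int
  assumes p: "prime p" and "int l \<le> p"
    and "\<And>i. i < l \<Longrightarrow> p dvd poly ((pderiv ^^ i) f) a"
  shows "\<exists>q. [:p:] dvd f - [:- a, 1:] ^ l * q"
proof -
  define T where "T = pcompose f [:a, 1:]"
  have T: "p dvd coeff T i" if "i < l" for i
  proof -
    have "poly ((pderiv ^^ i) f) a = poly ((pderiv ^^ i) T) 0"
      by (simp add: T_def higher_pderiv_pcompose_linear poly_pcompose)
    also have "\<dots> = fact i * coeff T i"
      by (simp add: poly_0_coeff_0 coeff_higher_pderiv pochhammer_fact)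
    finally have "p dvd fact i * coeff T i" using assms(3) that by metis
    moreover have "\<not> p dvd fact i"
    proof -
      have "\<not> nat p dvd fact i"
        using p that assms(2) by (subst prime_dvd_fact_iff) auto
      thus ?thesis using p
        by (metis int_dvd_int_iff nat_0_le of_nat_fact prime_ge_0_int)
    qed
    ultimately show ?thesis using p by (simp add: prime_dvd_mult_iff)
  qed
  have "T = monom 1 l * poly_shift l T + poly_cutoff l T"
    by (rule poly_eqI) (auto simp: coeff_poly_cutoff coeff_poly_shift coeff_monom_mult)
  moreover have "[:p:] dvd poly_cutoff l T"
    using T by (auto simp: const_poly_dvd_iff coeff_poly_cutoff)
  ultimately obtain R where R: "T = monom 1 l * poly_shift l T + [:p:] * R"
    by (metis dvdE)
  have "f = pcompose T [:- a, 1:]"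
    unfolding T_def by (simp flip: pcompose_assoc add: pcompose_pCons)
  also have "\<dots> = pcompose (monom 1 l) [:- a, 1:] * pcompose (poly_shift l T) [:- a, 1:] +
      [:p:] * pcompose R [:- a, 1:]"
    by (subst R) (simp only: pcompose_add pcompose_mult pcompose_const)
  also have "pcompose (monom 1 l) [:- a, 1:] = [:- a, 1:] ^ l"
    by (induction l) (simp_all add: monom_Suc pcompose_pCons monom_0 del: mult_pCons_left)
  finally show ?thesis
    by (metis add_diff_cancel_left' dvd_triv_left)
qed

subsection \<open>Stepanov's method for \<open>y\<^sup>2 = f(x)\<close>\<close>

text \<open>Pigeonhole in the manner of Siegel's lemma: there are \<open>p ^ card I\<close>
  assignments of residues and only \<open>p ^ card K\<close> value vectors. The difference of two
  colliding assignments is a nontrivial solution; linearity enters only through differences.\<close>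

lemma exists_nontrivial_solution_mod:
  fixes \<Phi> :: "('i \<Rightarrow> int) \<Rightarrow> 'k \<Rightarrow> int" and p :: int
  assumes "finite I" "finite K" "card K < card I" "p > 1"
    and diff: "\<And>c c' k. k \<in> K \<Longrightarrow> \<Phi> (\<lambda>i. c i - c' i) k = \<Phi> c k - \<Phi> c' k"
  shows "\<exists>c. (\<exists>i\<in>I. \<not> p dvd c i) \<and> (\<forall>k\<in>K. p dvd \<Phi> c k)"
proof -
  define A where "A = PiE I (\<lambda>_. {0..<p})"
  define B where "B = PiE K (\<lambda>_. {0..<p})"
  define g where "g = (\<lambda>c. restrict (\<lambda>k. \<Phi> c k mod p) K)"
  have "card A = nat p ^ card I" "card B = nat p ^ card K" "finite B"
    unfolding A_def B_def using assms(1,2) by (auto simp: card_PiE intro!: finite_PiE)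
  moreover have "g ` A \<subseteq> B" using \<open>p > 1\<close> by (auto simp: g_def B_def)
  ultimately have "card (g ` A) < card A"
    using card_mono[of B "g ` A"] power_strict_increasing[OF assms(3), of "nat p"] \<open>p > 1\<close>
    by linarith
  hence "\<not> inj_on g A" using pigeonhole by blast
  then obtain c c' where c: "c \<in> A" "c' \<in> A" "c \<noteq> c'" "g c = g c'" by (auto simp: inj_on_def)
  then obtain i where i: "i \<in> I" "c i \<noteq> c' i"
    unfolding A_def by (metis PiE_ext)
  have "c i \<in> {0..<p}" "c' i \<in> {0..<p}" using c i by (auto simp: A_def)
  hence "\<bar>c i - c' i\<bar> < p" by auto
  hence "\<not> p dvd c i - c' i" using i dvd_imp_le_int[of "c i - c' i" p] by auto
  moreover have "p dvd \<Phi> (\<lambda>i. c i - c' i) k" if "k \<in> K" for k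
  proof -
    have "\<Phi> c k mod p = \<Phi> c' k mod p" using fun_cong[OF c(4), of k] that by (simp add: g_def)
    thus ?thesis by (simp add: diff[OF that] mod_eq_dvd_iff)
  qed
  ultimately show ?thesis using i by (intro exI[of _ "\<lambda>i. c i - c' i"]) auto
qed

section \<open>Derivatives of the auxiliary polynomial\<close>

primrec power_deriv :: "int poly \<Rightarrow> nat \<Rightarrow> nat \<Rightarrow> int poly \<Rightarrow> int poly" where
  "power_deriv f n 0 r = r"
| "power_deriv f n (Suc i) r =
     smult (int (n - i)) (pderiv f * power_deriv f n i r) + f * pderiv (power_deriv f n i r)"

text \<open>Each application of the product rule costs one factor \<open>f\<close>;
  \<open>power_deriv\<close> collects the cofactor that remains.\<close>

lemma higher_pderiv_power_mult:
  "i \<le> n \<Longrightarrow> (pderiv ^^ i) (f ^ n * r) = f ^ (n - i) * power_deriv f n i r"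
proof (induction i)
  case (Suc i)
  then obtain k where k: "n - i = Suc k" "n - Suc i = k"
    by (metis Suc_diff_Suc Suc_le_eq)
  have "(pderiv ^^ Suc i) (f ^ n * r) = pderiv (f ^ Suc k * power_deriv f n i r)"
    using Suc k by simp
  also have "\<dots> = f ^ k * (smult (int (Suc k)) (pderiv f * power_deriv f n i r) +
      f * pderiv (power_deriv f n i r))"
    unfolding pderiv_mult pderiv_power_Suc by (simp add: algebra_simps smult_add_right smult_add_left)
  finally show ?case using k by simp
qed simp

lemma degree_power_deriv_le:
  "degree (power_deriv f n i r) \<le> degree r + i * degree f"
proof (induction i)
  case (Suc i)
  let ?P = "power_deriv f n i r"
  have "degree (pderiv f * ?P) \<le> degree f + degree ?P"
    by (rule order_trans[OF degree_mult_le]) (simp add: degree_pderiv)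
  moreover have "degree (f * pderiv ?P) \<le> degree f + degree ?P"
    by (rule order_trans[OF degree_mult_le]) (simp add: degree_pderiv)
  ultimately have "degree (power_deriv f n (Suc i) r) \<le> degree f + degree ?P"
    by (auto intro!: degree_add_le order_trans[OF degree_smult_le])
  thus ?case using Suc by simp
qed simp

lemma power_deriv_diff:
  "power_deriv f n i (r - s) = power_deriv f n i r - power_deriv f n i s"
  by (induction i) (simp_all add: right_diff_distrib smult_diff_right pderiv_diff)

text \<open>The derivative of x^(pj) is a multiple of \<open>p\<close>, so modulo \<open>p\<close>
  this monomial behaves like a constant under differentiation.\<close>

lemma higher_pderiv_frobenius_mult:
  "[:int p:] dvd (pderiv ^^ i) (monom 1 (p * j) * q) - monom 1 (p * j) * (pderiv ^^ i) q"
proof (induction i)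
  case (Suc i)
  let ?M = "monom (1::int) (p * j)"
  have dvd_pderiv: "[:int p:] dvd pderiv h" if "[:int p:] dvd h" for h
    using that by (auto simp: const_poly_dvd_iff coeff_pderiv)
  have "[:int p:] dvd pderiv ?M"
    by (auto simp: pderiv_monom const_poly_dvd_iff)
  hence "[:int p:] dvd (pderiv ^^ i) q * pderiv ?M" by simp
  with dvd_pderiv[OF Suc]
  have "[:int p:] dvd pderiv ((pderiv ^^ i) (?M * q) - ?M * (pderiv ^^ i) q) + (pderiv ^^ i) q * pderiv ?M"
    by (rule dvd_add)
  thus ?case by (simp add: pderiv_diff pderiv_mult algebra_simps)
qed simp

text \<open>The factor \<open>f ^ l\<close> leaves room for \<open>l\<close> derivatives. The powers
  x^(pj) raise the degree, yet take the same values as x^j at residues, so vanishing to high order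
  costs only conditions of low degree.\<close>

definition stepanov_poly ::
  "nat \<Rightarrow> int poly \<Rightarrow> nat \<Rightarrow> nat \<Rightarrow> nat \<Rightarrow> (nat \<Rightarrow> int poly) \<Rightarrow> (nat \<Rightarrow> int poly) \<Rightarrow> int poly" where
  "stepanov_poly p f l m J r s = (\<Sum>j<J. monom 1 (p * j) * (f ^ l * r j + f ^ (l + m) * s j))"

text \<open>At points with \<open>f\<^sup>m = 1\<close> and \<open>x\<^sup>p = x\<close>, the \<open>i\<close>-th derivative of the polynomial above
  is the value of this one, up to a power of \<open>f\<close>.\<close>

definition stepanov_cond ::
  "int poly \<Rightarrow> nat \<Rightarrow> nat \<Rightarrow> nat \<Rightarrow> nat \<Rightarrow> (nat \<Rightarrow> int poly) \<Rightarrow> (nat \<Rightarrow> int poly) \<Rightarrow> int poly" where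
  "stepanov_cond f l m J i r s =
     (\<Sum>j<J. monom 1 j * (power_deriv f l i (r j) + power_deriv f (l + m) i (s j)))"

lemma fermat_cong_int:
  assumes "prime p"
  shows "[(x::int) ^ p = x] (mod int p)"
proof (cases "int p dvd x")
  case True
  hence "int p dvd x ^ p" using assms by (simp add: prime_gt_0_nat dvd_power_same dvd_trans dvd_power)
  thus ?thesis using True by (simp add: cong_iff_dvd_diff)
next
  case False
  define y where "y = nat (x mod int p)"
  have xy: "[x = int y] (mod int p)"
    using assms prime_gt_0_nat[of p] by (simp add: y_def cong_def)
  hence "\<not> p dvd y" using False cong_dvd_iff[OF xy] by simp
  hence "[int y ^ (p - 1) = 1] (mod int p)"
    using fermat_theorem[OF assms, of y] by (metis cong_int_iff of_nat_1 of_nat_power)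
  hence "[x ^ (p - 1) = 1] (mod int p)" using cong_pow[OF xy] cong_trans by blast
  hence "[x * x ^ (p - 1) = x * 1] (mod int p)" by (intro cong_mult) auto
  thus ?thesis using assms prime_gt_0_nat[of p] by (simp flip: power_Suc)
qed

lemma dvd_higher_pderiv_stepanov_poly:
  assumes p: "prime p" and i: "i \<le> l"
    and x: "[poly f x ^ m = 1] (mod int p)"
    and cond: "[:int p:] dvd stepanov_cond f l m J i r s"
  shows "int p dvd poly ((pderiv ^^ i) (stepanov_poly p f l m J r s)) x"
proof -
  let ?D = "\<lambda>n. power_deriv f n i"
  have "[poly ((pderiv ^^ i) (monom 1 (p * j) * (f ^ l * r j + f ^ (l + m) * s j))) x =
      poly f x ^ (l - i) * (x ^ j * (poly (?D l (r j)) x + poly (?D (l + m) (s j)) x))] (mod int p)"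
    (is "[?L j = ?R j] (mod _)") for j
  proof -
    let ?q = "f ^ l * r j + f ^ (l + m) * s j"
    have "[?L j = poly (monom 1 (p * j) * (pderiv ^^ i) ?q) x] (mod int p)"
      using const_dvd_imp_dvd_poly[OF higher_pderiv_frobenius_mult[of p i j ?q], of x]
      by (simp add: cong_iff_dvd_diff)
    also have "poly (monom 1 (p * j) * (pderiv ^^ i) ?q) x =
      (x ^ p) ^ j * (poly f x ^ (l - i) * poly (?D l (r j)) x +
        poly f x ^ (l - i) * poly f x ^ m * poly (?D (l + m) (s j)) x)"
    proof -
      have "(pderiv ^^ i) (f ^ (l + m) * s j) = f ^ (l - i) * f ^ m * ?D (l + m) (s j)"
        using i higher_pderiv_power_mult[of i "l + m" f "s j"] by (simp flip: power_add)
      thus ?thesis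
        using higher_pderiv_power_mult[OF i, of f "r j"]
        by (simp only: higher_pderiv_add poly_monom power_mult poly_mult poly_add poly_power mult_1)
    qed
    also have "[\<dots> = x ^ j * (poly f x ^ (l - i) * poly (?D l (r j)) x +
        poly f x ^ (l - i) * 1 * poly (?D (l + m) (s j)) x)] (mod int p)"
      by (intro cong_mult cong_add cong_refl cong_pow fermat_cong_int p x)
    finally show ?thesis by (simp add: algebra_simps)
  qed
  hence "[(\<Sum>j<J. ?L j) = (\<Sum>j<J. ?R j)] (mod int p)" by (intro cong_sum)
  also have "(\<Sum>j<J. ?R j) = poly f x ^ (l - i) * poly (stepanov_cond f l m J i r s) x"
    by (simp add: stepanov_cond_def poly_sum poly_monom sum_distrib_left)
  also have "[\<dots> = 0] (mod int p)"
    using const_dvd_imp_dvd_poly[OF cond] by (simp add: cong_0_iff)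
  finally show ?thesis
    by (simp add: stepanov_poly_def higher_pderiv_sum poly_sum cong_0_iff)
qed

section \<open>Nonvanishing of the auxiliary polynomial modulo \<open>p\<close>\<close>

lemma coeff_power_prime_dvd:
  assumes "prime p" "0 < i" "i < p"
  shows "int p dvd coeff (f ^ p) i"
proof -
  obtain k where k: "i = Suc k" using assms by (cases i) auto
  obtain p' where p': "p = Suc p'" using assms by (cases p) auto
  \<comment> \<open>The derivative of \<open>f ^ p\<close> is a multiple of \<open>p\<close>, and
    its coefficients are those of \<open>f ^ p\<close> times indices prime to
    \<open>p\<close>.\<close>
  have "pderiv (f ^ p) = smult (int p) (f ^ p' * pderiv f)"
    unfolding p' pderiv_power_Suc by simp
  hence "coeff (pderiv (f ^ p)) k = int p * coeff (f ^ p' * pderiv f) k" by simp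
  hence "int p dvd int i * coeff (f ^ p) i" unfolding coeff_pderiv k by simp
  moreover have "\<not> int p dvd int i" using assms by (simp add: nat_dvd_not_less)
  ultimately show ?thesis using assms(1) by (simp add: prime_dvd_mult_iff)
qed

text \<open>Parity of the order of vanishing at the simple root \<open>a\<close>: odd for the
  product of \<open>r ^ 2\<close> with the polynomial, even for \<open>s ^ 2\<close>. The descent
  strips one linear factor from \<open>s\<close>, then one from \<open>r\<close>, and the degree of
  \<open>s\<close> drops.\<close>

lemma square_mult_simple_root_mod_prime:
  fixes p c :: int
  assumes p: "prime p" and c: "\<not> p dvd c" and f1: "\<not> p dvd poly f1 a"
    and "[:p:] dvd r ^ 2 * ([:- a, 1:] * f1) - smult c (s ^ 2)"
  shows "[:p:] dvd s"
  using assms(4)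
proof (induction "degree s" arbitrary: r s rule: less_induct)
  case less
  define X where "X = [:- a, 1:]"
  note X = prime_const_not_dvd_linear[OF p, of a, folded X_def]
  have eq: "[:p:] dvd r ^ 2 * (X * f1) - smult c (s ^ 2)" using less.prems by (simp only: X_def)
  have "p dvd c * poly s a ^ 2" using const_dvd_imp_dvd_poly[OF eq, of a] by (simp add: X_def)
  hence "p dvd poly s a" using c p by (auto simp: prime_dvd_mult_iff dest: prime_dvd_power)
  define s1 where "s1 = synthetic_div s a"
  have s1: "[:p:] dvd s - X * s1"
    using linear_factor_mod_prime[OF \<open>p dvd poly s a\<close>] by (simp only: s1_def X_def)
  show ?case
  proof (cases "degree s = 0")
    case True
    then obtain b where "s = [:b:]" by (metis degree_eq_zeroE)
    thus ?thesis using \<open>p dvd poly s a\<close> by simp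
  next
    case False
    have "X * (r ^ 2 * f1 - smult c (X * s1 ^ 2)) =
        (r ^ 2 * (X * f1) - smult c (s ^ 2)) + smult c (s + X * s1) * (s - X * s1)"
      by (simp add: algebra_simps power2_eq_square smult_add_right smult_diff_right)
    also have "[:p:] dvd \<dots>" by (rule dvd_add[OF eq dvd_mult[OF s1]])
    finally have eq1: "[:p:] dvd r ^ 2 * f1 - smult c (X * s1 ^ 2)"
      using prime_const_dvd_mult_iff[OF p] X by blast
    have "p dvd poly r a ^ 2 * poly f1 a" using const_dvd_imp_dvd_poly[OF eq1, of a] by (simp add: X_def)
    hence "p dvd poly r a" using f1 p by (auto simp: prime_dvd_mult_iff dest: prime_dvd_power)
    define r1 where "r1 = synthetic_div r a"
    have r1: "[:p:] dvd r - X * r1"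
      using linear_factor_mod_prime[OF \<open>p dvd poly r a\<close>] by (simp only: r1_def X_def)
    have "X * (r1 ^ 2 * (X * f1) - smult c (s1 ^ 2)) =
        (r ^ 2 * f1 - smult c (X * s1 ^ 2)) - (r + X * r1) * f1 * (r - X * r1)"
      by (simp add: algebra_simps power2_eq_square)
    also have "[:p:] dvd \<dots>" by (rule dvd_diff[OF eq1 dvd_mult[OF r1]])
    finally have "[:p:] dvd r1 ^ 2 * (X * f1) - smult c (s1 ^ 2)"
      using prime_const_dvd_mult_iff[OF p] X by blast
    moreover have "degree s1 < degree s" using False by (simp add: s1_def degree_synthetic_div)
    ultimately have "[:p:] dvd s1" using less.hyps[of s1 r1] by (simp only: X_def)
    hence "[:p:] dvd (s - X * s1) + X * s1" using s1 by (intro dvd_add dvd_mult)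
    thus ?thesis by simp
  qed
qed

text \<open>If the polynomial vanished, division by \<open>f ^ l\<close> and by a power of
  \<open>Y\<close>, which is x^p, would leave \<open>\<rho> + f ^ m * \<sigma>\<close> equal to 0
  with m = (p - 1) / 2, and hence \<open>\<rho> ^ 2 * f\<close> equal to
  \<open>f ^ p * \<sigma> ^ 2\<close>. Modulo \<open>p\<close> and \<open>Y\<close> the power
  \<open>f ^ p\<close> is a constant \<open>c\<close>, so comparing terms of degree below
  \<open>p\<close> makes \<open>f\<close> times a square equal to \<open>c\<close> times a square.
  The simple root of \<open>f\<close> forbids this.\<close>

lemma stepanov_poly_nonzero_mod:
  assumes p: "prime p" "odd p" and f: "f = [:- a, 1:] * f1" and f1: "\<not> int p dvd poly f1 a"
    and f0: "\<not> int p dvd coeff f 0"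
    and deg: "\<And>j. j < J \<Longrightarrow> 2 * degree (r j) + degree f < p" "\<And>j. j < J \<Longrightarrow> 2 * degree (s j) < p"
    and nz: "\<exists>j<J. \<not> ([:int p:] dvd r j \<and> [:int p:] dvd s j)"
  shows "\<not> [:int p:] dvd stepanov_poly p f l ((p - 1) div 2) J r s"
proof
  let ?P = "[:int p:]" and ?m = "(p - 1) div 2"
  assume zero: "?P dvd stepanov_poly p f l ?m J r s"
  have pi: "prime (int p)" using p by simp
  have fnz: "\<not> ?P dvd f" using f0 by (auto simp: const_poly_dvd_iff)
  \<comment> \<open>The lowest index with a coefficient that survives modulo \<open>p\<close>;
    \<open>r j0\<close> and \<open>s j0\<close> are the residues of \<open>\<rho>\<close> and
    \<open>\<sigma>\<close> modulo \<open>Y\<close>.\<close>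
  define j0 where "j0 = (LEAST j. j < J \<and> \<not> (?P dvd r j \<and> ?P dvd s j))"
  have j0: "j0 < J" "\<not> (?P dvd r j0 \<and> ?P dvd s j0)"
    using LeastI_ex[OF nz] unfolding j0_def by auto
  have below: "?P dvd r j" "?P dvd s j" if "j < j0" for j
    using not_less_Least[of j "\<lambda>j. j < J \<and> \<not> (?P dvd r j \<and> ?P dvd s j)"] that j0(1)
    unfolding j0_def[symmetric] by auto
  define Y where "Y = monom (1::int) p"
  define R where "R = (\<Sum>j\<in>{Suc j0..<J}. Y ^ (j - Suc j0) * r j)"
  define S where "S = (\<Sum>j\<in>{Suc j0..<J}. Y ^ (j - Suc j0) * s j)"
  define \<rho> where "\<rho> = r j0 + Y * R"
  define \<sigma> where "\<sigma> = s j0 + Y * S"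
  have Ypow: "monom 1 (p * j) = Y ^ j" for j by (simp add: Y_def monom_power)
  let ?t = "\<lambda>j. Y ^ j * (f ^ l * r j + f ^ (l + ?m) * s j)"
  have "stepanov_poly p f l ?m J r s = sum ?t {..<J}"
    by (simp add: stepanov_poly_def Ypow)
  also have "{..<J} = {..<j0} \<union> insert j0 {Suc j0..<J}" using j0(1) by auto
  also have "sum ?t \<dots> = sum ?t {..<j0} + (?t j0 + sum ?t {Suc j0..<J})"
    by (subst sum.union_disjoint) auto
  also have "sum ?t {Suc j0..<J} =
      (\<Sum>j\<in>{Suc j0..<J}. Y ^ j0 * Y * Y ^ (j - Suc j0) * (f ^ l * r j + f ^ (l + ?m) * s j))"
  proof (intro sum.cong refl)
    fix j assume "j \<in> {Suc j0..<J}"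
    hence "Y ^ j = Y ^ (Suc j0 + (j - Suc j0))" by simp
    also have "\<dots> = Y ^ j0 * Y * Y ^ (j - Suc j0)" by (simp only: power_add power_Suc2)
    finally show "?t j = Y ^ j0 * Y * Y ^ (j - Suc j0) * (f ^ l * r j + f ^ (l + ?m) * s j)" by simp
  qed
  also have "\<dots> = Y ^ j0 * Y * f ^ l * (R + f ^ ?m * S)"
    by (simp add: R_def S_def sum_distrib_left sum.distrib algebra_simps power_add)
  also have "?t j0 + Y ^ j0 * Y * f ^ l * (R + f ^ ?m * S) = Y ^ j0 * f ^ l * (\<rho> + f ^ ?m * \<sigma>)"
    by (simp add: \<rho>_def \<sigma>_def algebra_simps power_add)
  finally have "?P dvd sum ?t {..<j0} + Y ^ j0 * f ^ l * (\<rho> + f ^ ?m * \<sigma>)" using zero by simp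
  moreover have "?P dvd sum ?t {..<j0}" using below by (intro dvd_sum dvd_mult dvd_add) auto
  ultimately have "?P dvd Y ^ j0 * f ^ l * (\<rho> + f ^ ?m * \<sigma>)" using dvd_add_right_iff by blast
  moreover have "\<not> ?P dvd Y ^ j0"
  proof
    assume "?P dvd Y ^ j0"
    hence "?P dvd Y" using prime_const_dvd_power[OF pi] by blast
    hence "int p dvd coeff Y p" by (simp only: const_poly_dvd_iff)
    thus False using p by (auto simp: Y_def)
  qed
  moreover have "\<not> ?P dvd f ^ l" using fnz prime_const_dvd_power[OF pi] by blast
  ultimately have key: "?P dvd \<rho> + f ^ ?m * \<sigma>"
    using prime_const_dvd_mult_iff[OF pi] by blast
  \<comment> \<open>As p = 2m + 1, multiplication by \<open>f\<close> times the conjugate of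
    \<open>\<rho> + f ^ m * \<sigma>\<close> produces exactly \<open>f ^ p\<close>.\<close>
  have "p = Suc (?m + ?m)" using p by (auto elim!: oddE)
  hence fp: "f ^ p = f * f ^ ?m * f ^ ?m" by (metis mult.assoc power_Suc power_add)
  have "\<rho> ^ 2 * f - f ^ p * \<sigma> ^ 2 = f * (\<rho> - f ^ ?m * \<sigma>) * (\<rho> + f ^ ?m * \<sigma>)"
    unfolding fp by (simp add: algebra_simps power2_eq_square)
  hence key2: "?P dvd \<rho> ^ 2 * f - f ^ p * \<sigma> ^ 2" using key by simp
  define c where "c = coeff (f ^ p) 0"
  have "coeff f 0 ^ p = c" by (simp add: c_def coeff_0_power)
  hence c: "\<not> int p dvd c" using f0 pi prime_dvd_power by blast
  define K where "K = poly_shift p (f ^ p)"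
  define L where "L = poly_cutoff p (f ^ p) - [:c:]"
  have fpdec: "f ^ p = [:c:] + L + Y * K"
    unfolding K_def L_def Y_def
    by (rule poly_eqI) (auto simp: coeff_poly_cutoff coeff_poly_shift coeff_monom_mult)
  have L: "?P dvd L"
    unfolding const_poly_dvd_iff L_def c_def
    using coeff_power_prime_dvd[OF p(1)] prime_gt_0_nat[OF p(1)] by (auto simp: coeff_poly_cutoff coeff_pCons split: nat.splits)
  define Z where "Z = 2 * r j0 * R * f + Y * R ^ 2 * f - K * \<sigma> ^ 2 - [:c:] * (2 * s j0 * S + Y * S ^ 2)"
  have "\<rho> ^ 2 * f - f ^ p * \<sigma> ^ 2 = (r j0 ^ 2 * f - [:c:] * s j0 ^ 2) + Y * Z - L * \<sigma> ^ 2"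
  proof -
    have "(u + y * v) ^ 2 * f - (k + L + y * K) * w ^ 2 = (u ^ 2 * f - k * x ^ 2) +
        y * (2 * u * v * f + y * v ^ 2 * f - K * w ^ 2 - k * (2 * x * z + y * z ^ 2)) - L * w ^ 2"
      if "w = x + y * z" for u v w x y z k :: "int poly"
      by (simp add: that algebra_simps power2_eq_square)
    from this[OF \<sigma>_def] show ?thesis unfolding fpdec Z_def by (simp only: \<rho>_def)
  qed
  moreover have "?P dvd L * \<sigma> ^ 2" using L by simp
  ultimately have key3: "?P dvd (r j0 ^ 2 * f - [:c:] * s j0 ^ 2) + Y * Z"
    using key2 by (metis diff_add_cancel dvd_add)
  have deg2: "degree (r j0 ^ 2 * f - [:c:] * s j0 ^ 2) < p"
  proof (rule degree_diff_less)
    show "degree (r j0 ^ 2 * f) < p"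
      using deg(1)[OF j0(1)] degree_mult_le[of "r j0 ^ 2" f] degree_power_le[of "r j0" 2] by linarith
    show "degree ([:c:] * s j0 ^ 2) < p"
      using deg(2)[OF j0(1)] degree_mult_le[of "[:c:]" "s j0 ^ 2"] degree_power_le[of "s j0" 2]
      by (simp only: degree_pCons_0)
  qed
  \<comment> \<open>Below degree \<open>p\<close> the multiple of \<open>Y\<close> contributes
    nothing, and from degree \<open>p\<close> on the difference has no coefficients, so the relation
    modulo \<open>Y\<close> holds exactly.\<close>
  have fin: "?P dvd r j0 ^ 2 * f - smult c (s j0 ^ 2)"
    unfolding const_poly_dvd_iff
  proof
    fix i
    show "int p dvd coeff (r j0 ^ 2 * f - smult c (s j0 ^ 2)) i"
    proof (cases "i < p")
      case True
      hence "coeff (Y * Z) i = 0" by (simp add: Y_def coeff_monom_mult)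
      moreover have "int p dvd coeff ((r j0 ^ 2 * f - [:c:] * s j0 ^ 2) + Y * Z) i"
        using key3 by (simp only: const_poly_dvd_iff)
      ultimately show ?thesis by simp
    next
      case False
      hence "coeff (r j0 ^ 2 * f - [:c:] * s j0 ^ 2) i = 0" using deg2 by (intro coeff_eq_0) simp
      thus ?thesis by simp
    qed
  qed
  have s0: "?P dvd s j0"
    using square_mult_simple_root_mod_prime[OF pi c f1] fin unfolding f by blast
  have "?P dvd (r j0 ^ 2 * f - smult c (s j0 ^ 2)) + [:c:] * s j0 * s j0"
    by (rule dvd_add[OF fin dvd_mult[OF s0]])
  hence "?P dvd r j0 ^ 2 * f" by (simp add: power2_eq_square algebra_simps)
  hence "?P dvd r j0"
    using fnz prime_const_dvd_mult_iff[OF pi] prime_const_dvd_power[OF pi] by blast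
  with s0 j0(2) show False by simp
qed

section \<open>Existence of the auxiliary polynomial and the resulting point count\<close>

lemma exists_stepanov_coefficients:
  assumes p: "prime p" and B: "B > 0" and J: "J > 0" and deg: "degree f \<le> d"
    and count: "l * (J + B + l * d) < 2 * J * B"
  shows "\<exists>r s. (\<forall>j. degree (r j) < B \<and> degree (s j) < B) \<and>
    (\<exists>j<J. \<not> ([:int p:] dvd r j \<and> [:int p:] dvd s j)) \<and>
    (\<forall>i<l. [:int p:] dvd stepanov_cond f l m J i r s)"
proof -
  \<comment> \<open>One unknown for every coefficient of every \<open>r j\<close> and
    \<open>s j\<close>, the boolean telling the two families apart. Each of the \<open>l\<close>
    conditions is a polynomial of degree below \<open>M\<close>, so it amounts to \<open>M\<close>
    linear equations.\<close>
  define I where "I = {..<J} \<times> {..<B} \<times> (UNIV :: bool set)"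
  define M where "M = J + B + l * d"
  define K where "K = {..<l} \<times> {..<M}"
  define q :: "(nat \<times> nat \<times> bool \<Rightarrow> int) \<Rightarrow> bool \<Rightarrow> nat \<Rightarrow> int poly"
    where "q = (\<lambda>c t j. \<Sum>b<B. monom (c (j, b, t)) b)"
  have coeff_q: "coeff (q c t j) b = (if b < B then c (j, b, t) else 0)" for c t j b
    by (simp add: q_def coeff_sum)
  have deg_q: "degree (q c t j) < B" for c t j
    using B by (intro degree_lessI) (auto simp: coeff_q)
  have q_diff: "q (\<lambda>i. c i - c' i) t j = q c t j - q c' t j" for c c' t j
    by (rule poly_eqI) (simp add: coeff_q)
  define \<Phi> where "\<Phi> = (\<lambda>c (i, t). coeff (stepanov_cond f l m J i (q c True) (q c False)) t)"
  have "\<exists>c. (\<exists>i\<in>I. \<not> int p dvd c i) \<and> (\<forall>k\<in>K. int p dvd \<Phi> c k)"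
  proof (rule exists_nontrivial_solution_mod)
    show "card K < card I" using count by (simp add: K_def I_def M_def card_cartesian_product algebra_simps)
    show "\<Phi> (\<lambda>i. c i - c' i) k = \<Phi> c k - \<Phi> c' k" for c c' k
    proof (cases k)
      case (Pair i t)
      have "stepanov_cond f l m J i (q (\<lambda>i. c i - c' i) True) (q (\<lambda>i. c i - c' i) False) =
        stepanov_cond f l m J i (q c True) (q c False) - stepanov_cond f l m J i (q c' True) (q c' False)"
        unfolding stepanov_cond_def
        by (simp add: q_diff power_deriv_diff algebra_simps flip: sum_subtractf)
      thus ?thesis by (simp add: \<Phi>_def Pair)
    qed
  qed (use prime_gt_1_nat[OF p] in \<open>auto simp: I_def K_def\<close>)
  then obtain c where c: "\<exists>i\<in>I. \<not> int p dvd c i" "\<And>k. k \<in> K \<Longrightarrow> int p dvd \<Phi> c k" by blast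
  from c(1) obtain j b t where jbt: "j < J" "b < B" "\<not> int p dvd c (j, b, t)" by (auto simp: I_def)
  hence "\<not> int p dvd coeff (q c t j) b" by (simp add: coeff_q)
  hence "\<not> [:int p:] dvd q c t j" by (auto simp: const_poly_dvd_iff)
  hence "\<not> ([:int p:] dvd q c True j \<and> [:int p:] dvd q c False j)" by (cases t) auto
  moreover have "[:int p:] dvd stepanov_cond f l m J i (q c True) (q c False)" if i: "i < l" for i
    unfolding const_poly_dvd_iff
  proof
    fix t
    show "int p dvd coeff (stepanov_cond f l m J i (q c True) (q c False)) t" (is "_ dvd coeff ?C t")
    proof (cases "t < M")
      case True
      thus ?thesis using c(2)[of "(i, t)"] i by (simp add: K_def \<Phi>_def)
    next
      case False
      have pd: "degree (power_deriv f n i (q c u j)) \<le> (B - 1) + l * d" for n u j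
      proof -
        have "i * degree f \<le> l * d" using i deg by (intro mult_le_mono) auto
        thus ?thesis using degree_power_deriv_le[of f n i "q c u j"] deg_q[of c u j] by linarith
      qed
      have "degree ?C \<le> (J - 1) + ((B - 1) + l * d)"
        unfolding stepanov_cond_def
      proof (rule degree_sum_le)
        fix j assume "j \<in> {..<J}"
        show "degree (monom 1 j * (power_deriv f l i (q c True j) + power_deriv f (l + m) i (q c False j)))
            \<le> (J - 1) + ((B - 1) + l * d)"
          using \<open>j \<in> {..<J}\<close>
          by (intro order_trans[OF degree_mult_le] add_mono order_trans[OF degree_monom_le]
              degree_add_le pd) auto
      qed auto
      hence "coeff ?C t = 0" using False B J by (intro coeff_eq_0) (auto simp: M_def)
      thus ?thesis by simp
    qed
  qed
  ultimately show ?thesis using jbt(1) deg_q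
    by (intro exI[of _ "q c True"] exI[of _ "q c False"]) blast
qed

lemma degree_stepanov_poly_le:
  assumes "\<And>j. degree (r j) < B" "\<And>j. degree (s j) < B" "degree f \<le> d"
  shows "degree (stepanov_poly p f l m J r s) \<le> p * (J - 1) + (d * (l + m) + B)"
  unfolding stepanov_poly_def
proof (rule degree_sum_le)
  fix j assume j: "j \<in> {..<J}"
  have pow: "degree (f ^ n) \<le> d * (l + m)" if "n \<le> l + m" for n
    using degree_power_le[of f n] mult_le_mono[OF assms(3) that] by linarith
  have "degree (f ^ l * r j) \<le> d * (l + m) + B" "degree (f ^ (l + m) * s j) \<le> d * (l + m) + B"
    using assms(1,2)[of j] by (auto intro!: order_trans[OF degree_mult_le] add_mono pow)
  hence "degree (f ^ l * r j + f ^ (l + m) * s j) \<le> d * (l + m) + B" by (rule degree_add_le)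
  moreover have "degree (monom (1::int) (p * j)) \<le> p * (J - 1)"
    using j by (intro order_trans[OF degree_monom_le] mult_le_mono2) auto
  ultimately show "degree (monom 1 (p * j) * (f ^ l * r j + f ^ (l + m) * s j)) \<le>
      p * (J - 1) + (d * (l + m) + B)"
    by (intro order_trans[OF degree_mult_le] add_mono)
qed auto

text \<open>Every counted residue is a root of order \<open>l\<close> of an auxiliary polynomial
  that is nonzero modulo \<open>p\<close>, so its degree bounds \<open>l\<close> times their
  number.\<close>

lemma card_points_le_stepanov:
  assumes p: "prime p" "odd p" and f: "f = [:- a, 1:] * f1" and f1: "\<not> int p dvd poly f1 a"
    and f0: "\<not> int p dvd coeff f 0" and deg: "degree f \<le> d"
    and B: "B > 0" "2 * B + d \<le> p" and J: "J > 0" and l: "l \<le> p"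
    and count: "l * (J + B + l * d) < 2 * J * B"
  shows "l * card {x \<in> {0..<int p}. [poly f x ^ ((p - 1) div 2) = 1] (mod int p)}
    \<le> p * (J - 1) + (d * (l + (p - 1) div 2) + B)"
proof -
  let ?m = "(p - 1) div 2"
  obtain r s where rs: "\<And>j. degree (r j) < B" "\<And>j. degree (s j) < B"
      "\<exists>j<J. \<not> ([:int p:] dvd r j \<and> [:int p:] dvd s j)"
      "\<And>i. i < l \<Longrightarrow> [:int p:] dvd stepanov_cond f l ?m J i r s"
    using exists_stepanov_coefficients[OF p(1) B(1) J deg count, of ?m] by blast
  let ?h = "stepanov_poly p f l ?m J r s"
  let ?A = "{x \<in> {0..<int p}. [poly f x ^ ?m = 1] (mod int p)}"
  have "l * card ?A \<le> degree ?h"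
  proof (rule card_multiple_roots_mod_prime_le_degree)
    show "prime (int p)" using p by simp
    show "\<not> int p dvd b - a" if "a \<in> ?A" "b \<in> ?A" "a \<noteq> b" for a b
    proof
      assume "int p dvd b - a"
      hence "int p \<le> \<bar>b - a\<bar>" using that(3) dvd_imp_le_int[of "b - a" "int p"] by simp
      thus False using that by auto
    qed
    show "\<exists>q. [:int p:] dvd ?h - [:- x, 1:] ^ l * q" if "x \<in> ?A" for x
      using that p l rs(4)
      by (intro linear_power_dvd_mod_prime_if_higher_pderiv dvd_higher_pderiv_stepanov_poly) auto
    have "2 * degree (r j) + degree f < p" "2 * degree (s j) < p" for j
      using rs(1,2)[of j] B deg by linarith+
    thus "\<not> [:int p:] dvd ?h"
      by (intro stepanov_poly_nonzero_mod[OF p f f1 f0] rs(3))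
    show "finite ?A" by (rule finite_subset[of _ "{0..<int p}"]) auto
  qed
  also have "degree ?h \<le> p * (J - 1) + (d * (l + ?m) + B)"
    by (rule degree_stepanov_poly_le[OF rs(1,2) deg])
  finally show ?thesis .
qed

text \<open>Multiplicity \<open>l = 2t\<close> with \<open>t\<close> about \<open>sqrt p / 2\<close> balances the two error terms.\<close>

lemma card_points_le_of_parameter:
  assumes p: "prime p" "odd p" and f: "f = [:- a, 1:] * f1" and f1: "\<not> int p dvd poly f1 a"
    and f0: "\<not> int p dvd coeff f 0" and deg: "degree f \<le> d" and d: "d \<ge> 1"
    and t: "t \<ge> 1" "4 * t ^ 2 \<le> p" "4 * (d + 1 + 2 * t) \<le> p"
  shows "4 * t * card {x \<in> {0..<int p}. [poly f x ^ ((p - 1) div 2) = 1] (mod int p)}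
    \<le> 2 * p * t + 6 * d * p + 4 * d * t"
proof -
  define n where "n = card {x \<in> {0..<int p}. [poly f x ^ ((p - 1) div 2) = 1] (mod int p)}"
  \<comment> \<open>\<open>B\<close> is as large as \<open>2 * B + d \<le> p\<close> permits. With
    multiplicity \<open>2 * t\<close>, taking \<open>J = t\<close> would leave too few unknowns; the
    surplus \<open>2 * d + 1\<close> tips the balance.\<close>
  define B where "B = (p - d) div 2"
  define J where "J = t + 2 * d + 1"
  have B: "p - d - 1 \<le> 2 * B" "2 * B \<le> p - d" by (auto simp: B_def)
  have "2 * t * (J + B + 2 * t * d) < 2 * J * B"
  proof -
    have "real (2 * t * (J + B + 2 * t * d)) < real (2 * J * B)"
    proof -
      define P D T b where "P = real p" "D = real d" "T = real t" "b = real B"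
      have 1: "P - D - 1 \<le> 2 * b" using B(1) t unfolding P_D_T_b_def by linarith
      have 2: "4 * T\<^sup>2 \<le> P" using t(2) unfolding P_D_T_b_def
        by (metis of_nat_le_iff of_nat_mult of_nat_numeral of_nat_power)
      have 3: "4 * (D + 1 + 2 * T) \<le> P"
        using of_nat_mono[OF t(3), where 'a = real] unfolding P_D_T_b_def by simp
      have 4: "T \<ge> 1" "D \<ge> 1" using t d unfolding P_D_T_b_def by auto
      have "(2 * D + 1) * (3 / 4 * P) \<le> (2 * D + 1) * (P - D - 1 - 2 * T)"
        using 3 4 by (intro mult_left_mono) auto
      also have "\<dots> \<le> (2 * D + 1) * (2 * b - 2 * T)" using 1 4 by (intro mult_left_mono) auto
      finally have 5: "(2 * D + 1) * (3 / 4 * P) \<le> (2 * D + 1) * (2 * b - 2 * T)" .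
      have 6: "T\<^sup>2 * (2 + 4 * D) \<le> P / 4 * (2 + 4 * D)" using 2 4 by (intro mult_right_mono) auto
      have 7: "(2 * D + 1) * (3 / 4 * P) - P / 4 * (2 + 4 * D) = (2 * D + 1) / 4 * P" by (simp add: field_simps)
      have "P > 0" using t unfolding P_D_T_b_def by simp
      hence 8: "(2 * D + 1) / 4 * P > 0" using 4 by simp
      have "2 * (T + 2 * D + 1) * b - 2 * T * ((T + 2 * D + 1) + b + 2 * T * D) =
          (2 * D + 1) * (2 * b - 2 * T) - T\<^sup>2 * (2 + 4 * D)"
        by (simp add: algebra_simps power2_eq_square)
      with 5 6 7 8 have "2 * T * ((T + 2 * D + 1) + b + 2 * T * D) < 2 * (T + 2 * D + 1) * b" by linarith
      thus ?thesis
        by (simp only: P_D_T_b_def J_def of_nat_mult of_nat_add of_nat_numeral of_nat_1)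
    qed
    thus ?thesis by (simp only: of_nat_less_iff)
  qed
  moreover have "B > 0" "2 * B + d \<le> p" "J > 0" "2 * t \<le> p"
    using B t by (auto simp: J_def)
  ultimately have "2 * t * n \<le> p * (J - 1) + (d * (2 * t + (p - 1) div 2) + B)"
    unfolding n_def by (intro card_points_le_stepanov[OF p f f1 f0 deg])
  hence "2 * (2 * t * n) \<le> 2 * (p * (t + 2 * d) + (d * (2 * t + (p - 1) div 2) + B))"
    by (simp add: J_def)
  also have "\<dots> = 2 * (p * (t + 2 * d)) + (d * (4 * t + 2 * ((p - 1) div 2)) + 2 * B)"
    by (simp add: distrib_left)
  also have "\<dots> \<le> 2 * (p * (t + 2 * d)) + (d * (4 * t + p) + d * p)"
  proof (intro add_left_mono add_mono mult_left_mono)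
    show "2 * ((p - 1) div 2) \<le> p" by simp
    show "2 * B \<le> d * p" using B(2) mult_le_mono1[OF d, of p] by linarith
  qed simp
  also have "\<dots> = 2 * p * t + 6 * d * p + 4 * d * t" by (simp add: algebra_simps)
  finally show ?thesis by (simp add: n_def)
qed

subsection \<open>Runs of the Legendre symbol\<close>

lemma Legendre_cong:
  assumes "[a = b] (mod p)"
  shows "Legendre a p = Legendre b p"
  using assms by (simp add: Legendre_def QuadRes_def cong_def)

lemma Legendre_range: "Legendre a p \<in> {-1, 0, 1}"
  by (auto simp: Legendre_def)

lemma cong_small_imp_eq:
  fixes p :: int
  assumes "[a = b] (mod p)" "\<bar>a - b\<bar> < p"
  shows "a = b"
  using assms dvd_imp_le_int[of "a - b" p] by (force simp: cong_iff_dvd_diff)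

text \<open>Euler's criterion gives the congruence, and numbers in {-1, 0, 1} that are congruent
  modulo \<open>p > 2\<close> are equal.\<close>

lemma Legendre_mult:
  assumes "prime p" "2 < p"
  shows "Legendre (a * b) (int p) = Legendre a (int p) * Legendre b (int p)"
proof (rule cong_small_imp_eq)
  let ?m = "(p - 1) div 2"
  have "[Legendre (a * b) (int p) = a ^ ?m * b ^ ?m] (mod int p)"
    using euler_criterion[OF assms, of "a * b"] by (simp add: power_mult_distrib)
  also have "[a ^ ?m * b ^ ?m = Legendre a (int p) * Legendre b (int p)] (mod int p)"
    by (intro cong_mult cong_sym[OF euler_criterion[OF assms]])
  finally show "[Legendre (a * b) (int p) = Legendre a (int p) * Legendre b (int p)] (mod int p)" .
  show "\<bar>Legendre (a * b) (int p) - Legendre a (int p) * Legendre b (int p)\<bar> < int p"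
    using Legendre_range[of a "int p"] Legendre_range[of b "int p"] Legendre_range[of "a * b" "int p"] assms
    by auto
qed

lemma Legendre_1: "p > 1 \<Longrightarrow> Legendre 1 p = 1"
  by (auto simp: Legendre_def QuadRes_def cong_def intro!: exI[of _ 1])

lemma Legendre_prod:
  assumes "prime p" "2 < p" "finite T"
  shows "Legendre (\<Prod>i\<in>T. f i) (int p) = (\<Prod>i\<in>T. Legendre (f i) (int p))"
  using assms(3) by induction (use assms in \<open>simp_all add: Legendre_1 Legendre_mult\<close>)

lemma Legendre_eq_1_imp_cong:
  assumes "prime p" "2 < p" "Legendre a (int p) = 1"
  shows "[a ^ ((p - 1) div 2) = 1] (mod int p)"
  using euler_criterion[OF assms(1,2), of a] assms(3) by (simp add: cong_sym)

text \<open>The sum is twice the number of residues with symbol 1, plus the number of zeros, minus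
  \<open>p\<close>; Stepanov's bound applies to the first number, and there are at most
  \<open>k\<close> zeros. Only an upper bound is proved; the multiplier \<open>g\<close> makes it
  usable for runs of nonresidues too.\<close>

lemma sum_Legendre_prod_shifts_le:
  fixes t :: nat
  assumes p: "prime p" "2 < p" and T: "T \<subseteq> {1..k}" "T \<noteq> {}" and k: "k < p" and g: "\<not> int p dvd g"
    and t: "t \<ge> 1" "4 * t ^ 2 \<le> p" "4 * (k + 1 + 2 * t) \<le> p"
  shows "real_of_int (\<Sum>x\<in>{0..<int p}. Legendre (g * (\<Prod>i\<in>T. x + int i)) (int p))
    \<le> 3 * k * p / t + 3 * k"
proof -
  define F where "F = (\<lambda>x. g * (\<Prod>i\<in>T. x + int i))"
  define \<psi> where "\<psi> = (\<lambda>x. Legendre (F x) (int p))"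
  define A where "A = (\<lambda>e. {x \<in> {0..<int p}. \<psi> x = e})"
  have pi: "prime (int p)" and oddp: "odd p" using p prime_odd_nat by auto
  have finT: "finite T" using T(1) finite_subset by blast
  have cardT: "card T \<le> k" using card_mono[OF _ T(1)] by simp
  have k1: "k \<ge> 1" using T by auto
  obtain i0 where i0: "i0 \<in> T" using T by auto
  \<comment> \<open>Splitting off one shift \<open>i0\<close> exhibits the root \<open>- i0\<close>,
    which is simple because distinct shifts below \<open>p\<close> are incongruent.\<close>
  define f1 where "f1 = smult g (\<Prod>i\<in>T - {i0}. [:int i, 1:])"
  define f where "f = [:- (- int i0), 1:] * f1"
  have f_alt: "f = smult g (\<Prod>i\<in>T. [:int i, 1:])"
    using prod.remove[OF finT i0, of "\<lambda>i. [:int i, 1:]"] unfolding f_def f1_def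
    by (simp only: mult_smult_right minus_minus)
  have poly_f: "poly f x = F x" for x
    unfolding f_alt F_def by (simp add: poly_prod algebra_simps)
  have "degree (\<Prod>i\<in>T. [:int i, 1:]) = (\<Sum>i\<in>T. degree [:int i, 1:])"
    by (rule degree_prod_sum_eq) auto
  hence degf: "degree f \<le> k"
    using cardT degree_smult_le[of g "\<Prod>i\<in>T. [:int i, 1:]"] unfolding f_alt by simp
  have nodvd: "\<not> int p dvd int i" if "i \<in> T" for i
    using that T(1) k nat_dvd_not_less[of i p] by auto
  have f0: "\<not> int p dvd coeff f 0"
  proof -
    have "coeff f 0 = g * (\<Prod>i\<in>T. int i)"
      using poly_f[of 0] by (simp add: F_def poly_0_coeff_0)
    thus ?thesis using nodvd g pi finT by (auto simp: prime_dvd_mult_iff prime_dvd_prod_iff)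
  qed
  have f1: "\<not> int p dvd poly f1 (- int i0)"
  proof
    assume "int p dvd poly f1 (- int i0)"
    then obtain i where i: "i \<in> T" "i \<noteq> i0" "int p dvd int i - int i0"
      using g pi finT by (auto simp: f1_def poly_prod prime_dvd_mult_iff prime_dvd_prod_iff)
    hence "int p \<le> \<bar>int i - int i0\<bar>" using dvd_imp_le_int[of "int i - int i0" "int p"] by simp
    moreover have "i \<in> {1..k}" "i0 \<in> {1..k}" using i i0 T by auto
    ultimately show False using k by auto
  qed
  have A1: "4 * t * card (A 1) \<le> 2 * p * t + 6 * k * p + 4 * k * t"
  proof -
    have "A 1 \<subseteq> {x \<in> {0..<int p}. [poly f x ^ ((p - 1) div 2) = 1] (mod int p)}"
      using Legendre_eq_1_imp_cong[OF p] by (auto simp: A_def \<psi>_def poly_f)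
    hence "card (A 1) \<le> card {x \<in> {0..<int p}. [poly f x ^ ((p - 1) div 2) = 1] (mod int p)}"
      by (rule card_mono[rotated]) (rule finite_subset[of _ "{0..<int p}"], auto)
    hence "4 * t * card (A 1) \<le> 4 * t * card {x \<in> {0..<int p}. [poly f x ^ ((p - 1) div 2) = 1] (mod int p)}"
      by simp
    also have "\<dots> \<le> 2 * p * t + 6 * k * p + 4 * k * t"
      by (rule card_points_le_of_parameter[OF p(1) oddp f_def f1 f0 degf k1 t])
    finally show ?thesis .
  qed
  have A0: "card (A 0) \<le> k"
  proof -
    have "A 0 \<subseteq> (\<lambda>i. int p - int i) ` T"
    proof
      fix x assume "x \<in> A 0"
      hence x: "0 \<le> x" "x < int p" "int p dvd F x"
        by (auto simp: A_def \<psi>_def Legendre_def cong_0_iff split: if_splits)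
      then obtain i where i: "i \<in> T" "int p dvd x + int i"
        using g pi finT by (auto simp: F_def prime_dvd_mult_iff prime_dvd_prod_iff)
      have "i \<in> {1..k}" using i T by auto
      hence "\<bar>x + int i - int p\<bar> < int p" using x k by auto
      moreover have "int p dvd x + int i - int p" using i by simp
      ultimately have "x + int i - int p = 0"
        using dvd_imp_le_int[of "x + int i - int p" "int p"] by auto
      thus "x \<in> (\<lambda>i. int p - int i) ` T" using i by (intro image_eqI[of _ _ i]) auto
    qed
    hence "card (A 0) \<le> card T" by (rule surj_card_le[OF finT])
    thus ?thesis using cardT by simp
  qed
  have fin: "finite (A e)" for e unfolding A_def by (rule finite_subset[of _ "{0..<int p}"]) auto
  have split: "{0..<int p} = A 1 \<union> (A 0 \<union> A (-1))"
    using Legendre_range by (auto simp: A_def \<psi>_def)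
  have disj: "A 1 \<inter> (A 0 \<union> A (-1)) = {}" "A 0 \<inter> A (-1) = {}" by (auto simp: A_def)
  have sumA: "sum \<psi> (A e) = e * int (card (A e))" for e
    by (subst sum.cong[OF refl, of _ _ "\<lambda>_. e"]) (auto simp: A_def)
  have "sum \<psi> {0..<int p} = int (card (A 1)) - int (card (A (-1)))"
    unfolding split using disj fin by (simp add: sum.union_disjoint sumA)
  moreover have "int p = int (card (A 1)) + int (card (A 0)) + int (card (A (-1)))"
  proof -
    have "p = card {0..<int p}" by simp
    also have "\<dots> = card (A 1) + (card (A 0) + card (A (-1)))"
      unfolding split using disj fin by (simp add: card_Un_disjoint)
    finally show ?thesis by simp
  qed
  ultimately have "sum \<psi> {0..<int p} \<le> 2 * int (card (A 1)) - int p + int k" using A0 by linarith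
  moreover have "2 * real (card (A 1)) \<le> p + 3 * k * p / t + 2 * k"
  proof -
    have "real (4 * t * card (A 1)) \<le> real (2 * p * t + 6 * k * p + 4 * k * t)"
      using A1 by (simp only: of_nat_le_iff)
    thus ?thesis using t(1) by (simp add: field_simps)
  qed
  ultimately have "real_of_int (sum \<psi> {0..<int p}) \<le> 3 * real k * real p / real t + 3 * real k"
    unfolding of_int_le_iff[of "sum \<psi> {0..<int p}" "2 * int (card (A 1)) - int p + int k", where 'a = real, symmetric]
    by (simp del: of_int_sum of_int_le_iff)
  thus ?thesis by (simp only: \<psi>_def F_def)
qed

text \<open>The product of the factors \<open>\<eta> * \<psi> (x + u) + 1\<close> is
  \<open>2 ^ k\<close> on a run and never negative. Expanded over subsets of the shifts and summed
  over \<open>x\<close>, the empty subset gives \<open>p\<close> and every other one is a character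
  sum bounded above.\<close>

lemma card_Legendre_runs_le:
  fixes t :: nat
  assumes p: "prime p" "2 < p" and k: "1 \<le> k" "k < p" and \<eta>: "\<eta> \<in> {1, -1 :: int}"
    and t: "t \<ge> 1" "4 * t ^ 2 \<le> p" "4 * (k + 1 + 2 * t) \<le> p"
  shows "real (card {x \<in> {0..<int p}. \<forall>u\<in>{1..k}. Legendre (x + int u) (int p) = \<eta>})
    \<le> p / 2 ^ k + 3 * k * p / t + 3 * k"
proof (cases "{x \<in> {0..<int p}. \<forall>u\<in>{1..k}. Legendre (x + int u) (int p) = \<eta>} = {}")
  case True
  show ?thesis unfolding True by simp
next
  case False
  define W where "W = {x \<in> {0..<int p}. \<forall>u\<in>{1..k}. Legendre (x + int u) (int p) = \<eta>}"
  define \<psi> where "\<psi> = (\<lambda>x. Legendre x (int p))"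
  define E where "E = 3 * real k * real p / real t + 3 * real k"
  \<comment> \<open>A number with symbol \<open>\<eta>\<close>, taken from a run that exists. Its
    powers absorb the sign attached to each subset, so an upper bound for the sums suffices.\<close>
  obtain g where g: "\<psi> g = \<eta>" using False k unfolding \<psi>_def by force
  have E0: "E \<ge> 0" by (simp add: E_def)
  define P where "P = (\<lambda>x. \<Prod>u\<in>{1..k}. \<eta> * \<psi> (x + int u) + 1)"
  have P0: "P x \<ge> 0" for x
    unfolding P_def
  proof (intro prod_nonneg)
    fix u
    show "0 \<le> \<eta> * \<psi> (x + int u) + 1"
      using \<eta> Legendre_range[of "x + int u" "int p"] by (auto simp: \<psi>_def)
  qed
  have "2 ^ k * int (card W) = sum P W"
  proof -
    have "P x = 2 ^ k" if "x \<in> W" for x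
    proof -
      have "P x = (\<Prod>u\<in>{1..k}. 2)"
        unfolding P_def using that \<eta> by (intro prod.cong) (auto simp: W_def \<psi>_def)
      thus ?thesis by simp
    qed
    thus ?thesis by simp
  qed
  also have "sum P W \<le> sum P {0..<int p}"
    by (intro sum_mono2) (auto simp: W_def P0)
  also have "\<dots> = (\<Sum>x\<in>{0..<int p}. \<Sum>T\<in>Pow {1..k}. \<psi> (g ^ card T * (\<Prod>i\<in>T. x + int i)))"
  proof (rule sum.cong)
    fix x
    have "P x = (\<Sum>T\<in>Pow {1..k}. (\<Prod>i\<in>T. \<eta> * \<psi> (x + int i)))"
      unfolding P_def by (subst prod_add) auto
    also have "\<dots> = (\<Sum>T\<in>Pow {1..k}. \<psi> (g ^ card T * (\<Prod>i\<in>T. x + int i)))"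
    proof (rule sum.cong)
      fix T assume "T \<in> Pow {1..k}"
      hence fin: "finite T" using finite_subset by auto
      have "\<psi> (g ^ card T * (\<Prod>i\<in>T. x + int i)) = \<psi> (\<Prod>i\<in>T. g * (x + int i))"
        by (simp add: prod.distrib)
      also have "\<dots> = (\<Prod>i\<in>T. \<eta> * \<psi> (x + int i))"
        unfolding \<psi>_def by (simp add: Legendre_prod[OF p fin] Legendre_mult[OF p] g[unfolded \<psi>_def])
      finally show "(\<Prod>i\<in>T. \<eta> * \<psi> (x + int i)) = \<psi> (g ^ card T * (\<Prod>i\<in>T. x + int i))" ..
    qed simp
    finally show "P x = (\<Sum>T\<in>Pow {1..k}. \<psi> (g ^ card T * (\<Prod>i\<in>T. x + int i)))" .
  qed simp
  also have "\<dots> = (\<Sum>T\<in>Pow {1..k}. \<Sum>x\<in>{0..<int p}. \<psi> (g ^ card T * (\<Prod>i\<in>T. x + int i)))"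
    by (rule sum.swap)
  also have "\<dots> = int p + (\<Sum>T\<in>Pow {1..k} - {{}}. \<Sum>x\<in>{0..<int p}. \<psi> (g ^ card T * (\<Prod>i\<in>T. x + int i)))"
    using prime_gt_1_nat[OF p(1)] by (subst sum.remove[of _ "{}"]) (auto simp: \<psi>_def Legendre_1)
  finally have "real_of_int (2 ^ k * int (card W)) \<le> real_of_int (int p +
      (\<Sum>T\<in>Pow {1..k} - {{}}. \<Sum>x\<in>{0..<int p}. \<psi> (g ^ card T * (\<Prod>i\<in>T. x + int i))))"
    by (simp only: of_int_le_iff)
  also have "\<dots> = p + (\<Sum>T\<in>Pow {1..k} - {{}}.
      real_of_int (\<Sum>x\<in>{0..<int p}. \<psi> (g ^ card T * (\<Prod>i\<in>T. x + int i))))"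
    by simp
  also have "\<dots> \<le> p + (\<Sum>T\<in>Pow {1..k} - {{}}. E)"
  proof (intro add_left_mono sum_mono)
    fix T assume T: "T \<in> Pow {1..k} - {{}}"
    have "\<not> int p dvd g" using g \<eta> by (auto simp: \<psi>_def Legendre_def cong_0_iff)
    hence "\<not> int p dvd g ^ card T" using p(1) prime_dvd_power[of "int p" g] by auto
    thus "real_of_int (\<Sum>x\<in>{0..<int p}. \<psi> (g ^ card T * (\<Prod>i\<in>T. x + int i))) \<le> E"
      using sum_Legendre_prod_shifts_le[OF p _ _ k(2) _ t, of T "g ^ card T"] T
      unfolding \<psi>_def E_def by auto
  qed
  also have "\<dots> \<le> p + (\<Sum>T\<in>Pow {1..k}. E)"
    using E0 by (intro add_left_mono sum_mono2) auto
  also have "\<dots> = p + 2 ^ k * E" by (simp add: card_Pow)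
  finally have "real (card W) \<le> p / 2 ^ k + E" by (simp add: field_simps)
  thus ?thesis by (simp add: W_def E_def)
qed

subsection \<open>Divisors and primes\<close>

lemma card_divisors_prime_power_mult_le:
  fixes q m :: nat
  assumes q: "prime q" "\<not> q dvd m" and m: "m > 0"
  shows "card {d. d dvd q ^ e * m} \<le> (e + 1) * card {d. d dvd m}"
proof -
  have "{d. d dvd q ^ e * m} \<subseteq> (\<lambda>(i, d). q ^ i * d) ` ({..e} \<times> {d. d dvd m})"
  proof
    fix d assume "d \<in> {d. d dvd q ^ e * m}"
    hence d: "d dvd q ^ e * m" by simp
    have "q ^ e * m > 0" using m prime_gt_0_nat[OF q(1)] by simp
    hence "d \<noteq> 0" using d dvd_pos_nat by blast
    moreover have "\<not> is_unit q" using q by (auto simp: prime_nat_iff)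
    ultimately obtain d' where d': "d = q ^ multiplicity q d * d'" "\<not> q dvd d'"
      using multiplicity_decompose' by blast
    have "coprime d' (q ^ e)" using prime_imp_coprime[OF q(1) d'(2)] by (simp add: coprime_commute)
    moreover have "d' dvd q ^ e * m" using d d' by (metis dvd_mult_right)
    ultimately have "d' dvd m" by (simp add: coprime_dvd_mult_right_iff)
    have "coprime (q ^ multiplicity q d) m" using q by (simp add: prime_imp_coprime)
    moreover have "q ^ multiplicity q d dvd q ^ e * m" using d d' by (metis dvd_mult_left)
    ultimately have "q ^ multiplicity q d dvd q ^ e" by (simp add: coprime_dvd_mult_left_iff)
    hence "multiplicity q d \<le> e" using prime_gt_1_nat[OF q(1)] by (rule power_dvd_imp_le)
    thus "d \<in> (\<lambda>(i, d). q ^ i * d) ` ({..e} \<times> {d. d dvd m})"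
      using d' \<open>d' dvd m\<close> by (intro image_eqI[of _ _ "(multiplicity q d, d')"]) auto
  qed
  moreover have "finite ({..e} \<times> {d. d dvd m})" using m by simp
  ultimately have "card {d. d dvd q ^ e * m} \<le> card ({..e} \<times> {d. d dvd m})"
    by (meson surj_card_le)
  thus ?thesis by (simp add: card_cartesian_product)
qed

text \<open>Divisor counts are built from factors \<open>e + 1\<close>, one for each prime power
  \<open>q ^ e\<close> in \<open>n\<close>. Against the \<open>\<delta>\<close>-th power of
  \<open>q ^ e\<close> such a factor costs nothing once \<open>q\<close> is at least
  \<open>2 powr (1 / \<delta>)\<close>, and at most \<open>K\<close> for the fewer than
  \<open>Q + 1\<close> smaller primes.\<close>

lemma divisor_bound:
  fixes \<delta> :: real
  assumes "\<delta> > 0"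
  shows "\<exists>C>0. \<forall>n::nat. n > 0 \<longrightarrow> real (card {d. d dvd n}) \<le> C * real n powr \<delta>"
proof -
  define K where "K = max 1 (1 / (\<delta> * ln 2))"
  define Q where "Q = nat \<lceil>2 powr (1 / \<delta>)\<rceil>"
  have K1: "K \<ge> 1" by (simp add: K_def)
  have small: "real e + 1 \<le> K * (real q ^ e) powr \<delta>" if "q \<ge> 2" for q e :: nat
  proof -
    have K2: "K * (\<delta> * ln 2) \<ge> 1"
    proof -
      have "1 / (\<delta> * ln 2) * (\<delta> * ln 2) \<le> K * (\<delta> * ln 2)"
        using assms by (intro mult_right_mono) (auto simp: K_def)
      thus ?thesis using assms by simp
    qed
    have "real e + 1 \<le> K * (\<delta> * ln 2) * e + K" using K1 K2 mult_right_mono[OF K2, of "real e"] by simp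
    also have "\<dots> = K * (1 + real e * \<delta> * ln 2)" by (simp add: algebra_simps)
    also have "\<dots> \<le> K * exp (real e * \<delta> * ln 2)"
      using K1 by (intro mult_left_mono exp_ge_add_one_self) auto
    also have "exp (real e * \<delta> * ln 2) = (2 ^ e) powr \<delta>"
      by (simp add: powr_def ln_realpow algebra_simps)
    also have "\<dots> \<le> (real q ^ e) powr \<delta>"
      using that assms by (intro powr_mono2 power_mono) auto
    finally show ?thesis using K1 by (simp add: mult_left_mono)
  qed
  have large: "real e + 1 \<le> (real q ^ e) powr \<delta>" if "q \<ge> Q" for q e :: nat
  proof -
    have "2 powr (1 / \<delta>) \<le> real q" using that unfolding Q_def by linarith
    hence "(2 powr (1 / \<delta>)) powr \<delta> \<le> real q powr \<delta>" using assms by (intro powr_mono2) auto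
    hence "2 \<le> real q powr \<delta>" using assms by (simp add: powr_powr)
    have "real e + 1 \<le> 2 ^ e" using of_nat_le_iff[of "e + 1" "2 ^ e", where 'a = real] less_exp[of e] by simp
    also have "\<dots> \<le> (real q powr \<delta>) ^ e" using \<open>2 \<le> real q powr \<delta>\<close> by (intro power_mono) auto
    also have "\<dots> = (real q ^ e) powr \<delta>"
    proof -
      have "0 < 2 powr (1 / \<delta>)" by simp
      hence "q > 0" using \<open>2 powr (1 / \<delta>) \<le> real q\<close> by linarith
      thus ?thesis by (simp add: powr_realpow[symmetric] powr_powr mult.commute)
    qed
    finally show ?thesis .
  qed
  define \<omega> where "\<omega> = (\<lambda>n. {q. prime q \<and> q dvd n \<and> q < Q})"
  have fin: "finite (\<omega> n)" for n by (rule finite_subset[of _ "{..<Q}"]) (auto simp: \<omega>_def)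
  have main: "real (card {d. d dvd n}) \<le> K ^ card (\<omega> n) * real n powr \<delta>" if "n > 0" for n :: nat
    using that
  proof (induction n rule: less_induct)
    case (less n)
    show ?case
    proof (cases "n = 1")
      case True
      have "{d. d dvd (1::nat)} = {1}" by auto
      thus ?thesis using K1 True by simp
    next
      case False
      then obtain q where q: "prime q" "q dvd n" using prime_factor_nat by blast
      define e where "e = multiplicity q n"
      have e: "e > 0" using q less.prems by (simp add: e_def prime_multiplicity_gt_zero_iff)
      have "\<not> is_unit q" using q by (auto simp: prime_nat_iff)
      then obtain m where m: "n = q ^ e * m" "\<not> q dvd m"
        unfolding e_def using multiplicity_decompose'[of n q] less.prems by blast
      have m0: "m > 0" using less.prems m by (auto intro: Nat.gr0I)
      have "1 < q ^ e" using prime_gt_1_nat[OF q(1)] e by (intro one_less_power)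
      hence "m < n" using m m0 by simp
      note IH = less.IH[OF \<open>m < n\<close> m0]
      have step: "real (card {d. d dvd n}) \<le> (real e + 1) * (K ^ card (\<omega> m) * real m powr \<delta>)"
      proof -
        have "real (card {d. d dvd n}) \<le> real ((e + 1) * card {d. d dvd m})"
          using card_divisors_prime_power_mult_le[OF q(1) m(2) m0, of e] unfolding m(1)
          by (simp only: of_nat_le_iff)
        also have "\<dots> = (real e + 1) * real (card {d. d dvd m})" by (simp add: algebra_simps)
        also have "\<dots> \<le> (real e + 1) * (K ^ card (\<omega> m) * real m powr \<delta>)"
          using IH by (intro mult_left_mono) auto
        finally show ?thesis .
      qed
      have pn: "(real q ^ e) powr \<delta> * real m powr \<delta> = real n powr \<delta>"
        unfolding m(1) by (simp add: powr_mult)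
      have sub: "\<omega> m \<subseteq> \<omega> n" unfolding \<omega>_def m(1) by auto
      show ?thesis
      proof (cases "q < Q")
        case True
        have "q \<in> \<omega> n" "q \<notin> \<omega> m" using q True m by (auto simp: \<omega>_def)
        hence "Suc (card (\<omega> m)) \<le> card (\<omega> n)"
          using sub psubset_card_mono[OF fin, of "\<omega> m" n] unfolding Suc_le_eq by blast
        hence "K ^ Suc (card (\<omega> m)) \<le> K ^ card (\<omega> n)" using K1 by (intro power_increasing) auto
        note step
        also have "(real e + 1) * (K ^ card (\<omega> m) * real m powr \<delta>) \<le>
            (K * (real q ^ e) powr \<delta>) * (K ^ card (\<omega> m) * real m powr \<delta>)"
          using q K1 by (intro mult_right_mono small prime_ge_2_nat) auto
        also have "\<dots> = K ^ Suc (card (\<omega> m)) * real n powr \<delta>" by (simp flip: pn)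
        also have "\<dots> \<le> K ^ card (\<omega> n) * real n powr \<delta>"
          using \<open>K ^ Suc (card (\<omega> m)) \<le> K ^ card (\<omega> n)\<close> by (intro mult_right_mono) auto
        finally show ?thesis .
      next
        case False
        note step
        also have "(real e + 1) * (K ^ card (\<omega> m) * real m powr \<delta>) \<le>
            (real q ^ e) powr \<delta> * (K ^ card (\<omega> m) * real m powr \<delta>)"
          using False K1 by (intro mult_right_mono large) auto
        also have "\<dots> = K ^ card (\<omega> m) * real n powr \<delta>" by (simp flip: pn)
        also have "\<dots> \<le> K ^ card (\<omega> n) * real n powr \<delta>"
          using sub fin K1 by (intro mult_right_mono power_increasing card_mono) auto
        finally show ?thesis .
      qed
    qed
  qed
  have "real (card {d. d dvd n}) \<le> K ^ Q * real n powr \<delta>" if "n > 0" for n :: nat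
  proof -
    have "card (\<omega> n) \<le> Q" using card_mono[of "{..<Q}" "\<omega> n"] by (auto simp: \<omega>_def)
    hence "K ^ card (\<omega> n) * real n powr \<delta> \<le> K ^ Q * real n powr \<delta>"
      using K1 by (intro mult_right_mono power_increasing) auto
    with main[OF that] show ?thesis by linarith
  qed
  moreover have "K ^ Q > 0" using K1 by simp
  ultimately show ?thesis by blast
qed

section \<open>A lower bound of Chebyshev type for the number of primes\<close>

text \<open>The rationals \<open>a! b! / (a + b + 1)!\<close> are integer combinations of the unit fractions
  \<open>1/1, \<dots>, 1/(a + b + 1)\<close>.\<close>

lemma common_multiple_times_inverse_beta_Ints:
  assumes M: "\<And>i. 1 \<le> i \<Longrightarrow> i \<le> N \<Longrightarrow> i dvd M" and "a + b + 1 \<le> N"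
  shows "real M * (fact a * fact b / fact (a + b + 1)) \<in> \<int>"
  using assms(2)
proof (induction b arbitrary: a)
  case 0
  have "a + 1 dvd M" using 0 M[of "a + 1"] by simp
  then obtain k where k: "M = (a + 1) * k" by (elim dvdE)
  have "real M * (fact a * fact 0 / fact (a + 0 + 1)) = real k"
    unfolding k by (simp add: divide_simps) (simp add: algebra_simps)
  thus ?case by simp
next
  case (Suc b)
  define F where "F = (fact (a + b + 1) :: real)"
  have F: "F > 0" "fact (Suc (a + b + 1)) = (real a + real b + 2) * F"
    unfolding F_def using fact_Suc[of "a + b + 1", where 'a = real] by (auto simp del: fact_Suc)
  have idx: "a + 1 + b + 1 = Suc (a + b + 1)" "a + Suc b + 1 = Suc (a + b + 1)" by simp_all
  have fac: "fact (a + 1) = (real a + 1) * fact a" "fact (Suc b) = (real b + 1) * fact b" by simp_all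
  \<comment> \<open>The fraction is the integral of x^a (1 - x)^b over [0, 1]; the identity comes
    from x^a (1 - x)^b (1 - x) = x^a (1 - x)^(b + 1).\<close>
  have eq: "real M * (fact a * fact b / fact (a + b + 1)) - real M * (fact (a + 1) * fact b / fact (a + 1 + b + 1))
    = real M * (fact a * fact (Suc b) / fact (a + Suc b + 1))"
    unfolding idx F fac F_def[symmetric] using F(1)
    by (simp add: divide_simps add_nonneg_eq_0_iff) (simp add: algebra_simps)
  show ?case
    unfolding eq[symmetric] using Suc.IH[of a] Suc.IH[of "a + 1"] Suc.prems by (intro Ints_diff) auto
qed

text \<open>A positive integer is at least 1: applied to \<open>M\<close> times the integral of x^n
  (1 - x)^n, this bounds \<open>M\<close> below by \<open>2 * n + 1\<close> times the central
  binomial coefficient.\<close>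

lemma four_power_le_common_multiple:
  assumes M: "\<And>i. 1 \<le> i \<Longrightarrow> i \<le> 2 * n + 1 \<Longrightarrow> i dvd M" and "M > 0" "n > 0"
  shows "4 ^ n \<le> M"
proof -
  let ?\<beta> = "fact n * fact n / fact (n + n + 1) :: real"
  have "real M * ?\<beta> \<in> \<int>"
    by (rule common_multiple_times_inverse_beta_Ints[of "2 * n + 1", OF M]) simp_all
  moreover have "real M * ?\<beta> > 0" using \<open>M > 0\<close> by simp
  ultimately have \<beta>1: "1 \<le> real M * ?\<beta>" using Ints_nonzero_abs_ge1[of "real M * ?\<beta>"] by linarith
  have \<beta>2: "?\<beta> = 1 / ((2 * n + 1) * real ((2 * n) choose n))"
  proof -
    have "real ((2 * n) choose n) = fact (2 * n) / (fact n * fact n)"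
      using binomial_fact[of n "2 * n", where 'a = real] by simp
    moreover have "n + n + 1 = Suc (2 * n)" by simp
    hence "(fact (n + n + 1) :: real) = real (Suc (2 * n)) * fact (2 * n)"
      by (simp only: fact_Suc)
    ultimately show ?thesis by simp
  qed
  have "1 \<le> real M / ((2 * n + 1) * real ((2 * n) choose n))"
    using \<beta>1 unfolding \<beta>2 by (simp only: times_divide_eq_right mult_1_right)
  moreover have "(2 * n + 1) * real ((2 * n) choose n) > 0" by simp
  ultimately have 1: "(2 * n + 1) * real ((2 * n) choose n) \<le> M"
    by (simp only: pos_le_divide_eq mult_1)
  have "real (4 ^ n) \<le> 2 * n * real ((2 * n) choose n)"
    using central_binomial_lower_bound[OF \<open>n > 0\<close>] \<open>n > 0\<close> by (simp add: field_simps)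
  also have "\<dots> \<le> (2 * n + 1) * real ((2 * n) choose n)" by (intro mult_right_mono) auto
  also note 1
  finally show ?thesis by (simp only: of_nat_le_iff)
qed

text \<open>The witness is the product, over the primes up to \<open>N\<close>, of their largest
  powers not exceeding \<open>N\<close>.\<close>

lemma exists_common_multiple_le:
  assumes "N > 0"
  shows "\<exists>M>0. (\<forall>i. 1 \<le> i \<longrightarrow> i \<le> N \<longrightarrow> i dvd M) \<and> M \<le> N ^ card {q. prime q \<and> q \<le> (N::nat)}"
proof -
  define P where "P = {q. prime q \<and> q \<le> N}"
  define e where "e = (\<lambda>q. Max {i. q ^ i \<le> N})"
  define M where "M = (\<Prod>q\<in>P. q ^ e q)"
  have finP: "finite P" by (rule finite_subset[of _ "{..N}"]) (auto simp: P_def)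
  have fin: "finite {i. q ^ i \<le> N}" if "q \<ge> 2" for q
  proof (rule finite_subset)
    show "{i. q ^ i \<le> N} \<subseteq> {..N}"
    proof
      fix i assume "i \<in> {i. q ^ i \<le> N}"
      moreover have "i < q ^ i" using that less_exp[of i] power_mono[of 2 q i] by linarith
      ultimately show "i \<in> {..N}" by auto
    qed
  qed simp
  have e: "q ^ e q \<le> N" if "q \<ge> 2" for q
  proof -
    have "0 \<in> {i. q ^ i \<le> N}" using assms by simp
    hence "Max {i. q ^ i \<le> N} \<in> {i. q ^ i \<le> N}" using Max_in[OF fin[OF that]] by blast
    thus ?thesis by (simp add: e_def)
  qed
  have e_ge: "i \<le> e q" if "q \<ge> 2" "q ^ i \<le> N" for i q
    using Max_ge[OF fin[OF that(1)]] that unfolding e_def by auto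
  have "M > 0" unfolding M_def by (intro prod_pos) (auto simp: P_def prime_gt_0_nat)
  moreover have "i dvd M" if i: "1 \<le> i" "i \<le> N" for i
  proof (rule multiplicity_le_imp_dvd)
    show "i \<noteq> 0" using i by auto
    fix q :: nat assume q: "prime q"
    show "multiplicity q i \<le> multiplicity q M"
    proof (cases "q dvd i")
      case True
      hence "q \<in> P" using i q dvd_imp_le[of q i] by (auto simp: P_def)
      have "q ^ multiplicity q i dvd i" by (rule multiplicity_dvd)
      hence "q ^ multiplicity q i \<le> N" using i dvd_imp_le[of _ i] by fastforce
      hence "multiplicity q i \<le> e q" using e_ge q prime_ge_2_nat by blast
      moreover have "q ^ e q dvd M" unfolding M_def using finP \<open>q \<in> P\<close> by (rule dvd_prodI)
      hence "e q \<le> multiplicity q M"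
        using \<open>M > 0\<close> q by (intro multiplicity_geI) (auto simp: prime_nat_iff)
      ultimately show ?thesis by simp
    next
      case False
      thus ?thesis by (simp add: not_dvd_imp_multiplicity_0)
    qed
  qed
  moreover have "M \<le> (\<Prod>q\<in>P. N)"
    unfolding M_def by (intro prod_mono) (auto simp: P_def e prime_ge_2_nat)
  ultimately show ?thesis unfolding P_def by auto
qed

text \<open>After taking logarithms this bounds the number of primes up to \<open>2 * n + 1\<close>
  below by \<open>n * ln 4 / ln (2 * n + 1)\<close>. It supplies the primes used as
  denominators.\<close>

lemma four_power_le_power_card_primes:
  assumes "n > 0"
  shows "4 ^ n \<le> (2 * n + 1) ^ card {q. prime q \<and> q \<le> (2 * n + 1 :: nat)}"
proof -
  obtain M where "M > 0" "\<And>i. 1 \<le> i \<Longrightarrow> i \<le> 2 * n + 1 \<Longrightarrow> i dvd M"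
      "M \<le> (2 * n + 1) ^ card {q. prime q \<and> q \<le> (2 * n + 1 :: nat)}"
    using exists_common_multiple_le[of "2 * n + 1"] by auto
  with four_power_le_common_multiple[of n M] assms have "4 ^ n \<le> M" by blast
  also note \<open>M \<le> _\<close>
  finally show ?thesis .
qed

text \<open>Distinct primes dividing \<open>m\<close> have a product dividing \<open>m\<close>, and
  that product is at least \<open>B ^ card A\<close>.\<close>

lemma card_large_prime_divisors_less:
  fixes m :: int and B :: nat
  assumes "finite A" "B > 0" "\<And>q. q \<in> A \<Longrightarrow> prime q \<and> q \<ge> B \<and> int q dvd m" and "m \<noteq> 0"
    and "\<bar>m\<bar> < int B ^ j"
  shows "card A < j"
proof -
  have "int (\<Prod>A) dvd m"
    using assms(1,3)
  proof (induction A rule: finite_induct)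
    case (insert q A)
    have "coprime q (\<Prod>A)"
    proof (rule prod_coprime_right)
      fix r assume "r \<in> A"
      hence "prime q" "prime r" "q \<noteq> r" using insert by auto
      thus "coprime q r" by (rule primes_coprime)
    qed
    hence "coprime (int q) (int (\<Prod>A))" by (simp only: coprime_int_iff)
    moreover have "int q dvd m" "int (\<Prod>A) dvd m" using insert by auto
    ultimately have "int q * int (\<Prod>A) dvd m" by (intro divides_mult)
    moreover have "int (\<Prod>(insert q A)) = int q * int (\<Prod>A)"
      by (simp only: prod.insert[OF insert.hyps] of_nat_mult)
    ultimately show ?case by simp
  qed simp
  hence "int (\<Prod>A) \<le> \<bar>m\<bar>" using \<open>m \<noteq> 0\<close> dvd_imp_le_int[of m "int (\<Prod>A)"] by auto
  moreover have "B ^ card A \<le> \<Prod>A"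
  proof -
    have "(\<Prod>q\<in>A. B) \<le> \<Prod>A" using assms(3) by (intro prod_mono) auto
    thus ?thesis by simp
  qed
  hence "int B ^ card A \<le> int (\<Prod>A)" by (metis of_nat_le_iff of_nat_power)
  ultimately have lt: "int B ^ card A < int B ^ j" using assms(5) by linarith
  show ?thesis
  proof (rule ccontr)
    assume "\<not> card A < j"
    hence "int B ^ j \<le> int B ^ card A" using \<open>B > 0\<close> by (intro power_increasing) auto
    thus False using lt by simp
  qed
qed

text \<open>Cauchy-Schwarz for the sizes of the fibres of \<open>f\<close>.\<close>

lemma card_square_le_card_image_mult_energy:
  assumes "finite A"
  shows "(card A)\<^sup>2 \<le> card (f ` A) * card {(a, b) \<in> A \<times> A. f a = f b}"
proof -
  define F where "F = (\<lambda>y. {a \<in> A. f a = y})"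
  have finF: "finite (F y)" for y using assms by (simp add: F_def)
  have "card A = card (\<Union>y\<in>f ` A. F y)" by (rule arg_cong[of _ _ card]) (auto simp: F_def)
  also have "\<dots> = (\<Sum>y\<in>f ` A. card (F y))"
    using assms finF by (intro card_UN_disjoint) (auto simp: F_def)
  finally have 1: "real (card A) = (\<Sum>y\<in>f ` A. real (card (F y)))" by simp
  have "card {(a, b) \<in> A \<times> A. f a = f b} = card (\<Union>y\<in>f ` A. F y \<times> F y)"
    by (rule arg_cong[of _ _ card]) (auto simp: F_def)
  also have "\<dots> = (\<Sum>y\<in>f ` A. card (F y \<times> F y))"
    using assms finF by (intro card_UN_disjoint) (auto simp: F_def)
  finally have 2: "real (card {(a, b) \<in> A \<times> A. f a = f b}) = (\<Sum>y\<in>f ` A. (real (card (F y)))\<^sup>2)"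
    by (simp add: card_cartesian_product power2_eq_square)
  have "real ((card A)\<^sup>2) \<le> real (card (f ` A) * card {(a, b) \<in> A \<times> A. f a = f b})"
    using sum_squared_le_sum_of_squares[of "\<lambda>y. real (card (F y))" "f ` A"] 1 2
    by (simp add: mult.commute)
  thus ?thesis by (simp only: of_nat_le_iff)
qed

subsection \<open>Distinct values of \<open>k - F(h)\<close> modulo a prime\<close>

text \<open>In the application \<open>A\<close> is a quarter of \<open>a\<close> modulo
  \<open>p\<close>, and \<open>N\<close> is at most half the side of the box.\<close>

locale cubic_mod =
  fixes p :: nat and A c :: int and N :: nat
  assumes p: "prime p" and A: "\<not> int p dvd A" and N: "N > 0"
begin

definition F :: "int \<Rightarrow> int" where "F h = A * h ^ 3 + c * h"

definition grid :: "(int \<times> int) set" where "grid = {1..int N} \<times> {0..<int N}"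

definition S :: "int \<times> int \<Rightarrow> int" where "S x = snd x - F (fst x)"

text \<open>Two values \<open>k - F h\<close> and \<open>k' - F h'\<close> with
  \<open>h < h'\<close> on the grid can agree modulo \<open>p\<close> only for such a pair, the
  small number being \<open>k' - k\<close>.\<close>

definition close_pairs :: "(int \<times> int) set" where
  "close_pairs = {(h, h'). 1 \<le> h \<and> h < h' \<and> h' \<le> int N \<and> (\<exists>k. \<bar>k\<bar> < int N \<and> [F h' - F h = k] (mod int p))}"

lemma finite_grid [simp]: "finite grid"
  by (simp add: grid_def)

lemma card_grid: "card grid = N ^ 2"
  by (simp add: grid_def card_cartesian_product power2_eq_square)

lemma finite_close_pairs: "finite close_pairs"
  by (rule finite_subset[of _ "{1..int N} \<times> {1..int N}"]) (auto simp: close_pairs_def)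

text \<open>The quotient of \<open>h' ^ 3 - h ^ 3\<close> by \<open>h' - h\<close>. It makes the
  difference quotient of \<open>F\<close> the affine function \<open>A * Q + c\<close>.\<close>

definition Q :: "int \<times> int \<Rightarrow> int" where "Q x = fst x ^ 2 + fst x * snd x + snd x ^ 2"

definition gap :: "int \<times> int \<Rightarrow> int" where "gap x = snd x - fst x"

definition K :: "int \<times> int \<Rightarrow> int" where
  "K x = (SOME k. \<bar>k\<bar> < int N \<and> [F (snd x) - F (fst x) = k] (mod int p))"

lemma coprime_p:
  assumes "\<not> int p dvd a"
  shows "coprime a (int p)"
proof -
  have "prime (int p)" using p by simp
  hence "coprime (int p) a" using assms by (rule prime_imp_coprime)
  thus ?thesis by (subst coprime_commute)
qed

lemma N_less_p:
  assumes "18 * N ^ 5 < p"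
  shows "int N < int p"
proof -
  have "N \<le> N ^ 5" using N by (intro self_le_power) auto
  thus ?thesis using assms by linarith
qed

lemma F_diff: "F (snd x) - F (fst x) = gap x * (A * Q x + c)"
  by (simp add: F_def gap_def Q_def algebra_simps power2_eq_square power3_eq_cube)

lemma K:
  assumes "x \<in> close_pairs"
  shows "\<bar>K x\<bar> < int N" "[gap x * (A * Q x + c) = K x] (mod int p)"
proof -
  have "\<exists>k. \<bar>k\<bar> < int N \<and> [F (snd x) - F (fst x) = k] (mod int p)"
    using assms by (auto simp: close_pairs_def)
  from someI_ex[OF this, folded K_def]
  show "\<bar>K x\<bar> < int N" "[gap x * (A * Q x + c) = K x] (mod int p)"
    by (simp_all only: F_diff)
qed

lemma gap_bounds:
  assumes "x \<in> close_pairs"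
  shows "0 < gap x" "gap x < int N"
  using assms by (auto simp: gap_def close_pairs_def)

lemma Q_bounds:
  assumes "x \<in> close_pairs"
  shows "0 < Q x" "Q x \<le> 3 * int N ^ 2"
proof -
  obtain h h' where x: "x = (h, h')" "1 \<le> h" "h < h'" "h' \<le> int N"
    using assms by (auto simp: close_pairs_def)
  have "h ^ 2 \<le> int N ^ 2" "h' ^ 2 \<le> int N ^ 2" using x by (auto intro!: power_mono)
  moreover have "h * h' \<le> int N * int N" using x by (intro mult_mono) auto
  ultimately show "Q x \<le> 3 * int N ^ 2" by (simp add: x(1) Q_def power2_eq_square)
  have "0 < h ^ 2" "0 \<le> h * h'" "0 \<le> h' ^ 2" using x by auto
  thus "0 < Q x" unfolding x(1) Q_def fst_conv snd_conv by linarith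
qed

lemma Q_cong_imp_eq:
  assumes "x \<in> close_pairs" "y \<in> close_pairs" and "[A * Q x = A * Q y] (mod int p)"
    and "18 * N ^ 5 < p"
  shows "Q x = Q y"
proof (rule cong_small_imp_eq)
  have "coprime A (int p)" using A by (rule coprime_p)
  thus "[Q x = Q y] (mod int p)" using assms(3) by (simp add: cong_mult_lcancel)
  have "3 * N ^ 2 \<le> 18 * N ^ 5" using N power_increasing[of 2 5 N] by simp
  hence "int (3 * N ^ 2) < int p" using assms(4) unfolding of_nat_less_iff by linarith
  hence "3 * int N ^ 2 < int p" by simp
  thus "\<bar>Q x - Q y\<bar> < int p" using Q_bounds[OF assms(1)] Q_bounds[OF assms(2)] by linarith
qed

text \<open>With the first entry fixed, \<open>Q\<close> is strictly increasing in the second one,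
  as entries are positive. The same holds in the next lemma with the gap fixed.\<close>

lemma close_pair_eqI_fst:
  assumes "x \<in> close_pairs" "y \<in> close_pairs" "Q x = Q y" "fst x = fst y"
  shows "x = y"
proof -
  define h where "h = fst x"
  define a where "a = snd x"
  define b where "b = snd y"
  have xy: "x = (h, a)" "y = (h, b)"
    using assms(4) by (simp_all add: h_def a_def b_def prod_eq_iff)
  have pos: "h > 0" "a > 0" "b > 0" using assms(1,2) by (auto simp: xy close_pairs_def)
  have "Q x - Q y = (a - b) * (h + a + b)"
    by (simp add: xy Q_def algebra_simps power2_eq_square)
  hence "(a - b) * (h + a + b) = 0" using assms(3) by simp
  moreover have "h + a + b \<noteq> 0" using pos by linarith
  ultimately have "a = b" unfolding mult_eq_0_iff by linarith
  thus ?thesis by (simp add: xy)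
qed

lemma close_pair_eqI_gap:
  assumes "x \<in> close_pairs" "y \<in> close_pairs" "Q x = Q y" "gap x = gap y"
  shows "x = y"
proof -
  define n where "n = gap x"
  define a where "a = fst x"
  define b where "b = fst y"
  have xy: "x = (a, a + n)" "y = (b, b + n)"
    unfolding n_def using assms(4)[symmetric]
    by (auto simp: a_def b_def gap_def prod_eq_iff)
  have pos: "a > 0" "b > 0" "n > 0" using assms(1,2) by (auto simp: xy close_pairs_def)
  have "Q x - Q y = (a - b) * (3 * (a + b + n))"
    by (simp add: xy Q_def algebra_simps power2_eq_square)
  hence "(a - b) * (3 * (a + b + n)) = 0" using assms(3) by simp
  moreover have "3 * (a + b + n) > 0" using pos by simp
  ultimately have "a = b" by auto
  thus ?thesis by (simp add: xy)
qed

text \<open>The ratio of \<open>K\<close> to \<open>gap\<close> is \<open>A * Q + c\<close> modulo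
  \<open>p\<close>, and it determines \<open>Q\<close>. When \<open>K\<close> is 0 the ratio is 0
  whatever the gap.\<close>

lemma close_pair_Q_eq:
  assumes "x \<in> close_pairs" "y \<in> close_pairs" "K x = K y" "gap x = gap y \<or> K x = 0"
    and "18 * N ^ 5 < p"
  shows "Q x = Q y"
proof (rule Q_cong_imp_eq[OF assms(1,2) _ assms(5)])
  note Np = N_less_p[OF assms(5)]
  have cop: "coprime (gap z) (int p)" if "z \<in> close_pairs" for z
  proof -
    have "\<not> int p dvd gap z" using gap_bounds[OF that] Np zdvd_imp_le[of "int p" "gap z"] by auto
    thus ?thesis by (rule coprime_p)
  qed
  show "[A * Q x = A * Q y] (mod int p)"
    using assms(4)
  proof
    assume "gap x = gap y"
    hence "[gap x * (A * Q x + c) = gap x * (A * Q y + c)] (mod int p)"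
      using K(2)[OF assms(1)] K(2)[OF assms(2)] assms(3) by (simp add: cong_def)
    hence "[A * Q x + c = A * Q y + c] (mod int p)"
      using cop[OF assms(1)] by (simp only: cong_mult_lcancel)
    thus ?thesis by (simp add: cong_add_rcancel)
  next
    assume "K x = 0"
    hence "[A * Q z + c = 0] (mod int p)" if "z \<in> {x, y}" for z
    proof -
      have z: "z \<in> close_pairs" "K z = 0" using that assms \<open>K x = 0\<close> by auto
      hence "[gap z * (A * Q z + c) = gap z * 0] (mod int p)" using K(2)[OF z(1)] by simp
      thus ?thesis using cop[OF z(1)] by (simp only: cong_mult_lcancel)
    qed
    from this[of x] this[of y] have "[A * Q x + c = A * Q y + c] (mod int p)"
      by (simp add: cong_def)
    thus ?thesis by (simp add: cong_add_rcancel)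
  qed
qed

lemma card_close_pairs_same_Q:
  assumes "B \<subseteq> close_pairs" "\<And>x y. x \<in> B \<Longrightarrow> y \<in> B \<Longrightarrow> Q x = Q y"
  shows "card B \<le> N"
proof -
  have "inj_on fst B"
    using assms close_pair_eqI_fst by (meson inj_onI subsetD)
  moreover have "fst ` B \<subseteq> {1..int N}" using assms(1) by (auto simp: close_pairs_def)
  ultimately have "card B \<le> card {1..int N}" by (intro card_inj_on_le) auto
  thus ?thesis by simp
qed

text \<open>The points \<open>(Q x, K x / gap x)\<close> lie on a line modulo \<open>p\<close>, hence on a line over the rationals.\<close>

lemma gap_dvd:
  assumes x: "x \<in> close_pairs" and y: "y \<in> close_pairs" and z: "z \<in> close_pairs"
    and "18 * N ^ 5 < p"
  shows "gap x dvd gap y * gap z * (Q y - Q z) * K x"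
proof -
  let ?n = "int N"
  \<comment> \<open>Linear interpolation of \<open>A * Q + c\<close> at \<open>x\<close> from its
    values at \<open>y\<close> and \<open>z\<close>, cleared of denominators. Both sides are small
    enough for the congruence to be an equality of integers.\<close>
  define L where "L = gap y * gap z * (Q y - Q z) * K x"
  define M where "M = (Q x - Q z) * gap z * K y + (Q y - Q x) * gap y * K z"
  have "[L = gap y * gap z * (Q y - Q z) * (gap x * (A * Q x + c))] (mod int p)"
    unfolding L_def by (intro cong_mult cong_refl cong_sym[OF K(2)[OF x]])
  also have "gap y * gap z * (Q y - Q z) * (gap x * (A * Q x + c)) =
     gap x * ((Q x - Q z) * gap z * (gap y * (A * Q y + c)) + (Q y - Q x) * gap y * (gap z * (A * Q z + c)))"
    by (simp add: algebra_simps)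
  also have "[\<dots> = gap x * M] (mod int p)"
    unfolding M_def by (intro cong_mult cong_add cong_refl K(2)[OF y] K(2)[OF z])
  finally have "[L = gap x * M] (mod int p)" .
  moreover have "\<bar>L - gap x * M\<bar> < int p"
  proof -
    have Qd: "\<bar>Q a - Q b\<bar> \<le> 3 * ?n ^ 2" if "a \<in> close_pairs" "b \<in> close_pairs" for a b
      using Q_bounds[OF that(1)] Q_bounds[OF that(2)] by linarith
    have g: "\<bar>gap a\<bar> \<le> ?n" if "a \<in> close_pairs" for a using gap_bounds[OF that] by linarith
    have k: "\<bar>K a\<bar> \<le> ?n" if "a \<in> close_pairs" for a using K(1)[OF that] by linarith
    have "\<bar>L\<bar> \<le> ?n * ?n * (3 * ?n ^ 2) * ?n"
      unfolding L_def abs_mult using x y z by (intro mult_mono g k Qd) auto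
    moreover have "\<bar>(Q x - Q z) * gap z * K y\<bar> \<le> (3 * ?n ^ 2) * ?n * ?n"
      unfolding abs_mult using x y z by (intro mult_mono g k Qd) auto
    moreover have "\<bar>(Q y - Q x) * gap y * K z\<bar> \<le> (3 * ?n ^ 2) * ?n * ?n"
      unfolding abs_mult using x y z by (intro mult_mono g k Qd) auto
    moreover have "?n * ?n * (3 * ?n ^ 2) * ?n = 3 * ?n ^ 5" "(3 * ?n ^ 2) * ?n * ?n = 3 * ?n ^ 4"
      by (simp_all add: eval_nat_numeral)
    ultimately have LM: "\<bar>L\<bar> \<le> 3 * ?n ^ 5" "\<bar>M\<bar> \<le> 6 * ?n ^ 4"
      unfolding M_def by linarith+
    have "\<bar>gap x * M\<bar> \<le> ?n * (6 * ?n ^ 4)"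
      unfolding abs_mult using x LM by (intro mult_mono g) auto
    moreover have "?n * (6 * ?n ^ 4) = 6 * ?n ^ 5" by (simp add: eval_nat_numeral)
    ultimately have "\<bar>L - gap x * M\<bar> \<le> 9 * ?n ^ 5" using LM by linarith
    also have "\<dots> \<le> 18 * ?n ^ 5" by simp
    also have "\<dots> = int (18 * N ^ 5)" by simp
    also have "\<dots> < int p" using assms(4) by (simp only: of_nat_less_iff)
    finally show ?thesis .
  qed
  ultimately have "L = gap x * M" by (rule cong_small_imp_eq)
  thus ?thesis unfolding L_def by simp
qed

text \<open>If \<open>Q\<close> is not constant, fix \<open>y\<close> and \<open>z\<close> with
  different values. Pairs with \<open>K = 0\<close> share one \<open>Q\<close> and number at most
  \<open>N\<close>. Any other pair is determined by \<open>K\<close> and \<open>gap\<close>, and its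
  gap divides a nonzero integer that depends only on \<open>K\<close> and is at most
  \<open>3 * N ^ 5\<close> in absolute value, which leaves at most \<open>T\<close> gaps for each
  \<open>K\<close>.\<close>

lemma card_close_pairs_le:
  assumes Np: "18 * N ^ 5 < p"
    and T: "\<And>m::nat. 0 < m \<Longrightarrow> m \<le> 3 * N ^ 5 \<Longrightarrow> card {d. d dvd m} \<le> T"
  shows "card close_pairs \<le> N + 2 * N * T"
proof (cases "\<forall>x\<in>close_pairs. \<forall>y\<in>close_pairs. Q x = Q y")
  case True
  thus ?thesis using card_close_pairs_same_Q[of close_pairs] by fastforce
next
  case False
  then obtain y z where yz: "y \<in> close_pairs" "z \<in> close_pairs" "Q y \<noteq> Q z" by blast
  define \<alpha> where "\<alpha> = gap y * gap z * (Q y - Q z)"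
  have \<alpha>0: "\<alpha> \<noteq> 0" using yz gap_bounds[OF yz(1)] gap_bounds[OF yz(2)] by (simp add: \<alpha>_def)
  have "\<bar>\<alpha>\<bar> \<le> int N * int N * (3 * int N ^ 2)"
    unfolding \<alpha>_def abs_mult
    using gap_bounds[OF yz(1)] gap_bounds[OF yz(2)] Q_bounds[OF yz(1)] Q_bounds[OF yz(2)]
    by (intro mult_mono) auto
  also have "\<dots> = 3 * int N ^ 4" by (simp add: eval_nat_numeral)
  finally have \<alpha>1: "\<bar>\<alpha>\<bar> \<le> 3 * int N ^ 4" .
  define B0 where "B0 = {x \<in> close_pairs. K x = 0}"
  define B1 where "B1 = {x \<in> close_pairs. K x \<noteq> 0}"
  define U where "U = {- int N<..<int N} - {0}"
  have fin: "finite {d. d dvd nat \<bar>\<alpha> * k\<bar>}" if "k \<in> U" for k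
    using that \<alpha>0 by (intro finite_divisors_nat) (auto simp: U_def)
  have "card B0 \<le> N"
    using close_pair_Q_eq[OF _ _ _ _ Np] by (intro card_close_pairs_same_Q) (auto simp: B0_def)
  moreover have "card B1 \<le> card (SIGMA k:U. {d. d dvd nat \<bar>\<alpha> * k\<bar>})"
  proof (rule card_inj_on_le)
    show "inj_on (\<lambda>x. (K x, nat (gap x))) B1"
    proof (rule inj_onI)
      fix u v assume uv: "u \<in> B1" "v \<in> B1" "(K u, nat (gap u)) = (K v, nat (gap v))"
      hence cl: "u \<in> close_pairs" "v \<in> close_pairs" by (auto simp: B1_def)
      have "gap u = gap v" using uv(3) gap_bounds[OF cl(1)] gap_bounds[OF cl(2)] by auto
      moreover have "Q u = Q v"
        using close_pair_Q_eq[OF cl _ _ Np] uv(3) \<open>gap u = gap v\<close> by auto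
      ultimately show "u = v" using close_pair_eqI_gap[OF cl] by blast
    qed
    show "(\<lambda>x. (K x, nat (gap x))) ` B1 \<subseteq> (SIGMA k:U. {d. d dvd nat \<bar>\<alpha> * k\<bar>})"
    proof (clarify)
      fix u v assume uv: "(u, v) \<in> B1"
      hence cl: "(u, v) \<in> close_pairs" "K (u, v) \<noteq> 0" by (auto simp: B1_def)
      have "gap (u, v) dvd \<alpha> * K (u, v)"
        unfolding \<alpha>_def by (rule gap_dvd[OF cl(1) yz(1,2) Np])
      hence "nat (gap (u, v)) dvd nat \<bar>\<alpha> * K (u, v)\<bar>"
        using gap_bounds[OF cl(1)] by (simp add: nat_dvd_iff)
      thus "K (u, v) \<in> U \<and> nat (gap (u, v)) \<in> {d. d dvd nat \<bar>\<alpha> * K (u, v)\<bar>}"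
        using K(1)[OF cl(1)] cl(2) by (auto simp: U_def)
    qed
    show "finite (SIGMA k:U. {d. d dvd nat \<bar>\<alpha> * k\<bar>})"
      using fin by (intro finite_SigmaI) (auto simp: U_def)
  qed
  moreover have "card (SIGMA k:U. {d. d dvd nat \<bar>\<alpha> * k\<bar>}) \<le> 2 * N * T"
  proof -
    have "card (SIGMA k:U. {d. d dvd nat \<bar>\<alpha> * k\<bar>}) = (\<Sum>k\<in>U. card {d. d dvd nat \<bar>\<alpha> * k\<bar>})"
      using fin by (intro card_SigmaI) (auto simp: U_def)
    also have "\<dots> \<le> (\<Sum>k\<in>U. T)"
    proof (intro sum_mono T)
      fix k assume k: "k \<in> U"
      thus "0 < nat \<bar>\<alpha> * k\<bar>" using \<alpha>0 by (auto simp: U_def)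
      have "\<bar>\<alpha> * k\<bar> \<le> (3 * int N ^ 4) * int N"
        unfolding abs_mult using \<alpha>1 k by (intro mult_mono) (auto simp: U_def)
      also have "\<dots> = int (3 * N ^ 5)" by (simp add: eval_nat_numeral)
      finally show "nat \<bar>\<alpha> * k\<bar> \<le> 3 * N ^ 5" by linarith
    qed
    also have "\<dots> = card U * T" by simp
    also have "\<dots> \<le> 2 * N * T"
    proof (rule mult_right_mono)
      have "card U \<le> card {- int N<..<int N}" unfolding U_def by (intro card_mono) auto
      thus "card U \<le> 2 * N" using N by simp
    qed simp
    finally show ?thesis .
  qed
  moreover have "card close_pairs \<le> card B0 + card B1"
  proof -
    have "close_pairs = B0 \<union> B1" by (auto simp: B0_def B1_def)
    thus ?thesis by (metis card_Un_le)
  qed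
  ultimately show ?thesis by linarith
qed

text \<open>Cauchy-Schwarz with a bound for the coincidences of \<open>S\<close> on the grid. Those
  with equal abscissa are trivial; the others are fixed by a close pair and one ordinate, and the
  two orders of the abscissae are symmetric.\<close>

lemma exists_many_distinct_residues:
  assumes Np: "18 * N ^ 5 < p"
    and T: "\<And>m::nat. 0 < m \<Longrightarrow> m \<le> 3 * N ^ 5 \<Longrightarrow> card {d. d dvd m} \<le> T"
  shows "\<exists>I \<subseteq> grid. inj_on (\<lambda>x. S x mod int p) I \<and> N ^ 2 \<le> card I * (3 + 4 * T)"
proof -
  define E where "E = {(x, y) \<in> grid \<times> grid. S x mod int p = S y mod int p}"
  have Np': "int N < int p" by (rule N_less_p[OF Np])
  have k_eq: "k = k'" if "[k = k'] (mod int p)" "k \<in> {0..<int N}" "k' \<in> {0..<int N}" for k k'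
    using that Np' by (intro cong_small_imp_eq[OF that(1)]) auto
  have SE: "[k' - k = F h' - F h] (mod int p)" if "((h, k), (h', k')) \<in> E" for h k h' k'
  proof -
    have "[k - F h = k' - F h'] (mod int p)" using that by (simp add: E_def S_def cong_def)
    hence "[(k - F h) + (F h' - k) = (k' - F h') + (F h' - k)] (mod int p)" by (intro cong_add cong_refl)
    thus ?thesis by (simp add: cong_sym_eq)
  qed
  define E0 where "E0 = {(x, y) \<in> E. fst x = fst y}"
  define E1 where "E1 = {(x, y) \<in> E. fst x < fst y}"
  define E2 where "E2 = {(x, y) \<in> E. fst y < fst x}"
  have "card E0 \<le> card grid"
  proof (rule card_inj_on_le)
    show "inj_on fst E0"
    proof (rule inj_onI)
      have *: "b = a" if E0: "(a, b) \<in> E0" for a b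
      proof -
        obtain h k k' where ab: "a = (h, k)" "b = (h, k')"
          using E0 by (cases a; cases b) (auto simp: E0_def)
        have "((h, k), (h, k')) \<in> E" using E0 by (auto simp: ab E0_def)
        hence "[k' - k = 0] (mod int p)" "k \<in> {0..<int N}" "k' \<in> {0..<int N}"
          using SE[of h k h k'] by (auto simp: E_def grid_def)
        thus ?thesis using k_eq[of k' k] by (simp add: ab cong_diff_iff_cong_0)
      qed
      fix u v assume "u \<in> E0" "v \<in> E0" "fst u = fst v"
      thus "u = v" using * by (metis prod.collapse)
    qed
  qed (auto simp: E0_def E_def)
  moreover have E1: "card E1 \<le> card (close_pairs \<times> {0..<int N})"
  proof (rule card_inj_on_le)
    show "inj_on (\<lambda>(x, y). ((fst x, fst y), snd x)) E1"
    proof (rule inj_onI, clarsimp)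
      fix h k h' k1 k2
      assume *: "((h, k), (h', k1)) \<in> E1" "((h, k), (h', k2)) \<in> E1"
      hence "[k1 - k = k2 - k] (mod int p)"
        using SE[of h k h' k1] SE[of h k h' k2] by (auto simp: E1_def cong_def)
      hence "[k1 - k + k = k2 - k + k] (mod int p)" by (intro cong_add cong_refl)
      thus "k1 = k2" using * by (intro k_eq) (auto simp: E1_def E_def grid_def)
    qed
    show "(\<lambda>(x, y). ((fst x, fst y), snd x)) ` E1 \<subseteq> close_pairs \<times> {0..<int N}"
    proof (clarsimp)
      fix h k h' k' assume *: "((h, k), (h', k')) \<in> E1"
      have "\<bar>k' - k\<bar> < int N" using * by (auto simp: E1_def E_def grid_def)
      moreover have "[F h' - F h = k' - k] (mod int p)"
        using SE[of h k h' k'] * by (auto simp: E1_def cong_sym_eq)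
      ultimately show "(h, h') \<in> close_pairs \<and> 0 \<le> k \<and> k < int N"
        using * unfolding close_pairs_def by (auto simp: E1_def E_def grid_def)
    qed
  qed (auto simp: finite_close_pairs)
  moreover have "card E2 = card E1"
  proof (rule bij_betw_same_card)
    show "bij_betw prod.swap E2 E1"
      by (rule bij_betwI[of _ _ _ prod.swap]) (auto simp: E1_def E2_def E_def)
  qed
  moreover have "card E \<le> card E0 + (card E1 + card E2)"
  proof -
    have "E = E0 \<union> (E1 \<union> E2)" by (auto simp: E0_def E1_def E2_def)
    thus ?thesis by (metis add_left_mono card_Un_le order_trans)
  qed
  moreover have "card (close_pairs \<times> {0..<int N}) \<le> (N + 2 * N * T) * N"
    using card_close_pairs_le[OF Np T] by (simp add: card_cartesian_product)
  ultimately have "card E \<le> N ^ 2 + 2 * ((N + 2 * N * T) * N)" by (simp add: card_grid)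
  also have "\<dots> = N ^ 2 * (3 + 4 * T)" by (simp add: algebra_simps power2_eq_square)
  finally have E: "card E \<le> N ^ 2 * (3 + 4 * T)" .
  \<comment> \<open>One grid point is kept for each residue attained, so \<open>card I\<close> is
    the number of distinct residues.\<close>
  obtain I where I: "I \<subseteq> grid" "inj_on (\<lambda>x. S x mod int p) I"
      "(\<lambda>x. S x mod int p) ` grid = (\<lambda>x. S x mod int p) ` I"
    using subset_image_inj[of "(\<lambda>x. S x mod int p) ` grid" "\<lambda>x. S x mod int p" grid] by auto
  have "(card grid)\<^sup>2 \<le> card ((\<lambda>x. S x mod int p) ` grid) * card E"
    unfolding E_def by (rule card_square_le_card_image_mult_energy) simp
  also have "card ((\<lambda>x. S x mod int p) ` grid) = card I"
    unfolding I(3) by (rule card_image[OF I(2)])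
  also have "card I * card E \<le> card I * (N ^ 2 * (3 + 4 * T))" using E by simp
  finally have "N ^ 2 * N ^ 2 \<le> N ^ 2 * (card I * (3 + 4 * T))"
    by (simp add: card_grid power2_eq_square algebra_simps)
  hence "N ^ 2 \<le> card I * (3 + 4 * T)" using N unfolding nat_mult_le_cancel_disj by simp
  thus ?thesis using I by blast
qed

end

subsection \<open>Many quotients \<open>(k - F(h)) / v\<close> with \<open>v\<close> prime\<close>

context cubic_mod
begin

text \<open>\<open>F h\<close> is the fraction \<open>w / d\<close> modulo \<open>p\<close>. The
  size limits are those of the 2 by 2 determinants that arise from two linear relations with primes
  up to \<open>V\<close> as coefficients.\<close>

definition approx :: "nat \<Rightarrow> int \<Rightarrow> int \<Rightarrow> int \<Rightarrow> bool" where
  "approx V h d w \<longleftrightarrow> 0 < d \<and> d \<le> int V ^ 2 \<and> \<bar>w\<bar> \<le> 2 * int N * int V ^ 2 \<and> [d * F h = w] (mod int p)"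

lemma approx_if_signed:
  assumes "\<Delta> \<noteq> 0" "\<bar>\<Delta>\<bar> \<le> int V ^ 2" "\<bar>w\<bar> \<le> 2 * int N * int V ^ 2" "[\<Delta> * F h = w] (mod int p)"
  shows "\<exists>d w. approx V h d w"
proof (cases "\<Delta> > 0")
  case True
  thus ?thesis using assms by (auto simp: approx_def)
next
  case False
  have "[(- \<Delta>) * F h = - w] (mod int p)" using assms(4) cong_minus_minus_iff[of "\<Delta> * F h" w] by simp
  thus ?thesis using assms False by (intro exI[of _ "- \<Delta>"] exI[of _ "- w"]) (auto simp: approx_def)
qed

text \<open>Cramer's rule for two linear relations between \<open>F h\<close> and
  \<open>F h'\<close>. The determinant is nonzero because a pair of distinct primes is determined by
  its ratio.\<close>

lemma approx_if_two_relations: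
  fixes v v' u u' :: nat
  assumes primes: "prime v" "prime v'" "prime u" "prime u'" and neq: "v \<noteq> v'" "u \<noteq> u'" "(v, v') \<noteq> (u, u')"
    and le: "v \<le> V" "v' \<le> V" "u \<le> V" "u' \<le> V"
    and w: "\<bar>w1\<bar> \<le> int N * int V" "\<bar>w2\<bar> \<le> int N * int V"
    and c1: "[int v' * F h - int v * F h' = w1] (mod int p)"
    and c2: "[int u' * F h - int u * F h' = w2] (mod int p)"
  shows "(\<exists>d w. approx V h d w) \<and> (\<exists>d w. approx V h' d w)"
proof -
  define \<Delta> where "\<Delta> = int u * int v' - int v * int u'"
  have \<Delta>0: "\<Delta> \<noteq> 0"
  proof
    assume "\<Delta> = 0"
    hence "int (u * v') = int (v * u')" by (simp add: \<Delta>_def)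
    hence eq: "u * v' = v * u'" by (simp only: of_nat_eq_iff)
    hence "v dvd u * v'" by simp
    hence "v dvd u \<or> v dvd v'" using primes(1) by (simp add: prime_dvd_mult_iff)
    hence "v = u" using primes neq by (auto dest: primes_dvd_imp_eq)
    moreover from this eq have "v' = u'" using prime_gt_0_nat[OF primes(1)] by simp
    ultimately show False using neq by simp
  qed
  have prod_le: "int a * int b \<le> int V ^ 2" if "a \<le> V" "b \<le> V" for a b
    using that unfolding power2_eq_square by (intro mult_mono) auto
  have pos: "0 \<le> int u * int v'" "0 \<le> int v * int u'" by simp_all
  have \<Delta>1: "\<bar>\<Delta>\<bar> \<le> int V ^ 2"
    unfolding \<Delta>_def using prod_le[OF le(3,2)] prod_le[OF le(1,4)] pos by linarith
  have w_le: "\<bar>int a * w1 - int b * w2\<bar> \<le> 2 * int N * int V ^ 2" if "a \<le> V" "b \<le> V" for a b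
  proof -
    have "\<bar>int a * w1\<bar> \<le> int V * (int N * int V)" "\<bar>int b * w2\<bar> \<le> int V * (int N * int V)"
      unfolding abs_mult using that w by (auto intro!: mult_mono)
    moreover have "int V * (int N * int V) = int N * int V ^ 2" by (simp add: power2_eq_square)
    ultimately show ?thesis by linarith
  qed
  have "[int u * (int v' * F h - int v * F h') - int v * (int u' * F h - int u * F h') = int u * w1 - int v * w2] (mod int p)"
    by (intro cong_diff cong_mult cong_refl c1 c2)
  moreover have "int u * (int v' * F h - int v * F h') - int v * (int u' * F h - int u * F h') = \<Delta> * F h"
    by (simp add: \<Delta>_def algebra_simps)
  ultimately have "[\<Delta> * F h = int u * w1 - int v * w2] (mod int p)" by simp
  moreover have "[int u' * (int v' * F h - int v * F h') - int v' * (int u' * F h - int u * F h') = int u' * w1 - int v' * w2] (mod int p)"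
    by (intro cong_diff cong_mult cong_refl c1 c2)
  moreover have "int u' * (int v' * F h - int v * F h') - int v' * (int u' * F h - int u * F h') = \<Delta> * F h'"
    by (simp add: \<Delta>_def algebra_simps)
  ultimately have "[\<Delta> * F h = int u * w1 - int v * w2] (mod int p)" "[\<Delta> * F h' = int u' * w1 - int v' * w2] (mod int p)"
    by simp_all
  thus ?thesis using approx_if_signed[OF \<Delta>0 \<Delta>1] w_le le by blast
qed

end

text \<open>The first size condition turns congruences between cleared fractions into equalities of
  integers. The second leaves at most four primes of \<open>P\<close> dividing a numerator, the
  third at most two dividing a denominator.\<close>

locale cubic_quotients = cubic_mod +
  fixes I :: "(int \<times> int) set" and P :: "nat set" and V0 V :: nat
  assumes I: "I \<subseteq> grid" "inj_on (\<lambda>x. S x mod int p) I"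
    and S_nz: "\<And>x. x \<in> I \<Longrightarrow> \<not> int p dvd S x"
    and P: "\<And>v. v \<in> P \<Longrightarrow> prime v \<and> V0 \<le> v \<and> v \<le> V"
    and V0: "0 < V0" and size: "6 * N * V ^ 5 < p" "3 * N * V ^ 2 < V0 ^ 5" "V ^ 2 < V0 ^ 3"
begin

text \<open>\<open>W h / D h\<close> is a fixed choice of small fraction for \<open>F h\<close>;
  both values carry information only when \<open>R h\<close> holds.\<close>

definition D :: "int \<Rightarrow> int" where "D h = fst (SOME dw. approx V h (fst dw) (snd dw))"

definition W :: "int \<Rightarrow> int" where "W h = snd (SOME dw. approx V h (fst dw) (snd dw))"

definition R :: "int \<Rightarrow> bool" where "R h \<longleftrightarrow> (\<exists>d w. approx V h d w)"

lemma approx_D_W: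
  assumes "R h"
  shows "approx V h (D h) (W h)"
proof -
  have "\<exists>dw. approx V h (fst dw) (snd dw)" using assms by (auto simp: R_def)
  from someI_ex[OF this] show ?thesis by (simp only: D_def W_def)
qed

lemma finite_P: "finite P"
  by (rule finite_subset[of _ "{..V}"]) (use P in auto)

lemma finite_I: "finite I"
  using I(1) finite_grid finite_subset by blast

text \<open>When \<open>F h\<close> is a small fraction, \<open>k - F h\<close> has the numerator
  \<open>D h * k - W h\<close>. Primes dividing it could cancel in the quotient and are
  discarded.\<close>

definition bad :: "int \<times> int \<Rightarrow> nat set" where
  "bad x = {v \<in> P. R (fst x) \<and> int v dvd D (fst x) * snd x - W (fst x)}"

definition G :: "((int \<times> int) \<times> nat) set" where "G = (SIGMA x:I. P - bad x)"

lemma finite_G: "finite G"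
  unfolding G_def using finite_I finite_P by auto

lemma V_pos:
  assumes "v \<in> P"
  shows "V > 0"
  using P[OF assms] prime_gt_0_nat[of v] by simp

lemma monomial_less_p:
  assumes "V > 0" "i \<le> 1" "j \<le> 5"
  shows "6 * (int N ^ i * int V ^ j) < int p"
proof -
  have "N ^ i * V ^ j \<le> N ^ 1 * V ^ 5"
    using assms N by (intro mult_mono power_increasing) auto
  hence "6 * (N ^ i * V ^ j) < p" using size(1) by simp
  hence "int (6 * (N ^ i * V ^ j)) < int p" by (simp only: of_nat_less_iff)
  thus ?thesis by simp
qed

lemma fst_snd_I:
  assumes "x \<in> I"
  shows "1 \<le> fst x" "fst x \<le> int N" "0 \<le> snd x" "snd x < int N"
  using assms I(1) by (auto simp: grid_def)

lemma D_times_snd_le: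
  assumes "x \<in> I" "R (fst x)"
  shows "\<bar>D (fst x) * snd x - W (fst x)\<bar> \<le> 3 * int N * int V ^ 2"
proof -
  note a = approx_D_W[OF assms(2), unfolded approx_def]
  have "D (fst x) * snd x \<le> int V ^ 2 * int N"
    using a fst_snd_I[OF assms(1)] by (intro mult_mono) auto
  moreover have "0 \<le> D (fst x) * snd x" using a fst_snd_I[OF assms(1)] by simp
  moreover have "int V ^ 2 * int N = int N * int V ^ 2" by simp
  ultimately show ?thesis using a by linarith
qed

lemma not_p_dvd_small: "0 < d \<Longrightarrow> d < int p \<Longrightarrow> \<not> int p dvd d"
  using zdvd_imp_le[of "int p" d] by auto

lemma cong_D_S:
  assumes "R (fst x)"
  shows "[D (fst x) * S x = D (fst x) * snd x - W (fst x)] (mod int p)"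
proof -
  have "[D (fst x) * snd x - D (fst x) * F (fst x) = D (fst x) * snd x - W (fst x)] (mod int p)"
    using approx_D_W[OF assms] by (intro cong_diff cong_refl) (simp add: approx_def)
  thus ?thesis by (simp add: S_def right_diff_distrib)
qed

text \<open>The numerator is nonzero, since \<open>p\<close> divides neither \<open>S x\<close> nor
  the small denominator, and it is below \<open>V0 ^ 5\<close> in absolute value.\<close>

lemma card_bad_le:
  assumes "x \<in> I"
  shows "card (bad x) \<le> 4"
proof (cases "bad x = {}")
  case False
  then obtain v where "v \<in> bad x" by blast
  hence v: "v \<in> P" "R (fst x)" by (auto simp: bad_def)
  let ?m = "D (fst x) * snd x - W (fst x)"
  note a = approx_D_W[OF v(2), unfolded approx_def]
  have "card (bad x) < 5"
  proof (rule card_large_prime_divisors_less[where m = ?m and B = V0])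
    show "finite (bad x)" using finite_P by (simp add: bad_def)
    show "prime q \<and> V0 \<le> q \<and> int q dvd ?m" if "q \<in> bad x" for q
      using that P by (auto simp: bad_def)
    show "?m \<noteq> 0"
    proof
      assume "?m = 0"
      hence "int p dvd D (fst x) * S x" using cong_D_S[OF v(2)] by (simp add: cong_0_iff)
      hence "int p dvd D (fst x)" using S_nz[OF assms] p by (simp add: prime_dvd_mult_iff)
      moreover have "D (fst x) < int p"
        using a monomial_less_p[OF V_pos[OF v(1)], of 0 2] by simp
      ultimately show False using a not_p_dvd_small by blast
    qed
    have "\<bar>?m\<bar> \<le> int (3 * N * V ^ 2)" using D_times_snd_le[OF assms v(2)] by simp
    also have "\<dots> < int (V0 ^ 5)" using size(2) by (simp only: of_nat_less_iff)
    finally show "\<bar>?m\<bar> < int V0 ^ 5" by simp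
  qed (rule V0)
  thus ?thesis by simp
qed simp

lemma card_G_ge: "card I * (card P - 4) \<le> card G"
proof -
  have "card G = (\<Sum>x\<in>I. card (P - bad x))"
    unfolding G_def using finite_I finite_P by (intro card_SigmaI) auto
  also have "\<dots> \<ge> (\<Sum>x\<in>I. card P - 4)"
  proof (rule sum_mono)
    fix x assume "x \<in> I"
    have "card (P - bad x) = card P - card (bad x)"
      using finite_P by (intro card_Diff_subset) (auto simp: bad_def)
    thus "card P - 4 \<le> card (P - bad x)" using card_bad_le[OF \<open>x \<in> I\<close>] by simp
  qed
  finally show ?thesis by simp
qed

lemma card_G_le: "card G \<le> card I * card P"
proof -
  have "G \<subseteq> I \<times> P" by (auto simp: G_def)
  hence "card G \<le> card (I \<times> P)" using finite_I finite_P by (intro card_mono) auto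
  thus ?thesis by (simp add: card_cartesian_product)
qed

section \<open>Coincidences between quotients, in cross-multiplied form\<close>

definition rel :: "(((int \<times> int) \<times> nat) \<times> ((int \<times> int) \<times> nat)) set" where
  "rel = {(a, b) \<in> G \<times> G. [int (snd b) * S (fst a) = int (snd a) * S (fst b)] (mod int p)}"

definition offdiag :: "(((int \<times> int) \<times> nat) \<times> ((int \<times> int) \<times> nat)) set" where
  "offdiag = {(a, b) \<in> rel. snd a \<noteq> snd b}"

definition prime_pairs :: "int \<times> int \<Rightarrow> (nat \<times> nat) set" where
  "prime_pairs hh = {(v, v'). \<exists>k k'. (((fst hh, k), v), ((snd hh, k'), v')) \<in> offdiag}"

lemma offdiagD:
  assumes "(((h, k), v), ((h', k'), v')) \<in> offdiag"
  shows "(h, k) \<in> I" "(h', k') \<in> I" "v \<in> P" "v' \<in> P" "v \<noteq> v'"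
    "v \<notin> bad (h, k)" "v' \<notin> bad (h', k')"
    "[int v' * (k - F h) = int v * (k' - F h')] (mod int p)"
  using assms by (auto simp: offdiag_def rel_def G_def S_def)

lemma offdiag_rel:
  assumes "(((h, k), v), ((h', k'), v')) \<in> offdiag"
  shows "[int v' * F h - int v * F h' = int v' * k - int v * k'] (mod int p)"
    "\<bar>int v' * k - int v * k'\<bar> \<le> int N * int V"
proof -
  note o = offdiagD[OF assms]
  have "int p dvd int v' * (k - F h) - int v * (k' - F h')" using o(8) by (simp only: cong_iff_dvd_diff)
  moreover have "int v' * F h - int v * F h' - (int v' * k - int v * k') =
      - (int v' * (k - F h) - int v * (k' - F h'))" by (simp add: algebra_simps)
  ultimately show "[int v' * F h - int v * F h' = int v' * k - int v * k'] (mod int p)"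
    by (simp only: cong_iff_dvd_diff dvd_minus_iff)
  have "int v' * k \<le> int V * int N" "int v * k' \<le> int V * int N"
    using fst_snd_I[OF o(1)] fst_snd_I[OF o(2)] P[OF o(3)] P[OF o(4)] by (auto intro!: mult_mono)
  moreover have "0 \<le> int v' * k" "0 \<le> int v * k'"
    using fst_snd_I[OF o(1)] fst_snd_I[OF o(2)] by auto
  ultimately show "\<bar>int v' * k - int v * k'\<bar> \<le> int N * int V" by (simp add: mult.commute)
qed

text \<open>With both values of \<open>F\<close> written as small fractions, the coincidence becomes
  an equality of integers between \<open>v' * D h' * x\<close> and \<open>v * D h * y\<close>. Since
  \<open>v\<close> divides neither \<open>v'\<close> nor the numerator \<open>x\<close>, it must
  divide \<open>D h'\<close>; symmetrically \<open>v'\<close> divides \<open>D h\<close>.\<close>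

lemma offdiag_dvd:
  assumes od: "(((h, k), v), ((h', k'), v')) \<in> offdiag" and R: "R h" "R h'"
  shows "int v dvd D h'" "int v' dvd D h"
proof -
  note o = offdiagD[OF od]
  note a = approx_D_W[OF R(1), unfolded approx_def] and a' = approx_D_W[OF R(2), unfolded approx_def]
  define x where "x = D h * k - W h"
  define y where "y = D h' * k' - W h'"
  have x: "\<bar>x\<bar> \<le> 3 * int N * int V ^ 2" and y: "\<bar>y\<bar> \<le> 3 * int N * int V ^ 2"
    using D_times_snd_le[OF o(1)] D_times_snd_le[OF o(2)] R by (simp_all add: x_def y_def)
  have cx: "[D h * (k - F h) = x] (mod int p)" and cy: "[D h' * (k' - F h') = y] (mod int p)"
    using cong_D_S[of "(h, k)"] cong_D_S[of "(h', k')"] R by (simp_all add: x_def y_def S_def)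
  have "[int v' * D h' * x = int v' * D h' * (D h * (k - F h))] (mod int p)"
    by (intro cong_mult cong_refl cong_sym[OF cx])
  also have "int v' * D h' * (D h * (k - F h)) = D h * D h' * (int v' * (k - F h))" by (simp add: mult_ac)
  also have "[D h * D h' * (int v' * (k - F h)) = D h * D h' * (int v * (k' - F h'))] (mod int p)"
    by (intro cong_mult cong_refl o(8))
  also have "D h * D h' * (int v * (k' - F h')) = int v * D h * (D h' * (k' - F h'))" by (simp add: mult_ac)
  also have "[int v * D h * (D h' * (k' - F h')) = int v * D h * y] (mod int p)"
    by (intro cong_mult cong_refl cy)
  finally have "[int v' * D h' * x = int v * D h * y] (mod int p)" .
  moreover have "\<bar>int v' * D h' * x - int v * D h * y\<bar> < int p"
  proof -
    have "\<bar>int v' * D h' * x\<bar> \<le> int V * int V ^ 2 * (3 * int N * int V ^ 2)"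
      unfolding abs_mult using P[OF o(4)] a' x by (intro mult_mono) auto
    moreover have "\<bar>int v * D h * y\<bar> \<le> int V * int V ^ 2 * (3 * int N * int V ^ 2)"
      unfolding abs_mult using P[OF o(3)] a y by (intro mult_mono) auto
    moreover have "int V * int V ^ 2 * (3 * int N * int V ^ 2) = 3 * (int N ^ 1 * int V ^ 5)"
      by (simp add: eval_nat_numeral mult_ac)
    ultimately show ?thesis using monomial_less_p[OF V_pos[OF o(3)], of 1 5] by linarith
  qed
  ultimately have eq: "int v' * D h' * x = int v * D h * y" by (rule cong_small_imp_eq)
  have pv: "prime (int v)" "prime (int v')" using P[OF o(3)] P[OF o(4)] by auto
  have ndvd: "\<not> int v dvd int v'" "\<not> int v' dvd int v"
    using P[OF o(3)] P[OF o(4)] o(5) by (auto dest: primes_dvd_imp_eq)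
  have "\<not> int v dvd x" using o(6) o(3) R by (auto simp: bad_def x_def)
  moreover have "int v dvd int v' * D h' * x" unfolding eq by simp
  ultimately show "int v dvd D h'" using pv ndvd by (auto simp: prime_dvd_mult_iff)
  have "\<not> int v' dvd y" using o(7) o(4) R by (auto simp: bad_def y_def)
  moreover have "int v' dvd int v * D h * y" unfolding eq[symmetric] by simp
  ultimately show "int v' dvd D h" using pv ndvd by (auto simp: prime_dvd_mult_iff)
qed

lemma prime_pairs_subset: "prime_pairs hh \<subseteq> P \<times> P"
  using offdiagD(3,4) by (fastforce simp: prime_pairs_def)

lemma finite_prime_pairs: "finite (prime_pairs hh)"
  using prime_pairs_subset finite_P by (meson finite_SigmaI finite_subset)

lemma card_P_dvd_D_le:
  assumes "R h"
  shows "card {v \<in> P. int v dvd D h} \<le> 2"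
proof -
  note a = approx_D_W[OF assms, unfolded approx_def]
  have "card {v \<in> P. int v dvd D h} < 3"
  proof (rule card_large_prime_divisors_less[where m = "D h" and B = V0])
    have "D h \<le> int (V ^ 2)" using a by simp
    also have "\<dots> < int (V0 ^ 3)" using size(3) by (simp only: of_nat_less_iff)
    finally show "\<bar>D h\<bar> < int V0 ^ 3" using a by simp
  qed (use a V0 finite_P P in auto)
  thus ?thesis by simp
qed

text \<open>Two different prime pairs for the same \<open>(h, h')\<close> already make
  \<open>F h\<close> and \<open>F h'\<close> small fractions. All the pairs then consist of prime
  divisors of the two denominators, of which each has at most two in \<open>P\<close>.\<close>

lemma card_prime_pairs_le: "card (prime_pairs hh) \<le> 4"
proof (cases "\<exists>x y. x \<in> prime_pairs hh \<and> y \<in> prime_pairs hh \<and> x \<noteq> y")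
  case False
  hence "card (prime_pairs hh) \<le> Suc 0"
    using finite_prime_pairs by (subst card_le_Suc0_iff_eq) auto
  thus ?thesis by simp
next
  case True
  obtain h h' where hh: "hh = (h, h')" by (cases hh)
  from True obtain v v' u u' where "(v, v') \<in> prime_pairs hh" "(u, u') \<in> prime_pairs hh" "(v, v') \<noteq> (u, u')"
    by fast
  then obtain k k' l l' where
    1: "(((h, k), v), ((h', k'), v')) \<in> offdiag" and 2: "(((h, l), u), ((h', l'), u')) \<in> offdiag"
    and neq: "(v, v') \<noteq> (u, u')"
    by (auto simp: prime_pairs_def hh)
  have "(\<exists>d w. approx V h d w) \<and> (\<exists>d w. approx V h' d w)"
    using P[OF offdiagD(3)[OF 1]] P[OF offdiagD(4)[OF 1]] P[OF offdiagD(3)[OF 2]] P[OF offdiagD(4)[OF 2]]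
    by (intro approx_if_two_relations[OF _ _ _ _ offdiagD(5)[OF 1] offdiagD(5)[OF 2] neq _ _ _ _
      offdiag_rel(2)[OF 1] offdiag_rel(2)[OF 2] offdiag_rel(1)[OF 1] offdiag_rel(1)[OF 2]]) auto
  hence R: "R h" "R h'" by (auto simp: R_def)
  have "prime_pairs hh \<subseteq> {v \<in> P. int v dvd D h'} \<times> {v \<in> P. int v dvd D h}"
    using offdiagD(3,4) offdiag_dvd[OF _ R] by (fastforce simp: prime_pairs_def hh)
  hence "card (prime_pairs hh) \<le> card ({v \<in> P. int v dvd D h'} \<times> {v \<in> P. int v dvd D h})"
    using finite_P by (intro card_mono) auto
  also have "\<dots> \<le> 2 * 2"
    unfolding card_cartesian_product by (intro mult_mono card_P_dvd_D_le R) auto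
  finally show ?thesis by simp
qed

text \<open>For fixed \<open>h\<close>, \<open>h'\<close>, \<open>v\<close>, \<open>v'\<close> the
  integer \<open>v' * k - v * k'\<close> is determined, being small and known modulo
  \<open>p\<close>. Hence \<open>k\<close> is determined modulo \<open>v\<close>, the quotient
  \<open>k div v\<close> recovers \<open>k\<close>, and \<open>k'\<close> follows.\<close>

lemma card_offdiag_le: "card offdiag \<le> 4 * N ^ 2 * (N div V0 + 1)"
proof -
  define HH where "HH = {1..int N} \<times> {1..int N}"
  define M where "M = (SIGMA hh:HH. prime_pairs hh \<times> {0..int (N div V0)})"
  define f :: "((int \<times> int) \<times> nat) \<times> ((int \<times> int) \<times> nat) \<Rightarrow> (int \<times> int) \<times> (nat \<times> nat) \<times> int"
    where "f = (\<lambda>(((h, k), v), ((h', k'), v')). ((h, h'), (v, v'), k div int v))"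
  have "card offdiag \<le> card M"
  proof (rule card_inj_on_le)
    show "inj_on f offdiag"
    proof (rule inj_onI)
      fix a b assume ab: "a \<in> offdiag" "b \<in> offdiag" "f a = f b"
      obtain h k v h' k' v' where a: "a = (((h, k), v), ((h', k'), v'))" by (metis surj_pair)
      obtain l l' where b: "b = (((h, l), v), ((h', l'), v'))" and div: "k div int v = l div int v"
        using ab(3) by (cases b) (auto simp: a f_def)
      note o1 = offdiagD[OF ab(1)[unfolded a]] and o2 = offdiagD[OF ab(2)[unfolded b]]
      note r1 = offdiag_rel[OF ab(1)[unfolded a]] and r2 = offdiag_rel[OF ab(2)[unfolded b]]
      have "[int v' * k - int v * k' = int v' * l - int v * l'] (mod int p)"
        using r1(1) r2(1) by (meson cong_sym cong_trans)
      moreover have "\<bar>(int v' * k - int v * k') - (int v' * l - int v * l')\<bar> < int p"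
      proof -
        have "6 * (int N * int V) < int p" using monomial_less_p[OF V_pos[OF o1(3)], of 1 1] by simp
        moreover have "0 \<le> int N * int V" by simp
        ultimately show ?thesis using r1(2) r2(2) by linarith
      qed
      ultimately have eq: "int v' * k - int v * k' = int v' * l - int v * l'" by (rule cong_small_imp_eq)
      hence eq2: "int v' * (k - l) = int v * (k' - l')" by (simp add: algebra_simps)
      have pv: "prime (int v)" "\<not> int v dvd int v'"
        using P[OF o1(3)] P[OF o1(4)] o1(5) by (auto dest: primes_dvd_imp_eq)
      have "int v dvd int v' * (k - l)" unfolding eq2 by simp
      hence "int v dvd k - l" using pv by (simp add: prime_dvd_mult_iff)
      hence "k mod int v = l mod int v" by (simp add: mod_eq_dvd_iff)
      hence "k = l" using div by (metis div_mult_mod_eq)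
      moreover have "k' = l'" using eq \<open>k = l\<close> pv(1) by auto
      ultimately show "a = b" by (simp add: a b)
    qed
    show "f ` offdiag \<subseteq> M"
    proof
      fix z assume "z \<in> f ` offdiag"
      then obtain a where ab: "a \<in> offdiag" "z = f a" by blast
      obtain h k v h' k' v' where a: "a = (((h, k), v), ((h', k'), v'))" by (metis surj_pair)
      note o = offdiagD[OF ab(1)[unfolded a]]
      have "(h, h') \<in> HH" using fst_snd_I[OF o(1)] fst_snd_I[OF o(2)] by (auto simp: HH_def)
      moreover have "(v, v') \<in> prime_pairs (h, h')" using ab(1) by (auto simp: prime_pairs_def a)
      moreover have "k div int v \<in> {0..int (N div V0)}"
      proof -
        have "k div int v \<le> int N div int v"
          using fst_snd_I[OF o(1)] by (intro zdiv_mono1) (use P[OF o(3)] prime_gt_0_nat in auto)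
        also have "\<dots> \<le> int N div int V0" using P[OF o(3)] V0 by (intro zdiv_mono2) auto
        also have "\<dots> = int (N div V0)" by (simp add: zdiv_int)
        finally show ?thesis using fst_snd_I[OF o(1)] by (simp add: pos_imp_zdiv_nonneg_iff div_int_pos_iff)
      qed
      ultimately show "z \<in> M" by (simp add: ab(2) a f_def M_def)
    qed
    show "finite M" unfolding M_def HH_def using finite_prime_pairs by (intro finite_SigmaI) auto
  qed
  also have "card M = (\<Sum>hh\<in>HH. card (prime_pairs hh \<times> {0..int (N div V0)}))"
    unfolding M_def HH_def using finite_prime_pairs by (intro card_SigmaI) auto
  also have "\<dots> \<le> (\<Sum>hh\<in>HH. 4 * (N div V0 + 1))"
  proof (rule sum_mono)
    fix hh
    have "card {0..int (N div V0)} = N div V0 + 1" by simp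
    thus "card (prime_pairs hh \<times> {0..int (N div V0)}) \<le> 4 * (N div V0 + 1)"
      by (simp only: card_cartesian_product mult_le_mono1 card_prime_pairs_le)
  qed
  also have "\<dots> = 4 * N ^ 2 * (N div V0 + 1)"
    by (simp add: HH_def card_cartesian_product power2_eq_square algebra_simps)
  finally show ?thesis .
qed

lemma card_rel_le: "card rel \<le> card G + 4 * N ^ 2 * (N div V0 + 1)"
proof -
  have "rel \<subseteq> (\<lambda>a. (a, a)) ` G \<union> offdiag"
  proof
    fix z assume z: "z \<in> rel"
    obtain x v y u where zz: "z = ((x, v), (y, u))" by (metis surj_pair)
    show "z \<in> (\<lambda>a. (a, a)) ` G \<union> offdiag"
    proof (cases "v = u")
      case False
      thus ?thesis using z by (simp add: offdiag_def zz)
    next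
      case True
      have mem: "x \<in> I" "y \<in> I" "v \<in> P" "(x, v) \<in> G" and c: "[int v * S x = int v * S y] (mod int p)"
        using z True by (auto simp: rel_def G_def zz)
      \<comment> \<open>For equal primes \<open>v\<close> cancels modulo \<open>p\<close>, and
        injectivity on \<open>I\<close> leaves only the diagonal.\<close>
      have "int v < int p" using P[OF mem(3)] monomial_less_p[OF V_pos[OF mem(3)], of 0 1] by simp
      hence "coprime (int v) (int p)"
        using P[OF mem(3)] prime_gt_0_nat[of v] by (intro coprime_p not_p_dvd_small) auto
      hence "[S x = S y] (mod int p)" using c by (simp only: cong_mult_lcancel)
      hence "x = y" using inj_onD[OF I(2), of x y] mem by (simp add: cong_def)
      thus ?thesis using True mem by (simp add: zz)
    qed
  qed
  moreover have "finite offdiag"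
    by (rule finite_subset[of _ "G \<times> G"]) (auto simp: offdiag_def rel_def finite_G)
  ultimately have "card rel \<le> card ((\<lambda>a. (a, a)) ` G \<union> offdiag)"
    using finite_G by (intro card_mono) auto
  also have "\<dots> \<le> card ((\<lambda>a. (a, a)) ` G) + card offdiag" by (rule card_Un_le)
  also have "\<dots> \<le> card G + 4 * N ^ 2 * (N div V0 + 1)"
    by (intro add_mono card_image_le finite_G card_offdiag_le)
  finally show ?thesis .
qed

text \<open>Cauchy-Schwarz for the map that sends a point and an admissible prime to
  \<open>S x / v\<close> modulo \<open>p\<close>; its coincidences lie in
  \<open>rel\<close>.\<close>

lemma exists_many_quotients:
  "\<exists>X \<subseteq> {0..<int p}. (\<forall>x\<in>X. \<exists>y\<in>I. \<exists>v\<in>P. [int v * x = S y] (mod int p)) \<and>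
     (card I * (card P - 4))\<^sup>2 \<le> card X * (card I * card P + 4 * N ^ 2 * (N div V0 + 1))"
proof -
  have "\<exists>x. x \<in> {0..<int p} \<and> [int v * x = s] (mod int p)" if v: "v \<in> P" for v s
  proof -
    have "int v < int p" using P[OF v] monomial_less_p[OF V_pos[OF v], of 0 1] by simp
    hence "coprime (int v) (int p)"
      using P[OF v] prime_gt_0_nat[of v] by (intro coprime_p not_p_dvd_small) auto
    then obtain u where u: "[int v * u = 1] (mod int p)" using cong_solve_coprime_int by blast
    have "[int v * (u * s mod int p) = int v * (u * s)] (mod int p)"
      by (intro cong_mult cong_refl) (simp add: cong_def)
    also have "int v * (u * s) = (int v * u) * s" by simp
    also have "[(int v * u) * s = 1 * s] (mod int p)" by (intro cong_mult cong_refl u)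
    finally have "[int v * (u * s mod int p) = s] (mod int p)" by simp
    moreover have "u * s mod int p \<in> {0..<int p}" using prime_gt_0_nat[OF p] by simp
    ultimately show ?thesis by blast
  qed
  then obtain \<phi> where \<phi>: "\<And>v s. v \<in> P \<Longrightarrow> \<phi> v s \<in> {0..<int p} \<and> [int v * \<phi> v s = s] (mod int p)" by metis
  define \<Psi> where "\<Psi> = (\<lambda>a. \<phi> (snd a) (S (fst a)))"
  have GP: "snd a \<in> P" "fst a \<in> I" if "a \<in> G" for a using that by (auto simp: G_def)
  have "{(a, b) \<in> G \<times> G. \<Psi> a = \<Psi> b} \<subseteq> rel"
  proof (clarify)
    fix x v y u assume *: "(x, v) \<in> G" "(y, u) \<in> G" "\<Psi> (x, v) = \<Psi> (y, u)"
    define t where "t = \<Psi> (x, v)"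
    have 1: "[int v * t = S x] (mod int p)" using \<phi>[of v "S x"] GP[OF *(1)] by (simp add: t_def \<Psi>_def)
    have 2: "[int u * t = S y] (mod int p)" using \<phi>[of u "S y"] GP[OF *(2)] *(3) by (simp add: t_def \<Psi>_def)
    have "[int u * S x = int u * (int v * t)] (mod int p)" by (intro cong_mult cong_refl cong_sym[OF 1])
    also have "int u * (int v * t) = int v * (int u * t)" by simp
    also have "[int v * (int u * t) = int v * S y] (mod int p)" by (intro cong_mult cong_refl 2)
    finally show "((x, v), (y, u)) \<in> rel" using * by (simp add: rel_def)
  qed
  moreover have "finite rel" by (rule finite_subset[of _ "G \<times> G"]) (auto simp: rel_def finite_G)
  ultimately have en: "card {(a, b) \<in> G \<times> G. \<Psi> a = \<Psi> b} \<le> card rel" by (intro card_mono)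
  have "(card I * (card P - 4))\<^sup>2 \<le> (card G)\<^sup>2" by (intro power_mono card_G_ge) auto
  also have "\<dots> \<le> card (\<Psi> ` G) * card {(a, b) \<in> G \<times> G. \<Psi> a = \<Psi> b}"
    by (rule card_square_le_card_image_mult_energy[OF finite_G])
  also have "\<dots> \<le> card (\<Psi> ` G) * (card I * card P + 4 * N ^ 2 * (N div V0 + 1))"
    using en card_rel_le card_G_le by (intro mult_left_mono) auto
  finally have "(card I * (card P - 4))\<^sup>2 \<le> card (\<Psi> ` G) * (card I * card P + 4 * N ^ 2 * (N div V0 + 1))" .
  moreover have "\<Psi> ` G \<subseteq> {0..<int p}" using \<phi> GP by (auto simp: \<Psi>_def)
  moreover have "\<exists>y\<in>I. \<exists>v\<in>P. [int v * x = S y] (mod int p)" if "x \<in> \<Psi> ` G" for x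
    using that \<phi> GP by (fastforce simp: \<Psi>_def)
  ultimately show ?thesis by blast
qed

end

subsection \<open>Points of the cubic in a box\<close>

lemma finite_curve_pts: "finite (curve_pts p a c)"
  by (rule finite_subset[of _ "{0..p - 1} \<times> {0..p - 1}"]) (auto simp: curve_pts_def)

lemma two_le_card_curve_box:
  assumes "P \<in> curve_pts p a c \<inter> box_pts p X Y H" "P' \<in> curve_pts p a c \<inter> box_pts p X Y H" "P \<noteq> P'"
  shows "2 \<le> card (curve_pts p a c \<inter> box_pts p X Y H)"
proof -
  have "card {P, P'} \<le> card (curve_pts p a c \<inter> box_pts p X Y H)"
    using assms by (intro card_mono finite_Int) (auto simp: finite_curve_pts)
  thus ?thesis using assms(3) by simp
qed

lemma two_points_if_side_ge_p:
  fixes p H :: int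
  assumes "p > 1" "H \<ge> p"
  shows "2 \<le> card (curve_pts p a c \<inter> box_pts p 0 0 H)"
proof (rule two_le_card_curve_box)
  \<comment> \<open>Offsets in a box start at 1, so the residue 0 is reached with
    \<open>i = p\<close>.\<close>
  have rep: "\<exists>i. 1 \<le> i \<and> i \<le> H \<and> [x = 0 + i] (mod p)" if "0 \<le> x" "x < p" for x
  proof (cases "x = 0")
    case True
    thus ?thesis using assms by (intro exI[of _ p]) (auto simp: cong_def)
  next
    case False
    thus ?thesis using assms that by (intro exI[of _ x]) auto
  qed
  have mem: "(x, (a * x ^ 3 + c * x) mod p) \<in> curve_pts p a c \<inter> box_pts p 0 0 H"
    if x: "0 \<le> x" "x < p" for x
  proof -
    let ?y = "(a * x ^ 3 + c * x) mod p"
    have y: "0 \<le> ?y" "?y < p" using assms by auto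
    obtain i j where "1 \<le> i" "i \<le> H" "[x = 0 + i] (mod p)" "1 \<le> j" "j \<le> H" "[?y = 0 + j] (mod p)"
      using rep[OF x] rep[OF y] by blast
    thus ?thesis using x y by (auto simp: curve_pts_def box_pts_def cong_def)
  qed
  show "(0, (a * 0 ^ 3 + c * 0) mod p) \<in> curve_pts p a c \<inter> box_pts p 0 0 H"
    using assms by (intro mem) auto
  show "(1, (a * 1 ^ 3 + c * 1) mod p) \<in> curve_pts p a c \<inter> box_pts p 0 0 H"
    using assms by (intro mem) auto
qed auto

lemma two_points_if_cong:
  fixes p H :: int
  assumes p: "p > 1" and h: "1 \<le> h" "h < H" "h < p" and k: "0 \<le> k" "k < H"
    and eq: "[(a * (x + h) ^ 3 + c * (x + h)) - (a * x ^ 3 + c * x) = k] (mod p)"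
  shows "\<exists>X Y. 0 \<le> X \<and> X \<le> p - 1 \<and> 0 \<le> Y \<and> Y \<le> p - 1 \<and>
    2 \<le> card (curve_pts p a c \<inter> box_pts p X Y H)"
proof -
  define f where "f = (\<lambda>x. a * x ^ 3 + c * x)"
  \<comment> \<open>The corner is shifted by 1 so that the first point has offset
    \<open>(1, 1)\<close> and the second \<open>(h + 1, k + 1)\<close>.\<close>
  define X where "X = (x - 1) mod p"
  define Y where "Y = (f x - 1) mod p"
  have bounds: "0 \<le> z mod p" "z mod p \<le> p - 1" for z :: int using p by auto
  have mem: "(z mod p, f z mod p) \<in> curve_pts p a c \<inter> box_pts p X Y H"
    if ij: "1 \<le> i" "i \<le> H" "1 \<le> j" "j \<le> H" "[z = (x - 1) + i] (mod p)" "[f z = (f x - 1) + j] (mod p)" for z i j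
  proof -
    have "[f z mod p = f (z mod p)] (mod p)"
      unfolding f_def cong_def
      by (metis (no_types, opaque_lifting) mod_add_eq mod_mod_trivial mod_mult_right_eq power_mod)
    moreover have "[z mod p = X + i] (mod p)" "[f z mod p = Y + j] (mod p)"
      using ij(5,6) by (simp_all add: cong_def X_def Y_def mod_simps)
    ultimately show ?thesis using ij bounds
      by (auto simp: curve_pts_def box_pts_def f_def)
  qed
  have "2 \<le> card (curve_pts p a c \<inter> box_pts p X Y H)"
  proof (rule two_le_card_curve_box)
    show "(x mod p, f x mod p) \<in> curve_pts p a c \<inter> box_pts p X Y H"
      using h k by (intro mem[of 1 1]) auto
    have "[f x + (f (x + h) - f x) = f x + k] (mod p)"
      using eq unfolding f_def by (intro cong_add cong_refl)
    hence "[f (x + h) = (f x - 1) + (k + 1)] (mod p)" by simp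
    thus "((x + h) mod p, f (x + h) mod p) \<in> curve_pts p a c \<inter> box_pts p X Y H"
      using h k by (intro mem[of "h + 1" "k + 1"]) auto
    have "x mod p \<noteq> (x + h) mod p"
    proof
      assume "x mod p = (x + h) mod p"
      hence "p dvd h" by (metis add_diff_cancel_left' mod_eq_dvd_iff)
      thus False using h zdvd_imp_le[of p h] by auto
    qed
    thus "(x mod p, f x mod p) \<noteq> ((x + h) mod p, f (x + h) mod p)" by simp
  qed
  thus ?thesis using bounds unfolding X_def Y_def by blast
qed

text \<open>Completing the square: the difference of ordinates at \<open>x + h\<close> and
  \<open>x\<close> equals \<open>k\<close> iff \<open>(6 * a * h * x + 3 * a * h ^ 2) ^ 2\<close> is
  \<open>12 * a * h\<close> times \<open>k - c * h - (a / 4) * h ^ 3\<close>. This is the origin of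
  \<open>A\<close>, and \<open>x\<close> is found by solving the linear equation for a given root
  \<open>y\<close>.\<close>

lemma two_points_if_square:
  fixes p :: nat and H :: int
  assumes p: "prime p" "p > 3" and a: "\<not> int p dvd a" and A: "[4 * A = a] (mod int p)"
    and h: "1 \<le> h" "h < H" "h < int p" and k: "0 \<le> k" "k < H"
    and y: "[y ^ 2 = 12 * a * h * (k - (A * h ^ 3 + c * h))] (mod int p)"
  shows "\<exists>X Y. 0 \<le> X \<and> X \<le> int p - 1 \<and> 0 \<le> Y \<and> Y \<le> int p - 1 \<and>
    2 \<le> card (curve_pts (int p) a c \<inter> box_pts (int p) X Y H)"
proof -
  have pi: "prime (int p)" using p by simp
  have "\<not> int p dvd 6"
  proof
    assume "int p dvd 6"
    hence "int p dvd 2 * 3" by simp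
    hence "int p dvd 2 \<or> int p dvd 3" using pi prime_dvd_mult_iff by blast
    thus False using p(2) zdvd_imp_le[of "int p" 2] zdvd_imp_le[of "int p" 3] by auto
  qed
  moreover have "\<not> int p dvd h" using h zdvd_imp_le[of "int p" h] by auto
  ultimately have nd: "\<not> int p dvd 6 * a * h" using a pi by (simp add: prime_dvd_mult_iff)
  hence cop: "coprime (6 * a * h) (int p)"
    using pi prime_imp_coprime coprime_commute by blast
  then obtain u where u: "[6 * a * h * u = 1] (mod int p)" using cong_solve_coprime_int by blast
  define x where "x = u * (y - 3 * a * h ^ 2)"
  have "[6 * a * h * u * (y - 3 * a * h ^ 2) = 1 * (y - 3 * a * h ^ 2)] (mod int p)"
    by (intro cong_mult cong_refl u)
  hence x: "[6 * a * h * x + 3 * a * h ^ 2 = (y - 3 * a * h ^ 2) + 3 * a * h ^ 2] (mod int p)"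
    unfolding x_def by (intro cong_add cong_refl) (simp add: mult.assoc)
  define d where "d = (a * (x + h) ^ 3 + c * (x + h)) - (a * x ^ 3 + c * x)"
  have "int p dvd 4 * A - a" using A by (simp only: cong_iff_dvd_diff)
  hence dA: "int p dvd (3 * a * h ^ 4) * (4 * A - a)" by (rule dvd_mult)
  have d1: "int p dvd (6 * a * h * x + 3 * a * h ^ 2) ^ 2 - y ^ 2"
    using cong_pow[OF x, of 2] by (simp add: cong_iff_dvd_diff)
  have d2: "int p dvd y ^ 2 - 12 * a * h * (k - (A * h ^ 3 + c * h))"
    using y by (simp only: cong_iff_dvd_diff)
  have "int p dvd ((6 * a * h * x + 3 * a * h ^ 2) ^ 2 - y ^ 2) +
      (y ^ 2 - 12 * a * h * (k - (A * h ^ 3 + c * h))) - (3 * a * h ^ 4) * (4 * A - a)"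
    by (rule dvd_diff[OF dvd_add[OF d1 d2] dA])
  also have "((6 * a * h * x + 3 * a * h ^ 2) ^ 2 - y ^ 2) +
      (y ^ 2 - 12 * a * h * (k - (A * h ^ 3 + c * h))) - (3 * a * h ^ 4) * (4 * A - a) =
      2 * (6 * a * h) * (d - k)"
    by (simp add: d_def algebra_simps power2_eq_square power3_eq_cube eval_nat_numeral)
  finally have "int p dvd 2 * (6 * a * h) * (d - k)" .
  moreover have "\<not> int p dvd 2" using p(2) zdvd_imp_le[of "int p" 2] by auto
  ultimately have "int p dvd d - k" using nd pi prime_dvd_mult_iff by blast
  hence "[d = k] (mod int p)" by (simp only: cong_iff_dvd_diff)
  thus ?thesis using p h k unfolding d_def by (intro two_points_if_cong[of "int p" h H k]) auto
qed

section \<open>Consequences of the assumption that every box contains at most one point\<close>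

locale sparse_cubic =
  fixes p :: nat and a c :: int and H :: int
  assumes p: "prime p" "p > 3" and a: "\<not> int p dvd a"
    and sparse: "\<not> (\<exists>X Y. 0 \<le> X \<and> X \<le> int p - 1 \<and> 0 \<le> Y \<and> Y \<le> int p - 1 \<and>
      2 \<le> card (curve_pts (int p) a c \<inter> box_pts (int p) X Y H))"
begin

text \<open>A square discriminant, zero included, would give two points in one box; so the
  discriminant is a nonresidue.\<close>

lemma Legendre_eq:
  assumes A: "[4 * A = a] (mod int p)" and h: "1 \<le> h" "h < H" "h < int p" and k: "0 \<le> k" "k < H"
  shows "Legendre (12 * a * h) (int p) * Legendre (k - (A * h ^ 3 + c * h)) (int p) = -1"
proof -
  let ?D = "12 * a * h * (k - (A * h ^ 3 + c * h))"
  have no: "\<not> [y ^ 2 = ?D] (mod int p)" for y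
    using two_points_if_square[OF p a A h k] sparse by blast
  have "\<not> QuadRes (int p) ?D" using no by (simp add: QuadRes_def)
  moreover have "\<not> [?D = 0] (mod int p)" using no[of 0] by (auto simp: cong_sym_eq)
  ultimately have "Legendre ?D (int p) = -1" by (simp add: Legendre_def)
  thus ?thesis using p by (simp add: Legendre_mult)
qed

text \<open>Here \<open>i\<close> is the number of distinct residues kept from the grid and
  \<open>x\<close> the number of their quotients by primes. Each quotient starts a run of
  \<open>k\<close> equal symbols, and runs of either sign account for the factor 2.\<close>

lemma counting_inequalities:
  fixes N V0 V T k t :: nat and P :: "nat set"
  assumes N: "N > 0" "2 * int N \<le> H" and Np: "18 * N ^ 5 < p"
    and T: "\<And>m::nat. 0 < m \<Longrightarrow> m \<le> 3 * N ^ 5 \<Longrightarrow> card {d. d dvd m} \<le> T"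
    and P: "\<And>v. v \<in> P \<Longrightarrow> prime v \<and> V0 \<le> v \<and> v \<le> V"
    and V: "0 < V0" "6 * N * V ^ 5 < p" "3 * N * V ^ 2 < V0 ^ 5" "V ^ 2 < V0 ^ 3" "V * k \<le> N"
    and k: "1 \<le> k" and t: "t \<ge> 1" "4 * t ^ 2 \<le> p" "4 * (k + 1 + 2 * t) \<le> p"
  shows "\<exists>i x. N ^ 2 \<le> i * (3 + 4 * T) \<and>
    (i * (card P - 4))\<^sup>2 \<le> x * (i * card P + 4 * N ^ 2 * (N div V0 + 1)) \<and>
    real x \<le> 2 * (p / 2 ^ k + 3 * real k * real p / real t + 3 * real k)"
proof -
  have pi: "prime (int p)" using p by simp
  have n4: "\<not> int p dvd 4" using p(2)
  proof -
    have "\<not> int p dvd 2" using p(2) zdvd_imp_le[of "int p" 2] by auto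
    hence "\<not> int p dvd 2 * 2" using pi prime_dvd_mult_iff by blast
    thus ?thesis by simp
  qed
  hence "coprime 4 (int p)" using pi prime_imp_coprime coprime_commute by blast
  then obtain u where u: "[4 * u = 1] (mod int p)" using cong_solve_coprime_int by blast
  define A where "A = u * a"
  have "[4 * u * a = 1 * a] (mod int p)" by (intro cong_mult cong_refl u)
  hence A: "[4 * A = a] (mod int p)" by (simp add: A_def mult.assoc)
  have nA: "\<not> int p dvd A"
  proof
    assume "int p dvd A"
    hence "int p dvd 4 * A" by simp
    moreover have "int p dvd 4 * A - a" using A by (simp only: cong_iff_dvd_diff)
    ultimately have "int p dvd 4 * A - (4 * A - a)" by (rule dvd_diff)
    thus False using a by simp
  qed
  interpret cm: cubic_mod p A c N by unfold_locales (use p nA N in auto)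
  note Np' = cm.N_less_p[OF Np]
  have L: "Legendre (12 * a * h) (int p) * Legendre (j - cm.F h) (int p) = -1"
    if "1 \<le> h" "h \<le> int N" "0 \<le> j" "j < 2 * int N" for h j
    unfolding cm.F_def using that N Np' by (intro Legendre_eq[OF A]) auto
  obtain I where I: "I \<subseteq> cm.grid" "inj_on (\<lambda>x. cm.S x mod int p) I" "N ^ 2 \<le> card I * (3 + 4 * T)"
    using cm.exists_many_distinct_residues[OF Np T] by blast
  have S_nz: "\<not> int p dvd cm.S x" if "x \<in> I" for x
  proof
    assume "int p dvd cm.S x"
    hence "Legendre (snd x - cm.F (fst x)) (int p) = 0" by (simp add: Legendre_def cm.S_def cong_0_iff)
    moreover have "x \<in> cm.grid" using that I(1) by auto
    ultimately show False using L[of "fst x" "snd x"] by (auto simp: cm.grid_def)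
  qed
  interpret cq: cubic_quotients p A c N I P V0 V
    by unfold_locales (use I S_nz P V in auto)
  obtain X where X: "X \<subseteq> {0..<int p}" "\<And>x. x \<in> X \<Longrightarrow> \<exists>y\<in>I. \<exists>v\<in>P. [int v * x = cm.S y] (mod int p)"
      "(card I * (card P - 4))\<^sup>2 \<le> card X * (card I * card P + 4 * N ^ 2 * (N div V0 + 1))"
    using cq.exists_many_quotients by blast
  define run where "run = (\<lambda>\<eta>. {x \<in> {0..<int p}. \<forall>u\<in>{1..k}. Legendre (x + int u) (int p) = \<eta>})"
  have "X \<subseteq> run 1 \<union> run (-1)"
  proof
    fix x assume x: "x \<in> X"
    then obtain h j v where hjv: "(h, j) \<in> I" "v \<in> P" "[int v * x = j - cm.F h] (mod int p)"
      using X(2) by (fastforce simp: cm.S_def)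
    have hj: "1 \<le> h" "h \<le> int N" "0 \<le> j" "j < int N" using hjv(1) I(1) by (auto simp: cm.grid_def)
    \<comment> \<open>The sign of the run depends only on \<open>h\<close> and \<open>v\<close>; it
      is nonzero because the product of symbols is -1.\<close>
    define \<eta> where "\<eta> = - Legendre (12 * a * h) (int p) * Legendre (int v) (int p)"
    have step: "Legendre (x + int w) (int p) = \<eta> \<and> \<eta> \<in> {1, -1}" if w: "w \<in> {1..k}" for w
    proof -
      \<comment> \<open>\<open>V * k \<le> N\<close> keeps the shifted ordinate
        \<open>j + v * w\<close> below \<open>2 * N\<close>, where the symbol is still under
        control.\<close>
      have "v * w \<le> V * k" using P[OF hjv(2)] w by (intro mult_mono) auto
      hence "int (v * w) \<le> int N" using V(5) by linarith
      hence jw: "0 \<le> j + int v * int w" "j + int v * int w < 2 * int N" using hj by auto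
      have "[int v * x + int v * int w = (j - cm.F h) + int v * int w] (mod int p)"
        using hjv(3) by (intro cong_add cong_refl)
      hence "[int v * (x + int w) = j + int v * int w - cm.F h] (mod int p)"
        by (simp add: algebra_simps)
      hence "Legendre (int v * (x + int w)) (int p) = Legendre (j + int v * int w - cm.F h) (int p)"
        by (rule Legendre_cong)
      hence "Legendre (12 * a * h) (int p) * (Legendre (int v) (int p) * Legendre (x + int w) (int p)) = -1"
        using L[OF hj(1,2) jw] p by (simp add: Legendre_mult)
      thus ?thesis
        using Legendre_range[of "12 * a * h" "int p"] Legendre_range[of "int v" "int p"]
          Legendre_range[of "x + int w" "int p"] by (auto simp: \<eta>_def)
    qed
    have "x \<in> run \<eta>" using step x X(1) by (auto simp: run_def)
    moreover have "\<eta> \<in> {1, -1}" using step[of 1] k by auto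
    ultimately show "x \<in> run 1 \<union> run (-1)" by auto
  qed
  moreover have fin: "finite (run \<eta>)" for \<eta> unfolding run_def by (rule finite_subset[of _ "{0..<int p}"]) auto
  ultimately have "card X \<le> card (run 1 \<union> run (-1))" by (intro card_mono) auto
  also have "\<dots> \<le> card (run 1) + card (run (-1))" by (rule card_Un_le)
  finally have "real (card X) \<le> real (card (run 1)) + real (card (run (-1)))" by linarith
  moreover have "real (card (run \<eta>)) \<le> p / 2 ^ k + 3 * real k * real p / real t + 3 * real k" if "\<eta> \<in> {1, -1}" for \<eta>
    unfolding run_def using p t k that by (intro card_Legendre_runs_le) auto
  ultimately have "real (card X) \<le> 2 * (p / 2 ^ k + 3 * real k * real p / real t + 3 * real k)"
    by (smt (verit) insertCI)
  thus ?thesis using I(3) X(3) by blast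
qed

text \<open>With at least eight primes, discarding four loses at most half of them, and
  \<open>off\<close> makes the off-diagonal term no larger than the diagonal one. So
  \<open>i * card P\<close> is at most \<open>8 * x\<close>, and the bounds for \<open>i\<close> and
  \<open>x\<close> are inserted.\<close>

lemma final_inequality:
  fixes N V0 V T k t :: nat and P :: "nat set"
  assumes N: "N > 0" "2 * int N \<le> H" and Np: "18 * N ^ 5 < p"
    and T: "\<And>m::nat. 0 < m \<Longrightarrow> m \<le> 3 * N ^ 5 \<Longrightarrow> card {d. d dvd m} \<le> T"
    and P: "\<And>v. v \<in> P \<Longrightarrow> prime v \<and> V0 \<le> v \<and> v \<le> V" "8 \<le> card P"
    and V: "0 < V0" "6 * N * V ^ 5 < p" "3 * N * V ^ 2 < V0 ^ 5" "V ^ 2 < V0 ^ 3" "V * k \<le> N"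
    and k: "1 \<le> k" and t: "t \<ge> 1" "4 * t ^ 2 \<le> p" "4 * (k + 1 + 2 * t) \<le> p"
    and off: "4 * (N div V0 + 1) * (3 + 4 * T) \<le> card P"
  shows "real N ^ 2 * card P / (3 + 4 * T) \<le> 16 * (p / 2 ^ k + 3 * real k * real p / real t + 3 * real k)"
proof -
  obtain i x where ix: "N ^ 2 \<le> i * (3 + 4 * T)"
    "(i * (card P - 4))\<^sup>2 \<le> x * (i * card P + 4 * N ^ 2 * (N div V0 + 1))"
    "real x \<le> 2 * (p / 2 ^ k + 3 * real k * real p / real t + 3 * real k)"
    using counting_inequalities[OF N Np T P(1) V k t] by blast
  define Z where "Z = i * card P"
  have "4 * N ^ 2 * (N div V0 + 1) = N ^ 2 * (4 * (N div V0 + 1))" by (simp only: mult_ac)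
  also have "\<dots> \<le> i * (3 + 4 * T) * (4 * (N div V0 + 1))" using ix(1) by (rule mult_le_mono1)
  also have "\<dots> = i * (4 * (N div V0 + 1) * (3 + 4 * T))" by (simp only: mult_ac)
  also have "\<dots> \<le> Z" unfolding Z_def using off by simp
  finally have Y: "4 * N ^ 2 * (N div V0 + 1) \<le> Z" .
  have Z0: "Z > 0" using ix(1) N P(2) by (auto simp: Z_def intro!: Nat.gr0I)
  have "Z \<le> 2 * (i * (card P - 4))"
  proof -
    have "card P \<le> 2 * (card P - 4)" using P(2) by simp
    from mult_le_mono2[OF this, of i] show ?thesis by (simp add: Z_def mult_ac)
  qed
  hence "Z ^ 2 \<le> (2 * (i * (card P - 4))) ^ 2" by (intro power_mono) auto
  also have "\<dots> = 4 * (i * (card P - 4)) ^ 2" by (simp add: power_mult_distrib)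
  also have "\<dots> \<le> 4 * (x * (i * card P + 4 * N ^ 2 * (N div V0 + 1)))" using ix(2) by simp
  also have "\<dots> \<le> 4 * (x * (Z + Z))" using Y by (intro mult_left_mono add_mono) (auto simp: Z_def)
  finally have "Z * Z \<le> Z * (8 * x)" by (simp add: power2_eq_square mult_ac)
  hence Zx: "Z \<le> 8 * x" using Z0 by (simp only: nat_mult_le_cancel_disj)
  have "real (N ^ 2) * card P \<le> real (i * (3 + 4 * T)) * card P"
    using ix(1) by (intro mult_right_mono) (auto simp only: of_nat_le_iff of_nat_0_le_iff)
  also have "\<dots> = real Z * (3 + 4 * T)" by (simp add: Z_def)
  finally have "real N ^ 2 * card P / (3 + 4 * T) \<le> real Z" by (simp add: divide_le_eq)
  also have "\<dots> \<le> 8 * real x" using Zx by linarith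
  also have "\<dots> \<le> 16 * (p / 2 ^ k + 3 * real k * real p / real t + 3 * real k)" using ix(3) by linarith
  finally show ?thesis .
qed

end

subsection \<open>Choice of the parameters\<close>

text \<open>The powers stand for \<open>N\<close> (exponent 1/6 + e), the upper end \<open>V\<close>
  (1/6 - e/2) and lower end \<open>V0\<close> (1/6 - e) of the range of primes, a lower bound for
  the number of primes (1/6 - 3e/4) and a bound for \<open>3 + 4 * T\<close> (e/4). The product of
  \<open>N\<close> and \<open>V ^ 5\<close> has exponent 1 - 3e/2, just below 1. In the last clause
  the left side has order x^(1/2 + e), the right side x^(1/2) log x.\<close>

lemma eventually_parameters:
  fixes e C :: real
  assumes e: "e > 0" "e \<le> 1 / 100" and C: "C > 0"
  shows "\<forall>\<^sub>F x in at_top.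
    18 * (x powr (1/6 + e)) ^ 5 < x \<and> x powr (1/6 + e) \<ge> 2 \<and> x powr (1/6 - e/2) \<ge> 8 \<and>
    x powr (1/6 - e) \<ge> 1 \<and> 6 * x powr (1/6 + e) * (x powr (1/6 - e/2)) ^ 5 < x \<and>
    3 * x powr (1/6 + e) * (x powr (1/6 - e/2)) ^ 2 < (x powr (1/6 - e)) ^ 5 \<and>
    (x powr (1/6 - e/2)) ^ 2 < (x powr (1/6 - e)) ^ 3 \<and>
    x powr (1/6 - e/2) * (log 2 x + 1) \<le> x powr (1/6 + e) / 2 \<and> sqrt x \<ge> 8 \<and>
    4 * ((log 2 x + 1) + 1 + 2 * (sqrt x / 4)) \<le> x \<and>
    x powr (1/6 - 3*e/4) \<le> x powr (1/6 - e/2) / (8 * ln x) - 2 * x powr (1/6 - e) \<and>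
    x powr (1/6 - 3*e/4) \<ge> 8 \<and> 3 + 4 * (C * x powr (e/8)) \<le> x powr (e/4) \<and>
    4 * (x powr (1/6 + e) / x powr (1/6 - e) + 1) * x powr (e/4) \<le> x powr (1/6 - 3*e/4) \<and>
    (x powr (1/6 + e) / 2) ^ 2 * x powr (1/6 - 3*e/4) / x powr (e/4) >
      16 * (1 + 3 * (log 2 x + 1) * x / (sqrt x / 8) + 3 * (log 2 x + 1))"
  using assms by (intro eventually_conj; real_asymp)

lemma not_sparse_cubic:
  fixes e :: real
  assumes e: "e > 0" "e \<le> 1 / 100"
  shows "\<exists>x0. \<forall>p a c H. real p \<ge> x0 \<longrightarrow> real_of_int H \<ge> 2 * real p powr (1/6 + e) \<longrightarrow>
    \<not> sparse_cubic p a c H"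
proof -
  obtain C where C: "C > 0" "\<And>n::nat. n > 0 \<Longrightarrow> real (card {d. d dvd n}) \<le> C * real n powr (e/8)"
    using divisor_bound[of "e/8"] e by auto
  from eventually_parameters[OF e C(1)] obtain x0 where x0: "\<And>x. x \<ge> x0 \<Longrightarrow>
    18 * (x powr (1/6 + e)) ^ 5 < x \<and> x powr (1/6 + e) \<ge> 2 \<and> x powr (1/6 - e/2) \<ge> 8 \<and>
    x powr (1/6 - e) \<ge> 1 \<and> 6 * x powr (1/6 + e) * (x powr (1/6 - e/2)) ^ 5 < x \<and>
    3 * x powr (1/6 + e) * (x powr (1/6 - e/2)) ^ 2 < (x powr (1/6 - e)) ^ 5 \<and>
    (x powr (1/6 - e/2)) ^ 2 < (x powr (1/6 - e)) ^ 3 \<and>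
    x powr (1/6 - e/2) * (log 2 x + 1) \<le> x powr (1/6 + e) / 2 \<and> sqrt x \<ge> 8 \<and>
    4 * ((log 2 x + 1) + 1 + 2 * (sqrt x / 4)) \<le> x \<and>
    x powr (1/6 - 3*e/4) \<le> x powr (1/6 - e/2) / (8 * ln x) - 2 * x powr (1/6 - e) \<and>
    x powr (1/6 - 3*e/4) \<ge> 8 \<and> 3 + 4 * (C * x powr (e/8)) \<le> x powr (e/4) \<and>
    4 * (x powr (1/6 + e) / x powr (1/6 - e) + 1) * x powr (e/4) \<le> x powr (1/6 - 3*e/4) \<and>
    (x powr (1/6 + e) / 2) ^ 2 * x powr (1/6 - 3*e/4) / x powr (e/4) >
      16 * (1 + 3 * (log 2 x + 1) * x / (sqrt x / 8) + 3 * (log 2 x + 1))"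
    unfolding eventually_at_top_linorder by blast
  have "\<not> sparse_cubic p a c H"
    if px0: "real p \<ge> x0" and H: "real_of_int H \<ge> 2 * real p powr (1/6 + e)" for p a c H
  proof
    assume "sparse_cubic p a c H"
    then interpret sparse_cubic p a c H .
    define x y z w m g l where "x = real p" "y = x powr (1/6 + e)" "z = x powr (1/6 - e/2)"
      "w = x powr (1/6 - e)" "m = x powr (1/6 - 3*e/4)" "g = x powr (e/4)" "l = log 2 x + 1"
    note defs = x_y_z_w_m_g_l_def
    have par: "18 * y ^ 5 < x" "y \<ge> 2" "z \<ge> 8" "w \<ge> 1" "6 * y * z ^ 5 < x" "3 * y * z ^ 2 < w ^ 5"
      "z ^ 2 < w ^ 3" "z * l \<le> y / 2" "sqrt x \<ge> 8" "4 * (l + 1 + 2 * (sqrt x / 4)) \<le> x"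
      "m \<le> z / (8 * ln x) - 2 * w" "m \<ge> 8" "3 + 4 * (C * x powr (e/8)) \<le> g"
      "4 * (y / w + 1) * g \<le> m" "(y / 2) ^ 2 * m / g > 16 * (1 + 3 * l * x / (sqrt x / 8) + 3 * l)"
      using x0[OF px0] by (simp_all only: defs)
    have x3: "x > 3" using p(2) by (simp add: defs)
    have g0: "g > 0" using x3 by (simp add: defs)
    define N where "N = nat \<lfloor>y\<rfloor>"
    \<comment> \<open>The prime count is bounded below at odd numbers \<open>2 * n + 1\<close>; a
      quarter of \<open>z\<close> leaves room for the extra 1 in \<open>V \<le> z\<close>.\<close>
    define n where "n = nat \<lfloor>z / 4\<rfloor>"
    define V where "V = 2 * n + 1"
    define V0 where "V0 = nat \<lceil>w\<rceil>"
    \<comment> \<open>Runs of this length have \<open>2 ^ k \<ge> p\<close>, so the expected count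
      \<open>p / 2 ^ k\<close> is at most 1. Taking \<open>t\<close> near \<open>sqrt x / 4\<close>
      keeps the error term at order x^(1/2) log x.\<close>
    define k where "k = nat \<lceil>log 2 x\<rceil>"
    define t where "t = nat \<lfloor>sqrt x / 4\<rfloor>"
    define T where "T = nat \<lfloor>C * x powr (e/8)\<rfloor>"
    define P where "P = {q. prime q \<and> V0 \<le> q \<and> q \<le> V}"
    have N: "real N \<le> y" "y / 2 \<le> real N" unfolding N_def using par(2) by linarith+
    have n: "real n \<le> z / 4" "z / 8 \<le> real n" unfolding n_def using par(3) by linarith+
    have V: "real V \<le> z" unfolding V_def using n par(3) by simp
    have V0: "w \<le> real V0" "real V0 \<le> 2 * w" unfolding V0_def using par(4) by linarith+
    have log0: "log 2 x > 0" using x3 by simp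
    have k: "log 2 x \<le> real k" "real k \<le> l" "k \<ge> 1" unfolding k_def defs(7) using log0 by linarith+
    have t: "real t \<le> sqrt x / 4" "sqrt x / 8 \<le> real t" unfolding t_def using par(9) by linarith+
    have T: "real T \<le> C * x powr (e/8)" unfolding T_def using C(1) by simp
    have lt_p: "u < p" if "real u < x" for u using that by (simp add: defs)
    have Np: "18 * N ^ 5 < p"
    proof (rule lt_p)
      have "real N ^ 5 \<le> y ^ 5" using N by (intro power_mono) auto
      thus "real (18 * N ^ 5) < x" using par(1) by simp
    qed
    have T': "card {d. d dvd u} \<le> T" if u: "0 < u" "u \<le> 3 * N ^ 5" for u :: nat
    proof -
      have "real (card {d. d dvd u}) \<le> C * real u powr (e/8)" using C(2)[OF u(1)] .
      also have "\<dots> \<le> C * x powr (e/8)"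
        using C(1) e u Np by (intro mult_left_mono powr_mono2) (auto simp: defs)
      finally show ?thesis unfolding T_def by linarith
    qed
    have P: "prime v \<and> V0 \<le> v \<and> v \<le> V" if "v \<in> P" for v using that by (simp add: P_def)
    have cP: "m \<le> real (card P)"
    proof -
      \<comment> \<open>Primes up to \<open>V\<close> are counted by the lower bound of Chebyshev
        type, and at most \<open>V0\<close> of them lie below \<open>V0\<close>.\<close>
      define \<pi> where "\<pi> = card {q. prime q \<and> q \<le> V}"
      have "4 ^ n \<le> V ^ \<pi>"
        unfolding V_def \<pi>_def using n par(3) by (intro four_power_le_power_card_primes) linarith
      hence "real (4 ^ n) \<le> real (V ^ \<pi>)" by (simp only: of_nat_le_iff)
      hence "ln (4 ^ n) \<le> ln (real V ^ \<pi>)" by (subst ln_le_cancel_iff) (auto simp: V_def)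
      hence "real n * ln 4 \<le> real \<pi> * ln (real V)" by (simp add: ln_realpow V_def)
      also have "\<dots> \<le> real \<pi> * ln x"
      proof (intro mult_left_mono)
        have "z \<le> x powr 1" unfolding defs(3) using x3 e by (intro powr_mono) auto
        hence "real V \<le> x" using V x3 by simp
        thus "ln (real V) \<le> ln x" by (subst ln_le_cancel_iff) (use x3 in \<open>auto simp: V_def\<close>)
      qed simp
      finally have "real n * ln 4 \<le> real \<pi> * ln x" .
      moreover have "real n * 1 \<le> real n * ln 4"
      proof (intro mult_left_mono)
        have "exp 1 \<le> (4::real)" using exp_le by simp
        thus "1 \<le> ln (4::real)" by (simp add: ln_ge_iff)
      qed simp
      ultimately have "z / 8 \<le> real \<pi> * ln x" using n by linarith
      hence "z / (8 * ln x) \<le> real \<pi>" using x3 by (simp add: field_simps)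
      moreover have "\<pi> \<le> card P + V0"
      proof -
        have "{q. prime q \<and> q \<le> V} \<subseteq> P \<union> {..<V0}" by (auto simp: P_def)
        hence "\<pi> \<le> card (P \<union> {..<V0})" unfolding \<pi>_def by (intro card_mono) (auto simp: P_def)
        also have "\<dots> \<le> card P + V0" using card_Un_le[of P "{..<V0}"] by simp
        finally show ?thesis .
      qed
      ultimately show ?thesis using par(11) V0 by linarith
    qed
    have gT: "real (3 + 4 * T) \<le> g" using T par(13) by simp
    have upper: "real N ^ 2 * card P / (3 + 4 * T) \<le> 16 * (p / 2 ^ k + 3 * real k * real p / real t + 3 * real k)"
    proof (rule final_inequality[OF _ _ Np T' P])
      show "N > 0" using N par(2) by linarith
      show "2 * int N \<le> H" using N H unfolding defs(1,2) by linarith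
      show "8 \<le> card P" using cP par(12) by linarith
      show "0 < V0" using V0 par(4) by linarith
      show "6 * N * V ^ 5 < p"
      proof (rule lt_p)
        have "real N * real V ^ 5 \<le> y * z ^ 5" using N V par by (intro mult_mono power_mono) auto
        thus "real (6 * N * V ^ 5) < x" using par(5) by simp
      qed
      show "3 * N * V ^ 2 < V0 ^ 5"
      proof -
        have "real N * real V ^ 2 \<le> y * z ^ 2" using N V par by (intro mult_mono power_mono) auto
        moreover have "w ^ 5 \<le> real V0 ^ 5" using V0 par by (intro power_mono) auto
        ultimately have "real (3 * N * V ^ 2) < real (V0 ^ 5)" using par(6) by simp
        thus ?thesis by (simp only: of_nat_less_iff)
      qed
      show "V ^ 2 < V0 ^ 3"
      proof -
        have "real V ^ 2 \<le> z ^ 2" using V by (intro power_mono) auto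
        moreover have "w ^ 3 \<le> real V0 ^ 3" using V0 par by (intro power_mono) auto
        ultimately have "real (V ^ 2) < real (V0 ^ 3)" using par(7) by simp
        thus ?thesis by (simp only: of_nat_less_iff)
      qed
      show "V * k \<le> N"
      proof -
        have "real V * real k \<le> z * l" using V k par by (intro mult_mono) auto
        hence "real (V * k) \<le> real N" using par(8) N by simp
        thus ?thesis by (simp only: of_nat_le_iff)
      qed
      show "1 \<le> k" by (rule k(3))
      show "1 \<le> t" using t par(9) by linarith
      show "4 * t ^ 2 \<le> p"
      proof -
        have "real t ^ 2 \<le> (sqrt x / 4) ^ 2" using t by (intro power_mono) auto
        also have "\<dots> = x / 16" using x3 by (simp add: power_divide)
        finally have "real (4 * t ^ 2) \<le> real p" using x3 by (simp add: defs(1))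
        thus ?thesis by (simp only: of_nat_le_iff)
      qed
      show "4 * (k + 1 + 2 * t) \<le> p"
      proof -
        have "real (4 * (k + 1 + 2 * t)) \<le> real p" using k t par(10) unfolding defs(1) by simp
        thus ?thesis by (simp only: of_nat_le_iff)
      qed
      show "4 * (N div V0 + 1) * (3 + 4 * T) \<le> card P"
      proof -
        have "real (N div V0) \<le> real N / real V0" by (rule of_nat_div_le_of_nat)
        also have "\<dots> \<le> y / w" using N V0 par by (intro frac_le) auto
        finally have "4 * (real (N div V0) + 1) * real (3 + 4 * T) \<le> 4 * (y / w + 1) * g"
          using gT par by (intro mult_mono) auto
        also have "\<dots> \<le> real (card P)" using par(14) cP by linarith
        finally have "real (4 * (N div V0 + 1) * (3 + 4 * T)) \<le> real (card P)"
          by (simp only: of_nat_mult of_nat_add of_nat_1 of_nat_numeral)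
        thus ?thesis by (simp only: of_nat_le_iff)
      qed
    qed
    have lower: "(y / 2) ^ 2 * m / g \<le> real N ^ 2 * card P / (3 + 4 * T)"
    proof -
      have "(y / 2) ^ 2 * m \<le> real N ^ 2 * card P"
        using N cP par by (intro mult_mono power_mono) auto
      thus ?thesis using gT g0 par by (intro frac_le) auto
    qed
    have "p / 2 ^ k + 3 * real k * real p / real t + 3 * real k \<le>
        1 + 3 * l * x / (sqrt x / 8) + 3 * l"
    proof (intro add_mono)
      have "x = 2 powr (log 2 x)" using x3 by simp
      also have "\<dots> \<le> 2 powr (real k)" using k by (intro powr_mono) auto
      finally have "x \<le> 2 ^ k" by (simp add: powr_realpow)
      thus "p / 2 ^ k \<le> 1" by (simp add: defs(1))
      show "3 * real k * real p / real t \<le> 3 * l * x / (sqrt x / 8)"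
        using k t par(9) x3 unfolding defs(1) by (intro frac_le mult_mono) auto
      show "3 * real k \<le> 3 * l" using k by simp
    qed
    hence "16 * (p / 2 ^ k + 3 * real k * real p / real t + 3 * real k) \<le>
        16 * (1 + 3 * l * x / (sqrt x / 8) + 3 * l)" by (rule mult_left_mono) simp
    from leD[OF order_trans[OF lower order_trans[OF upper this]]] par(15) show False by contradiction
  qed
  thus ?thesis by blast
qed

theorem theorem2:
  "\<forall>\<epsilon>::real. \<epsilon> > 0 \<longrightarrow> (\<exists>C::real. C > 0 \<and>
     (\<forall>(p::int) (a::int) (c::int) (H::int).
        prime p \<longrightarrow> p > 3 \<longrightarrow> gcd a p = 1 \<longrightarrow> H > 0 \<longrightarrow>
        real_of_int H \<ge> C * (real_of_int p) powr (1/6 + \<epsilon>) \<longrightarrow>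
        (\<exists>X Y. 0 \<le> X \<and> X \<le> p - 1 \<and> 0 \<le> Y \<and> Y \<le> p - 1 \<and>
           card (curve_pts p a c \<inter> box_pts p X Y H) \<ge> 2)))"
proof (intro allI impI)
  fix \<epsilon> :: real assume \<epsilon>: "\<epsilon> > 0"
  \<comment> \<open>Lowering the exponent only weakens the demand on \<open>H\<close>, and the
    choice of parameters needs it small.\<close>
  define e where "e = min \<epsilon> (1 / 100)"
  have e: "e > 0" "e \<le> 1 / 100" "e \<le> \<epsilon>" using \<epsilon> by (auto simp: e_def)
  obtain x0 where x0: "\<And>p a c H. real p \<ge> x0 \<Longrightarrow> real_of_int H \<ge> 2 * real p powr (1/6 + e) \<Longrightarrow>
      \<not> sparse_cubic p a c H"
    using not_sparse_cubic[OF e(1,2)] by blast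
  \<comment> \<open>With \<open>C \<ge> x0\<close> the primes below \<open>x0\<close> are settled at
    once, as then \<open>H \<ge> p\<close> and the box is the whole plane.\<close>
  define C where "C = max 2 x0"
  have C: "C \<ge> 2" "C \<ge> x0" by (auto simp: C_def)
  show "\<exists>C::real. C > 0 \<and>
     (\<forall>(p::int) (a::int) (c::int) (H::int).
        prime p \<longrightarrow> p > 3 \<longrightarrow> gcd a p = 1 \<longrightarrow> H > 0 \<longrightarrow>
        real_of_int H \<ge> C * (real_of_int p) powr (1/6 + \<epsilon>) \<longrightarrow>
        (\<exists>X Y. 0 \<le> X \<and> X \<le> p - 1 \<and> 0 \<le> Y \<and> Y \<le> p - 1 \<and>
           card (curve_pts p a c \<inter> box_pts p X Y H) \<ge> 2))"
  proof (intro exI[of _ C] conjI allI impI)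
    show "C > 0" using C by simp
  next
    fix p a c H :: int
    assume p: "prime p" "p > 3" and a: "gcd a p = 1" and "H > 0"
      and H: "real_of_int H \<ge> C * (real_of_int p) powr (1/6 + \<epsilon>)"
    show "\<exists>X Y. 0 \<le> X \<and> X \<le> p - 1 \<and> 0 \<le> Y \<and> Y \<le> p - 1 \<and>
        card (curve_pts p a c \<inter> box_pts p X Y H) \<ge> 2"
    proof (cases "real_of_int p \<ge> x0")
      case False
      have "C * 1 \<le> C * real_of_int p powr (1/6 + \<epsilon>)"
        using C p \<epsilon> by (intro mult_left_mono ge_one_powr_ge_zero) auto
      hence "real_of_int H \<ge> real_of_int p" using False C H by linarith
      hence "2 \<le> card (curve_pts p a c \<inter> box_pts p 0 0 H)"
        using p by (intro two_points_if_side_ge_p) auto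
      thus ?thesis using p by (intro exI[of _ 0]) auto
    next
      case True
      define q where "q = nat p"
      have q: "p = int q" using p by (simp add: q_def)
      have "2 * real q powr (1/6 + e) \<le> C * real_of_int p powr (1/6 + \<epsilon>)"
        using C e p unfolding q by (intro mult_mono powr_mono) auto
      hence "\<not> sparse_cubic q a c H" using True H unfolding q by (intro x0) auto
      moreover have "\<not> int q dvd a"
      proof
        assume "int q dvd a"
        hence "p dvd gcd a p" by (simp add: q)
        thus False using a p by simp
      qed
      moreover have "prime q" "q > 3" using p by (auto simp: q)
      ultimately show ?thesis unfolding sparse_cubic_def q by blast
    qed
  qed
qed



end
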